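(* Let $\rho:F_g\to\mathrm{PSL}(4k+3,\mathbb{R})$ be a purely hyperbolic (Anosov) Schottky representation of the free group $F_g$ on $g$ generators, and let $D\subset S^{4k+2}$ be the orbit $D=\bigcup_{\gamma\in F_g}\rho(\gamma)P$ of the set $P=S^{4k+2}\setminus\bigcup_{i=1}^{2g}\mathcal{H}(F_i,G_i)$, where $(\!(F_1,G_1)\!),\dots,(\!(F_{2g},G_{2g})\!)$ are the Schottky intervals defining $\rho$. Then the properly discontinuous and cocompact action of $F_g$ on $D$ via $\rho$ admits a fundamental domain bounded by finitely many polyhedral hypersurfaces.
   Context: Here $k\ge 0$ and $g\ge 1$ are integers and $n=4k+3$ (odd). Oriented flags. $\mathbb{R}^n$ has its standard orientation. $\mathrm{Flag}^+(\mathbb{R}^n)$ is the set of complete flags $F^{(1)}\subset\dots\subset F^{(n-1)}$ in $\mathbb{R}^n$ ($\dim F^{(i)}=i$) with a choice of orientation on each $F^{(i)}$. $\mathrm{PSL}(n,\mathbb{R})=\mathrm{SL}(n,\mathbb{R})$ acts on it, and on the sphere $S^{n-1}=(\mathbb{R}^n\setminus\{0\})/\mathbb{R}_{>0}$. Direct sums of oriented subspaces are oriented by concatenating positive bases in order; $F^{(0)}=\{0\}$. A triple $(F_1,F_2,F_3)$ is hyperconvex if $F_1^{(i_1)}\oplus F_2^{(i_2)}\oplus F_3^{(i_3)}=\mathbb{R}^n$ as oriented vector spaces for all integers $0\le i_1,i_2,i_3\le n-1$ with $i_1+i_2+i_3=n$. Intervals are $(\!(F,G)\!)=\{H: (F,H,G)\text{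 hyperconvex}\}$, with opposite $-(\!(F,G)\!)=(\!(G,F)\!)$. A pair $(F_1,F_2)$ is oriented transverse if $F_1^{(i)}\oplus F_2^{(n-i)}=\mathbb{R}^n$ as oriented spaces for $1\le i\le n-1$. For such a pair there is a positively oriented ordered basis $\mathcal{E}=(e_1,\dots,e_n)$, unique up to positive scaling of the basis vectors, such that $F_1^{(i)}=\mathrm{span}(e_1,\dots,e_i)$ and $F_2^{(i)}=\mathrm{span}(e_{n-i+1},\dots,e_n)$, each span oriented by the listed order; $\mathcal{E}$ is called adapted to $(F_1,F_2)$. Halfspaces in the sphere. $S^+_{\mathcal{E}}(v)$ is the maximal number of sign changes in the sequence of coordinates of $v\ne0$ in the basis $\mathcal{E}$, over all ways of assigning signs to zero coordinates. (Trailing zero coordinates receive a unique sign when maximizing, so the sign of the last coordinate used in determining $S^+_{\mathcal{E}}(v)$ is well defined.) For an oriented transverse pair $(F_1,F_2)$ with adapted basis $\mathcal{E}$, $\mathcal{H}(F_1,F_2)$ is the set of $[v]\in S^{4k+2}$ with $S^+_{\mathcal{E}}(v)\le 2k+1$ and such that, in case of equality, the sign of the last coordinate of $v$ used in determining $S^+_{\mathcal{E}}(v)$ is positive. Purely hyperbolic Schottky representations. $\mathbb{RP}^1$ carries its standard cyclic order, $(a,b)\subset\mathbb{RP}^1$ is the set of $x$ with $(a,x,b)$ positively ordered, and $-(a,b)=(b,a)$. Let $A_1,\dots,A_g\in\mathrm{PSL}(2,\mathbb{R})$ and let $I_j^\pm=(a_j^\pm,b_j^\pm)\subset\mathbb{RP}^1$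 be $2g$ intervals with pairwise disjoint closures such that $A_j(-I_j^-)=I_j^+$; then $\Gamma=\langle A_1,\dots,A_g\rangle\cong F_g$ is free on the $A_j$. Let $\xi_0$ be a map from the set of endpoints of the $I_j^\pm$ to $\mathrm{Flag}^+(\mathbb{R}^n)$ sending positively cyclically ordered triples to hyperconvex triples. Put $J_j^\pm=(\!(\xi_0(a_j^\pm),\xi_0(b_j^\pm))\!)$ and let $h_1,\dots,h_g\in\mathrm{PSL}(n,\mathbb{R})$ satisfy $h_j\xi_0(b_j^-)=\xi_0(a_j^+)$, $h_j\xi_0(a_j^-)=\xi_0(b_j^+)$, so $h_j(-J_j^-)=J_j^+$. The homomorphism $\rho:F_g\cong\Gamma\to\mathrm{PSL}(n,\mathbb{R})$, $A_j\mapsto h_j$, is a purely hyperbolic Schottky representation (such representations are Anosov with respect to the Borel subgroup), and the $2g$ intervals $J_j^\pm$, listed in cyclic order as $(\!(F_i,G_i)\!)$, are its Schottky intervals. Fundamental domain: a closed subset of $D$ whose translates under $\rho(F_g)$ cover $D$ and such that it and its translate by $\rho(\gamma)$ have disjoint interiors for all $\gamma\ne 1$. Polyhedral hypersurface: a hypersurface in $S^{4k+2}$ made of finitely many pieces, each the image of a convex polyhedral cone in a linear hyperplane of $\mathbb{R}^{4k+3}$. *)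

theory Defs
  imports "HOL-Analysis.Analysis" "HOL-Algebra.Group" "Jordan_Normal_Form.Determinant"
begin

section \<open>Oriented subspaces and oriented flags\<close>

text \<open>
  The index type of \<open>real ^ 'n\<close> is linearly ordered, so that the standard basis is an ordered
  basis and the standard orientation makes sense. An orientation of a subspace is an equivalence
  class of ordered bases modulo change of basis with positive determinant. The zero space has the
  single ordered basis \<open>[]\<close> and hence exactly one orientation.
\<close>

type_synonym 'n oriented_subspace = "(real ^ 'n) set \<times> (real ^ 'n) list set"

definition ordered_bases :: "(real ^ 'n::finite) set \<Rightarrow> (real ^ 'n) list set" where
  "ordered_bases V = {b. distinct b \<and> independent (set b) \<and> span (set b) = V}"

definition same_orientation ::
    "(real ^ 'n::finite) set \<Rightarrow> ((real ^ 'n) list \<times> (real ^ 'n) list) set" where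
  "same_orientation V =
     {(b, c). b \<in> ordered_bases V \<and> c \<in> ordered_bases V \<and>
        (\<exists>M \<in> carrier_mat (length b) (length b). Determinant.det M > 0 \<and>
           (\<forall>j < length b. c ! j = (\<Sum>i < length b. (M $$ (i, j)) *\<^sub>R (b ! i))))}"

definition orientations :: "(real ^ 'n::finite) set \<Rightarrow> (real ^ 'n) list set set" where
  "orientations V = ordered_bases V // same_orientation V"

definition oriented_span :: "(real ^ 'n::finite) list \<Rightarrow> 'n oriented_subspace" where
  "oriented_span b = (span (set b), same_orientation (span (set b)) `` {b})"

definition standard_space :: "('n::{finite,linorder}) oriented_subspace" where
  "standard_space = oriented_span (map (\<lambda>i. axis i 1) (sorted_list_of_set UNIV))"

text \<open>
  If the sum is not direct, no concatenation is an ordered basis and the second component is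
  empty. So \<open>oriented_sum X Y\<close> being equal to a space with an orientation entails that the sum
  is direct.
\<close>

definition oriented_sum ::
    "'n::finite oriented_subspace \<Rightarrow> 'n oriented_subspace \<Rightarrow> 'n oriented_subspace" where
  "oriented_sum X Y =
     (let V = {x + y | x y. x \<in> fst X \<and> y \<in> fst Y}
      in (V, \<Union>b \<in> snd X. \<Union>c \<in> snd Y. same_orientation V `` {b @ c}))"

text \<open>The zero space is included as the entry of index 0, and entries of index at least
  \<open>CARD('n)\<close> are \<open>undefined\<close>.\<close>

type_synonym 'n oriented_flag = "nat \<Rightarrow> 'n oriented_subspace"

definition oriented_flags :: "'n::finite oriented_flag set" where
  "oriented_flags =
     {F \<in> extensional {..<CARD('n)}.
        (\<forall>i < CARD('n). subspace (fst (F i)) \<and> dim (fst (F i)) = i \<and>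
                         snd (F i) \<in> orientations (fst (F i))) \<and>
        (\<forall>i. Suc i < CARD('n) \<longrightarrow> fst (F i) \<subseteq> fst (F (Suc i)))}"

definition flag_act :: "real ^ 'n ^ 'n \<Rightarrow> 'n::finite oriented_flag \<Rightarrow> 'n oriented_flag" where
  "flag_act A F =
     (\<lambda>i \<in> {..<CARD('n)}. ((\<lambda>x. A *v x) ` fst (F i), map (\<lambda>x. A *v x) ` snd (F i)))"

definition hyperconvex ::
    "('n::{finite,linorder}) oriented_flag \<Rightarrow> 'n oriented_flag \<Rightarrow> 'n oriented_flag \<Rightarrow> bool" where
  "hyperconvex F1 F2 F3 \<longleftrightarrow>
     (\<forall>i1 i2 i3. i1 < CARD('n) \<and> i2 < CARD('n) \<and> i3 < CARD('n) \<and> i1 + i2 + i3 = CARD('n) \<longrightarrow>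
        oriented_sum (oriented_sum (F1 i1) (F2 i2)) (F3 i3) = standard_space)"

definition adapted_basis ::
    "'n oriented_flag \<Rightarrow> 'n oriented_flag \<Rightarrow> (real ^ 'n::{finite,linorder}) list \<Rightarrow> bool" where
  "adapted_basis F1 F2 e \<longleftrightarrow>
     e \<in> ordered_bases UNIV \<and> oriented_span e = standard_space \<and>
     (\<forall>i \<in> {1..<CARD('n)}. F1 i = oriented_span (take i e) \<and>
                             F2 i = oriented_span (drop (CARD('n) - i) e))"


section \<open>Halfspaces in the sphere\<close>

text \<open>
  The sphere \<open>(\<real>\<^sup>n - {0}) / \<real>\<^sub>>\<^sub>0\<close> is represented by the unit sphere, each ray by
  its unit vector. Then \<open>sgn\<close>, which is \<open>x /\<^sub>R norm x\<close>, is the quotient map.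
\<close>

definition sphere_act :: "real ^ 'n ^ 'n \<Rightarrow> real ^ 'n \<Rightarrow> real ^ 'n::finite" where
  "sphere_act A x = sgn (A *v x)"

definition sign_assignments :: "real list \<Rightarrow> real list set" where
  "sign_assignments c =
     {s. length s = length c \<and>
         (\<forall>i < length c. s ! i \<in> {-1, 1} \<and> (c ! i \<noteq> 0 \<longrightarrow> s ! i = sgn (c ! i)))}"

definition sign_changes :: "real list \<Rightarrow> nat" where
  "sign_changes s = card {i. Suc i < length s \<and> s ! i \<noteq> s ! Suc i}"

definition max_sign_changes :: "real list \<Rightarrow> nat" where
  "max_sign_changes c = Max (sign_changes ` sign_assignments c)"

definition coordinates :: "(real ^ 'n::finite) list \<Rightarrow> real ^ 'n \<Rightarrow> real list" where
  "coordinates e v = map (representation (set e) v) e"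

text \<open>The parameter \<open>k\<close> is the one in \<open>CARD('n) = 4 * k + 3\<close>. All adapted bases of
  a pair agree up to positive scaling of the vectors, so they define the same halfspace; and all
  maximizing sign assignments of a nonzero vector have the same last sign.\<close>

definition halfspace ::
    "nat \<Rightarrow> 'n oriented_flag \<Rightarrow> 'n oriented_flag \<Rightarrow> (real ^ 'n::{finite,linorder}) set" where
  "halfspace k F1 F2 =
     {v \<in> sphere 0 1. \<exists>e. adapted_basis F1 F2 e \<and>
        max_sign_changes (coordinates e v) \<le> 2 * k + 1 \<and>
        (max_sign_changes (coordinates e v) = 2 * k + 1 \<longrightarrow>
           (\<exists>s \<in> sign_assignments (coordinates e v).
              sign_changes s = max_sign_changes (coordinates e v) \<and> last s = 1))}"


section \<open>The projective line\<close>

definition RP1 :: "(real ^ 2) set set" where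
  "RP1 = {span {v} | v. v \<noteq> 0}"

definition RP1_topology :: "(real ^ 2) set topology" where
  "RP1_topology = topology (\<lambda>U. U \<subseteq> RP1 \<and> open {v. v \<noteq> 0 \<and> span {v} \<in> U})"

lemma openin_RP1_topology:
  "openin RP1_topology U \<longleftrightarrow> U \<subseteq> RP1 \<and> open {v. v \<noteq> 0 \<and> span {v} \<in> U}"
proof -
  have "istopology (\<lambda>U. U \<subseteq> RP1 \<and> open {v. v \<noteq> 0 \<and> span {v} \<in> U})"
    unfolding istopology_def
  proof (rule conjI; intro allI impI)
    fix S T :: "(real ^ 2) set set"
    assume S: "S \<subseteq> RP1 \<and> open {v. v \<noteq> 0 \<and> span {v} \<in> S}"
      and T: "T \<subseteq> RP1 \<and> open {v. v \<noteq> 0 \<and> span {v} \<in> T}"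
    have "{v. v \<noteq> 0 \<and> span {v} \<in> S \<inter> T}
          = {v. v \<noteq> 0 \<and> span {v} \<in> S} \<inter> {v. v \<noteq> 0 \<and> span {v} \<in> T}" by auto
    then show "S \<inter> T \<subseteq> RP1 \<and> open {v. v \<noteq> 0 \<and> span {v} \<in> S \<inter> T}"
      using S T by auto
  next
    fix K :: "(real ^ 2) set set set"
    assume K: "\<forall>U\<in>K. U \<subseteq> RP1 \<and> open {v. v \<noteq> 0 \<and> span {v} \<in> U}"
    have "{v. v \<noteq> 0 \<and> span {v} \<in> \<Union>K} = (\<Union>U\<in>K. {v. v \<noteq> 0 \<and> span {v} \<in> U})" by auto
    then show "\<Union>K \<subseteq> RP1 \<and> open {v. v \<noteq> 0 \<and> span {v} \<in> \<Union>K}"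
      using K by auto
  qed
  then show ?thesis
    unfolding RP1_topology_def by (simp add: topology_inverse')
qed

text \<open>For lines spanned by \<open>(x, 1)\<close>, \<open>(y, 1)\<close>, \<open>(z, 1)\<close> the product below is
  \<open>(x - y) * (y - z) * (z - x)\<close>, so that \<open>x < y < z\<close> is positively ordered. Its sign depends on the
  lines only, since every vector occurs twice.\<close>

definition positively_ordered ::
    "(real ^ 2) set \<Rightarrow> (real ^ 2) set \<Rightarrow> (real ^ 2) set \<Rightarrow> bool" where
  "positively_ordered x y z \<longleftrightarrow>
     (\<exists>u v w. x = span {u} \<and> y = span {v} \<and> z = span {w} \<and>
        Determinants.det (vector [u, v] :: real ^ 2 ^ 2) * Determinants.det (vector [v, w] :: real ^ 2 ^ 2)
          * Determinants.det (vector [w, u] :: real ^ 2 ^ 2) > 0)"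

definition arc :: "(real ^ 2) set \<Rightarrow> (real ^ 2) set \<Rightarrow> (real ^ 2) set set" where
  "arc a b = {x. positively_ordered a x b}"


section \<open>Purely hyperbolic Schottky representations\<close>

definition SL :: "(real ^ 'n ^ 'n::finite) monoid" where
  "SL = \<lparr>carrier = {A. Determinants.det A = 1}, mult = (**), one = Finite_Cartesian_Product.mat 1\<rparr>"

text \<open>The free group on \<open>{..<g}\<close> consists of the reduced words. The letter \<open>(j, True)\<close> is
  the generator of index \<open>j\<close> and \<open>(j, False)\<close> its inverse.\<close>

fun cancel_cons :: "nat \<times> bool \<Rightarrow> (nat \<times> bool) list \<Rightarrow> (nat \<times> bool) list" where
  "cancel_cons x [] = [x]"
| "cancel_cons x (y # ys) = (if fst x = fst y \<and> snd x \<noteq> snd y then ys else x # y # ys)"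

definition free_group :: "nat \<Rightarrow> (nat \<times> bool) list monoid" where
  "free_group g =
     \<lparr>carrier = {w. set w \<subseteq> {..<g} \<times> UNIV \<and>
                    successively (\<lambda>x y. \<not> (fst x = fst y \<and> snd x \<noteq> snd y)) w},
      mult = (\<lambda>u v. foldr cancel_cons u v), one = []\<rparr>"

text \<open>
  The index \<open>(j, True)\<close> stands for the superscript \<open>+\<close> and \<open>(j, False)\<close> for \<open>-\<close>. An
  element of \<open>PSL(2, \<real>)\<close> is given by one of its two lifts to \<open>SL(2, \<real>)\<close>, which act
  equally on the projective line. The complementary interval of \<open>arc a b\<close> is \<open>arc b a\<close>.
\<close>

definition schottky_intervals ::
    "nat \<Rightarrow> (nat \<Rightarrow> real ^ 2 ^ 2) \<Rightarrow> (nat \<Rightarrow> bool \<Rightarrow> (real ^ 2) set) \<Rightarrow>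
     (nat \<Rightarrow> bool \<Rightarrow> (real ^ 2) set) \<Rightarrow> bool" where
  "schottky_intervals g A a b \<longleftrightarrow>
     (\<forall>j < g. A j \<in> carrier SL) \<and>
     (\<forall>j < g. \<forall>s. a j s \<in> RP1 \<and> b j s \<in> RP1 \<and> a j s \<noteq> b j s) \<and>
     (\<forall>i < g. \<forall>j < g. \<forall>s t. (i, s) \<noteq> (j, t) \<longrightarrow>
        (RP1_topology closure_of arc (a i s) (b i s)) \<inter>
        (RP1_topology closure_of arc (a j t) (b j t)) = {}) \<and>
     (\<forall>j < g. (\<lambda>L. (\<lambda>x. A j *v x) ` L) ` arc (b j False) (a j False)
               = arc (a j True) (b j True))"

definition endpoints ::
    "nat \<Rightarrow> (nat \<Rightarrow> bool \<Rightarrow> (real ^ 2) set) \<Rightarrow> (nat \<Rightarrow> bool \<Rightarrow> (real ^ 2) set) \<Rightarrow>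
     (real ^ 2) set set" where
  "endpoints g a b = {a j s | j s. j < g} \<union> {b j s | j s. j < g}"

text \<open>The representation is defined on the free group on the letters \<open>j < g\<close>, which is identified
  with the group generated by the \<open>A j\<close>. For odd \<open>CARD('n)\<close>, \<open>PSL(n, \<real>)\<close> is
  \<open>SL(n, \<real>)\<close>.\<close>

definition purely_hyperbolic_schottky ::
    "nat \<Rightarrow> (nat \<Rightarrow> real ^ 2 ^ 2) \<Rightarrow> (nat \<Rightarrow> bool \<Rightarrow> (real ^ 2) set) \<Rightarrow>
     (nat \<Rightarrow> bool \<Rightarrow> (real ^ 2) set) \<Rightarrow>
     ((real ^ 2) set \<Rightarrow> 'n oriented_flag) \<Rightarrow>
     ((nat \<times> bool) list \<Rightarrow> real ^ 'n::{finite,linorder} ^ 'n::{finite,linorder}) \<Rightarrow> bool" where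
  "purely_hyperbolic_schottky g A a b \<xi> \<rho> \<longleftrightarrow>
     schottky_intervals g A a b \<and>
     (\<forall>x \<in> endpoints g a b. \<xi> x \<in> oriented_flags) \<and>
     (\<forall>x \<in> endpoints g a b. \<forall>y \<in> endpoints g a b. \<forall>z \<in> endpoints g a b.
        positively_ordered x y z \<longrightarrow> hyperconvex (\<xi> x) (\<xi> y) (\<xi> z)) \<and>
     \<rho> \<in> hom (free_group g) SL \<and>
     (\<forall>j < g. flag_act (\<rho> [(j, True)]) (\<xi> (b j False)) = \<xi> (a j True) \<and>
              flag_act (\<rho> [(j, True)]) (\<xi> (a j False)) = \<xi> (b j True))"


section \<open>Group actions and fundamental domains\<close>

text \<open>In this section \<open>\<rho>\<close> is a homomorphism from \<open>G\<close> to \<open>SL\<close>, and \<open>D\<close> is an invariant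
  subset of the sphere.\<close>

definition properly_discontinuous ::
    "'g monoid \<Rightarrow> ('g \<Rightarrow> real ^ 'n ^ 'n) \<Rightarrow> (real ^ 'n::finite) set \<Rightarrow> bool" where
  "properly_discontinuous G \<rho> D \<longleftrightarrow>
     (\<forall>C. compact C \<and> C \<subseteq> D \<longrightarrow>
        finite {\<gamma> \<in> carrier G. sphere_act (\<rho> \<gamma>) ` C \<inter> C \<noteq> {}})"

definition cocompact ::
    "'g monoid \<Rightarrow> ('g \<Rightarrow> real ^ 'n ^ 'n) \<Rightarrow> (real ^ 'n::finite) set \<Rightarrow> bool" where
  "cocompact G \<rho> D \<longleftrightarrow>
     (\<exists>C. compact C \<and> C \<subseteq> D \<and> D = (\<Union>\<gamma> \<in> carrier G. sphere_act (\<rho> \<gamma>) ` C))"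

definition fundamental_domain ::
    "'g monoid \<Rightarrow> ('g \<Rightarrow> real ^ 'n ^ 'n) \<Rightarrow> (real ^ 'n::finite) set \<Rightarrow> (real ^ 'n) set \<Rightarrow> bool" where
  "fundamental_domain G \<rho> D K \<longleftrightarrow>
     closedin (top_of_set D) K \<and>
     D = (\<Union>\<gamma> \<in> carrier G. sphere_act (\<rho> \<gamma>) ` K) \<and>
     (\<forall>\<gamma> \<in> carrier G. \<gamma> \<noteq> \<one>\<^bsub>G\<^esub> \<longrightarrow>
        (top_of_set D interior_of K) \<inter>
        (top_of_set D interior_of (sphere_act (\<rho> \<gamma>) ` K)) = {})"

text \<open>A topological submanifold of the sphere of codimension one.\<close>

definition hypersurface :: "(real ^ 'n::finite) set \<Rightarrow> bool" where
  "hypersurface S \<longleftrightarrow> S \<subseteq> sphere 0 1 \<and>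
     (\<forall>x \<in> S. \<exists>U. \<exists>W :: (real ^ 'n) set. \<exists>V.
        x \<in> U \<and> openin (top_of_set S) U \<and>
        subspace W \<and> dim W = CARD('n) - 2 \<and> openin (top_of_set W) V \<and> U homeomorphic V)"

definition polyhedral_hypersurface :: "(real ^ 'n::finite) set \<Rightarrow> bool" where
  "polyhedral_hypersurface S \<longleftrightarrow> hypersurface S \<and>
     (\<exists>\<C>. finite \<C> \<and>
        (\<forall>C \<in> \<C>. polyhedron C \<and> cone C \<and> (\<exists>a. a \<noteq> 0 \<and> C \<subseteq> {x. a \<bullet> x = 0})) \<and>
        S = (\<Union>C \<in> \<C>. sgn ` (C - {0})))"

end

theory Submission
  imports Defs
begin

text \<open>
  The fundamental domain is \<open>P\<close> itself. Fix \<open>n = 4 * k + 3\<close> and call a sequence of signs low if it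
  changes sign at most \<open>2 * k\<close> times, or \<open>2 * k + 1\<close> times and ends with plus
  (\<open>low_variation\<close>). For an ordered basis \<open>e\<close> let \<open>closed_half k e\<close> be the set of vectors whose
  coordinates admit a low choice of signs; it is a finite union of closed orthants. The operation
  \<open>alt_rev\<close> reverses a list and alternates signs. It turns a basis adapted to \<open>(F, G)\<close> into one
  adapted to \<open>(G, F)\<close>, and it turns \<open>m\<close> sign changes into \<open>n - 1 - m\<close>, so that exactly one of a sign
  sequence and its image is low. Therefore the halfspace of \<open>(F, G)\<close> is the complement of
  \<open>closed_half k (alt_rev e)\<close>, for \<open>e\<close> adapted to \<open>(F, G)\<close> (\<open>halfspace_eq\<close>); the closed sets
  \<open>closed_half k e\<close> and \<open>closed_half k (alt_rev e)\<close> cover the space, and their common part in the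
  sphere is the boundary of the halfspace, its wall.

  The geometric core is that the closed halves of two different Schottky intervals meet in \<open>0\<close> only
  (\<open>closed_halves_disjoint\<close>). Let \<open>e\<close> and \<open>f\<close> be bases adapted to the two intervals. Hyperconvexity
  of the triples of endpoints says that some determinants of \<open>n\<close> members of the sequence \<open>e @ f\<close>,
  taken in order, are positive. Three-term Grassmann-Pluecker relations propagate positivity to all
  of them. A nontrivial linear relation among \<open>2 * n\<close> vectors with this property changes sign at
  least \<open>n\<close> times (\<open>alternating_dependency\<close>): otherwise there is a linear functional that has the
  sign pattern of the relation along the sequence. A common nonzero vector of the two closed halves
  would give a relation with at most \<open>n - 1\<close> sign changes.

  Since a generator maps the complement of the halfspace of one interval onto the closed half of
  another one, disjointness is the ping-pong situation, abstracted in the locale \<open>ping_pong\<close>: a nonempty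
  reduced word moves \<open>P\<close> into the closed half of its first letter, a word of length at least two
  moves it off \<open>P\<close>, and near its boundary \<open>P\<close> is continued by its translates under single letters.
  This gives the fundamental domain, proper discontinuity, and a frontier that is the union
  of the walls.

  A wall consists of the vectors that admit both a low and a non-low choice of signs. Two such
  choices differ somewhere, so the wall is a finite union of polyhedral cones in coordinate
  hyperplanes. It is a submanifold because a flow crosses it transversally: on the set where the
  \<open>p\<close>-th coordinate is nonzero, let the velocity of each other coordinate be the neighbouring
  coordinate in the direction of \<open>p\<close>. At small positive times a vanishing coordinate takes the sign
  of this neighbour, which minimizes the number of sign changes; at small negative times it takes the
  opposite sign, which maximizes it. So every orbit crosses the wall at most once, from the
  non-low to the low side, and the wall is locally a graph over a slice of the orbits
  (\<open>hypersurface_wall\<close>).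
\<close>

section \<open>Determinants of lists of vectors\<close>

text \<open>The position of an index in the standard order; it turns a list of vectors into the rows of a
  square matrix.\<close>

definition index_rank :: "'n::{finite,linorder} \<Rightarrow> nat" where
  "index_rank i = (THE j. j < CARD('n) \<and> sorted_list_of_set (UNIV :: 'n set) ! j = i)"

lemma index_rank_props:
  fixes i :: "'n::{finite,linorder}"
  shows index_rank_less: "index_rank i < CARD('n)"
    and nth_index_rank: "sorted_list_of_set (UNIV :: 'n set) ! index_rank i = i"
proof -
  have "\<exists>!j. j < CARD('n) \<and> sorted_list_of_set (UNIV :: 'n set) ! j = i"
    by (metis (no_types, lifting) UNIV_I distinct_Ex1 distinct_sorted_list_of_set finite_class.finite_UNIV
        length_sorted_list_of_set set_sorted_list_of_set)
  from theI'[OF this] show "index_rank i < CARD('n)"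
    "sorted_list_of_set (UNIV :: 'n set) ! index_rank i = i"
    unfolding index_rank_def by auto
qed

lemma index_rank_nth:
  fixes j :: nat
  assumes "j < CARD('n)"
  shows "index_rank (sorted_list_of_set (UNIV :: 'n::{finite,linorder} set) ! j) = j"
  by (metis assms distinct_sorted_list_of_set index_rank_less length_sorted_list_of_set
      nth_eq_iff_index_eq nth_index_rank)

lemma bij_index_rank: "bij_betw (index_rank :: 'n \<Rightarrow> nat) UNIV {0..<CARD('n::{finite,linorder})}"
  by (rule bij_betw_byWitness[where f' = "\<lambda>j. sorted_list_of_set (UNIV :: 'n set) ! j"])
    (auto simp: index_rank_nth nth_index_rank index_rank_less)

lemma sum_index_rank:
  fixes h :: "nat \<Rightarrow> 'b::comm_monoid_add"
  shows "(\<Sum>i\<in>UNIV. h (index_rank (i :: 'n::{finite,linorder}))) = (\<Sum>m<CARD('n). h m)"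
  using sum.reindex_bij_betw[OF bij_index_rank[where 'n = 'n], of h]
  by (simp add: lessThan_atLeast0)

lemma index_rank_inj [simp]: "index_rank i = index_rank j \<longleftrightarrow> i = j"
  by (metis nth_index_rank)

text \<open>Orientations compare bases by matrices indexed by numbers, while brackets are determinants over
  the index type, whose rows are the vectors themselves. Both determinants are the same
  sum over permutations, relabelled by \<open>index_rank\<close>.\<close>

lemma det_eq_determinant:
  fixes M :: "real mat"
  assumes "M \<in> carrier_mat CARD('n) CARD('n::{finite,linorder})"
  shows "Determinants.det (\<chi> i j :: 'n. M $$ (index_rank i, index_rank j)) = Determinant.det M"
proof -
  let ?r = "index_rank :: 'n \<Rightarrow> nat"
  let ?n = "CARD('n)"
  let ?E = "\<lambda>j. sorted_list_of_set (UNIV :: 'n set) ! j"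
  have inv1: "inv_into UNIV ?r j = ?E j" if "j < ?n" for j
    by (rule inv_into_f_eq) (auto simp: inj_def index_rank_nth that)
  let ?g = "\<lambda>\<pi> x. if x \<in> {0..<?n} then ?r (\<pi> (inv_into UNIV ?r x)) else x"
  have bij: "bij_betw ?g {\<pi>. \<pi> permutes UNIV} {\<pi>. \<pi> permutes {0..<?n}}"
    by (rule bij_betw_permutations[OF bij_index_rank])
  have range: "range ?r = {0..<?n}"
    using bij_index_rank by (auto simp: bij_betw_def)
  have g_eq: "?g \<pi> = map_permutation UNIV ?r \<pi>" for \<pi>
    by (auto simp: map_permutation_def fun_eq_iff range restrict_id_def)
  have "Determinant.det M = (\<Sum>p | p permutes {0..<?n}. signof p * (\<Prod>i = 0..<?n. M $$ (i, p i)))"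
    by (rule det_def'[OF assms])
  also have "\<dots> = (\<Sum>p | p permutes (UNIV :: 'n set).
      signof (?g p) * (\<Prod>i = 0..<?n. M $$ (i, ?g p i)))"
    by (rule sum.reindex_bij_betw[OF bij, symmetric])
  also have "\<dots> = (\<Sum>p | p permutes (UNIV :: 'n set).
      of_int (sign p) * (\<Prod>i\<in>UNIV. M $$ (?r i, ?r (p i))))"
  proof (rule sum.cong[OF refl])
    fix p assume "p \<in> {p. p permutes (UNIV :: 'n set)}"
    then have p: "p permutes (UNIV :: 'n set)" by simp
    have "sign (?g p) = sign p"
      unfolding g_eq by (rule sign_map_permutation[OF _ p]) (auto simp: inj_def)
    moreover have "(\<Prod>i = 0..<?n. M $$ (i, ?g p i)) = (\<Prod>i\<in>UNIV. M $$ (?r i, ?g p (?r i)))"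
      by (rule prod.reindex_bij_betw[OF bij_index_rank, symmetric])
    moreover have "?g p (?r i) = ?r (p i)" for i
      by (simp add: index_rank_less inv_into_f_f inj_def)
    ultimately show "signof (?g p) * (\<Prod>i = 0..<?n. M $$ (i, ?g p i)) =
        of_int (sign p) * (\<Prod>i\<in>UNIV. M $$ (?r i, ?r (p i)))" by simp
  qed
  also have "\<dots> = Determinants.det (\<chi> i j :: 'n. M $$ (?r i, ?r j))"
    by (simp add: Determinants.det_def)
  finally show ?thesis by simp
qed

text \<open>The oriented volume spanned by a list of vectors, the Pluecker bracket of projective geometry.\<close>

definition bracket :: "(real ^ 'n::{finite,linorder}) list \<Rightarrow> real" where
  "bracket vs = Determinants.det (\<chi> i. vs ! index_rank i)"

lemma list_chi_split:
  fixes A B :: "(real ^ 'n::{finite,linorder}) list"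
  assumes "length A + Suc (length B) = CARD('n)"
  obtains q :: 'n where "\<And>x. (\<chi> i. (A @ x # B) ! index_rank i)
    = (\<chi> i. if i = q then x else (A @ B) ! (if index_rank i < length A then index_rank i else index_rank i - 1))"
proof -
  have "length A < CARD('n)" using assms by simp
  then obtain q :: 'n where q: "index_rank q = length A"
    by (metis index_rank_nth)
  show thesis
  proof
    show "(\<chi> i. (A @ x # B) ! index_rank i)
    = (\<chi> i. if i = q then x else (A @ B) ! (if index_rank i < length A then index_rank i else index_rank i - 1))" for x
    proof (rule Finite_Cartesian_Product.vec_eq_iff[THEN iffD2], rule allI)
      fix i
      show "(\<chi> i. (A @ x # B) ! index_rank i) $ i = (\<chi> i. if i = q then x else (A @ B) ! (if index_rank i < length A then index_rank i else index_rank i - 1)) $ i"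
      proof (cases "i = q")
        case False
        then have "index_rank i \<noteq> length A" using q index_rank_inj by metis
        then show ?thesis using False
          by (cases "index_rank i < length A") (auto simp: nth_append nth_Cons')
      qed (simp add: q)
    qed
  qed
qed

lemma linear_bracket:
  fixes A B :: "(real ^ 'n::{finite,linorder}) list"
  assumes "length A + Suc (length B) = CARD('n)"
  shows "linear (\<lambda>x. bracket (A @ x # B))"
proof -
  obtain q :: 'n where q: "\<And>x. (\<chi> i. (A @ x # B) ! index_rank i)
    = (\<chi> i. if i = q then x else (A @ B) ! (if index_rank i < length A then index_rank i else index_rank i - 1))"
    using list_chi_split[OF assms] by blast
  let ?c = "\<lambda>i :: 'n. (A @ B) ! (if index_rank i < length A then index_rank i else index_rank i - 1)"
  have smult: "r *s x = r *\<^sub>R x" for r and x :: "real ^ 'n::{finite,linorder}"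
    by (simp add: Finite_Cartesian_Product.vec_eq_iff)
  show ?thesis
  proof (rule linearI)
    show "bracket (A @ (x + y) # B) = bracket (A @ x # B) + bracket (A @ y # B)" for x y
      unfolding bracket_def q using Determinants.det_row_add[of q "\<lambda>_. x" "\<lambda>_. y" ?c] by simp
    show "bracket (A @ (r *\<^sub>R x) # B) = r *\<^sub>R bracket (A @ x # B)" for r x
      unfolding bracket_def q using Determinants.det_row_mul[of q r "\<lambda>_. x" ?c]
      unfolding smult by simp
  qed
qed

lemma bracket_repeated:
  fixes A B C :: "(real ^ 'n::{finite,linorder}) list"
  assumes "length A + length B + length C + 2 = CARD('n)"
  shows "bracket (A @ x # B @ x # C) = 0"
proof -
  let ?L = "A @ x # B @ x # C"
  have "length A < CARD('n)" "Suc (length A + length B) < CARD('n)" using assms by auto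
  then obtain p q :: 'n where p: "index_rank p = length A" and q: "index_rank q = Suc (length A + length B)"
    by (metis index_rank_nth)
  have "Finite_Cartesian_Product.row p (\<chi> i. ?L ! index_rank i) = Finite_Cartesian_Product.row q (\<chi> i. ?L ! index_rank i)"
    by (simp add: Finite_Cartesian_Product.row_def p q nth_append)
  moreover have "p \<noteq> q" using p q by auto
  ultimately show ?thesis
    unfolding bracket_def by (rule Determinants.det_identical_rows[rotated])
qed

lemma bracket_repeated':
  fixes A B :: "(real ^ 'n::{finite,linorder}) list"
  assumes "length A + Suc (length B) = CARD('n)" "x \<in> set A \<union> set B"
  shows "bracket (A @ x # B) = 0"
proof (cases "x \<in> set A")
  case True
  then obtain A1 A2 where "A = A1 @ x # A2" by (meson split_list)
  then show ?thesis using bracket_repeated[of A1 A2 B x] assms by simp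
next
  case False
  then obtain B1 B2 where "B = B1 @ x # B2" using assms by (meson split_list UnE)
  then show ?thesis using bracket_repeated[of A B1 B2 x] assms by simp
qed

lemma bracket_span:
  fixes A B :: "(real ^ 'n::{finite,linorder}) list"
  assumes len: "length A + Suc (length B) = CARD('n)" and "x \<in> span (set A \<union> set B)"
  shows "bracket (A @ x # B) = 0"
  using assms(2) linear_eq_0_on_span[OF linear_bracket[OF len]] bracket_repeated'[OF len] by blast

lemma bracket_swap_adjacent:
  fixes A B :: "(real ^ 'n::{finite,linorder}) list"
  assumes len: "length A + length B + 2 = CARD('n)"
  shows "bracket (A @ x # y # B) = - bracket (A @ y # x # B)"
proof -
  have 1: "linear (\<lambda>u. bracket (A @ u # w # B))" for w
    using linear_bracket[of A "w # B"] len by simp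
  have 2: "linear (\<lambda>u. bracket (A @ w # u # B))" for w
    using linear_bracket[of "A @ [w]" B] len by simp
  have 0: "bracket (A @ w # w # B) = 0" for w
    using bracket_repeated[of A "[]" B w] len by simp
  have "0 = bracket (A @ (x + y) # (x + y) # B)" by (simp add: 0)
  also have "\<dots> = bracket (A @ x # y # B) + bracket (A @ y # x # B)"
    unfolding linear_add[OF 1] linear_add[OF 2] by (simp add: 0)
  finally show ?thesis by simp
qed

text \<open>The basic sign rule: moving a vector past a block costs one sign for each vector of the block.\<close>

lemma bracket_move:
  fixes A B C :: "(real ^ 'n::{finite,linorder}) list"
  assumes "length A + length B + length C + 1 = CARD('n)"
  shows "bracket (A @ x # B @ C) = (-1) ^ length B * bracket (A @ B @ x # C)"
  using assms
proof (induction B arbitrary: A)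
  case (Cons b B)
  have "bracket (A @ x # (b # B) @ C) = - bracket (A @ b # x # (B @ C))"
    using bracket_swap_adjacent[of A "B @ C" x b] Cons.prems by simp
  also have "\<dots> = - ((-1) ^ length B * bracket ((A @ [b]) @ B @ x # C))"
    using Cons.IH[of "A @ [b]"] Cons.prems by simp
  finally show ?case by simp
qed simp

text \<open>In odd dimension a cyclic rotation is an even permutation. This is why flags and intervals may
  be exchanged freely below.\<close>

lemma bracket_rotate:
  fixes A B :: "(real ^ 'n::{finite,linorder}) list"
  assumes "length A + length B = CARD('n)" "odd CARD('n)"
  shows "bracket (A @ B) = bracket (B @ A)"
  using assms(1)
proof (induction A arbitrary: B)
  case (Cons x A)
  have "bracket ((x # A) @ B) = (-1) ^ length (A @ B) * bracket ((A @ B) @ [x])"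
    using bracket_move[of "[]" "A @ B" "[]" x] Cons.prems by simp
  also have "even (length (A @ B))" using Cons.prems assms(2) by (metis Suc_eq_plus1 add_Suc even_Suc length_Cons length_append)
  then have "(-1) ^ length (A @ B) * bracket ((A @ B) @ [x]) = bracket (A @ (B @ [x]))" by simp
  also have "\<dots> = bracket ((B @ [x]) @ A)" using Cons by simp
  finally show ?case by simp
qed simp

text \<open>The link to orientations, which are defined by the determinant of a change of basis.\<close>

lemma bracket_combination:
  fixes b c :: "(real ^ 'n::{finite,linorder}) list"
  assumes len: "length b = CARD('n)" "length c = CARD('n)"
    and M: "M \<in> carrier_mat CARD('n) CARD('n)"
    and c: "\<And>j. j < CARD('n) \<Longrightarrow> c ! j = (\<Sum>i < CARD('n). (M $$ (i, j)) *\<^sub>R (b ! i))"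
  shows "bracket c = Determinant.det M * bracket b"
proof -
  let ?B = "(\<chi> i. b ! index_rank i) :: real ^ 'n::{finite,linorder} ^ 'n::{finite,linorder}"
  let ?M = "(\<chi> i j. M $$ (index_rank i, index_rank j)) :: real ^ 'n::{finite,linorder} ^ 'n::{finite,linorder}"
  have "(\<chi> i. c ! index_rank i) = Finite_Cartesian_Product.transpose ?M ** ?B"
  proof -
    have "c ! index_rank i $ l = (\<Sum>m\<in>(UNIV :: 'n set). M $$ (index_rank m, index_rank i) * (b ! index_rank m $ l))" for i l :: 'n
    proof -
      have "c ! index_rank i $ l = (\<Sum>m < CARD('n). M $$ (m, index_rank i) * (b ! m $ l))"
        by (simp add: c index_rank_less sum_component)
      also have "\<dots> = (\<Sum>m\<in>(UNIV :: 'n set). M $$ (index_rank m, index_rank i) * (b ! index_rank m $ l))"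
        by (rule sum_index_rank[symmetric])
      finally show ?thesis .
    qed
    then show ?thesis
      by (simp add: Finite_Cartesian_Product.vec_eq_iff matrix_matrix_mult_def Finite_Cartesian_Product.transpose_def)
  qed
  then have "bracket c = Determinants.det ?M * bracket b"
    by (simp add: bracket_def Determinants.det_mul Determinants.det_transpose)
  then show ?thesis using det_eq_determinant[OF M] by simp
qed

lemma bracket_matrix:
  fixes b :: "(real ^ 'n::{finite,linorder}) list"
  assumes "length b = CARD('n)"
  shows "bracket (map (\<lambda>x. A *v x) b) = Determinants.det A * bracket b"
proof -
  let ?B = "(\<chi> i. b ! index_rank i) :: real ^ 'n::{finite,linorder} ^ 'n::{finite,linorder}"
  have "(\<chi> i. map (\<lambda>x. A *v x) b ! index_rank i) = ?B ** Finite_Cartesian_Product.transpose A"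
    using assms index_rank_less[where 'n = 'n]
    by (simp add: Finite_Cartesian_Product.vec_eq_iff matrix_matrix_mult_def matrix_vector_mult_def Finite_Cartesian_Product.transpose_def mult.commute)
  then show ?thesis
    by (simp add: bracket_def Determinants.det_mul Determinants.det_transpose)
qed

definition standard_basis :: "(real ^ 'n::{finite,linorder}) list" where
  "standard_basis = map (\<lambda>i. axis i 1) (sorted_list_of_set UNIV)"

lemma length_standard_basis [simp]: "length (standard_basis :: (real ^ 'n::{finite,linorder}) list) = CARD('n)"
  by (simp add: standard_basis_def)

lemma bracket_standard_basis: "bracket (standard_basis :: (real ^ 'n::{finite,linorder}) list) = 1"
proof -
  have "(\<chi> i. standard_basis ! index_rank i) = (Finite_Cartesian_Product.mat 1 :: real ^ 'n::{finite,linorder} ^ 'n::{finite,linorder})"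
    using index_rank_less[where 'n = 'n]
    by (auto simp: standard_basis_def Finite_Cartesian_Product.vec_eq_iff nth_index_rank axis_def Finite_Cartesian_Product.mat_def)
  then show ?thesis by (simp add: bracket_def)
qed

section \<open>Grassmann-Pluecker relations and total positivity\<close>

lemma bracket_nonzero_basis:
  fixes vs :: "(real ^ 'n::{finite,linorder}) list"
  assumes len: "length vs = CARD('n)" and nz: "bracket vs \<noteq> 0"
  shows "distinct vs" "independent (set vs)" "span (set vs) = UNIV"
proof -
  show dist: "distinct vs"
  proof (rule ccontr)
    assume "\<not> distinct vs"
    then obtain A B C x where "vs = A @ [x] @ B @ [x] @ C"
      using not_distinct_decomp by blast
    then show False using bracket_repeated[of A B C x] len nz by simp
  qed
  show ind: "independent (set vs)"
  proof
    assume "dependent (set vs)"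
    then obtain x where x: "x \<in> set vs" "x \<in> span (set vs - {x})"
      by (auto simp: dependent_def)
    then obtain A B where vs: "vs = A @ x # B" by (meson split_list)
    have "span (set vs - {x}) \<subseteq> span (set A \<union> set B)"
      by (rule span_mono) (auto simp: vs)
    then have "bracket vs = 0"
      unfolding vs using x len by (intro bracket_span) (auto simp: vs)
    then show False using nz by simp
  qed
  have "UNIV \<subseteq> span (set vs)"
    by (rule card_ge_dim_independent) (use ind dist len in \<open>auto simp: distinct_card dim_UNIV\<close>)
  then show "span (set vs) = UNIV" by auto
qed

text \<open>Fixing all but two vectors leaves an alternating form on a plane, and there the relation is the
  identity for two-by-two determinants. If \<open>a # b # W\<close> is a basis, the remaining two vectors can be
  expanded in it.\<close>

lemma bracket_grassmann_pluecker:
  fixes W :: "(real ^ 'n::{finite,linorder}) list" and a b c d :: "real ^ 'n::{finite,linorder}"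
  assumes len: "length W + 2 = CARD('n)"
    and nz: "bracket (a # b # W) \<noteq> 0"
  shows "bracket (a # b # W) * bracket (c # d # W)
    = bracket (a # c # W) * bracket (b # d # W) - bracket (a # d # W) * bracket (b # c # W)"
proof -
  define \<phi> where "\<phi> = (\<lambda>x y. bracket (x # y # W))"
  have lin1: "linear (\<lambda>x. \<phi> x y)" for y
    using linear_bracket[of "[]" "y # W"] len by (simp add: \<phi>_def)
  have lin2: "linear (\<lambda>y. \<phi> x y)" for x
    using linear_bracket[of "[x]" "W"] len by (simp add: \<phi>_def)
  have swap: "\<phi> x y = - \<phi> y x" for x y
    using bracket_swap_adjacent[of "[]" W x y] len by (simp add: \<phi>_def)
  have self: "\<phi> x x = 0" for x using swap[of x x] by simp
  have W0: "\<phi> x w = 0" if "w \<in> span (set W)" for w x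
    using bracket_span[of "[x]" W w] len that span_mono[of "set W" "set [x] \<union> set W"]
    by (auto simp: \<phi>_def)
  have ex: "\<exists>\<alpha> \<beta> w. z = \<alpha> *\<^sub>R a + \<beta> *\<^sub>R b + w \<and> w \<in> span (set W)" for z
  proof -
    have "span (set (a # b # W)) = UNIV"
      by (rule bracket_nonzero_basis) (use len nz in auto)
    then have "z \<in> span (insert a (insert b (set W)))" by simp
    then obtain \<alpha> where "z - \<alpha> *\<^sub>R a \<in> span (insert b (set W))"
      by (auto simp: span_insert)
    then obtain \<beta> where "z - \<alpha> *\<^sub>R a - \<beta> *\<^sub>R b \<in> span (set W)"
      by (auto simp: span_insert)
    then show ?thesis by (intro exI[of _ \<alpha>] exI[of _ \<beta>] exI[of _ "z - \<alpha> *\<^sub>R a - \<beta> *\<^sub>R b"]) auto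
  qed
  obtain \<alpha> \<beta> w where c: "c = \<alpha> *\<^sub>R a + \<beta> *\<^sub>R b + w" "w \<in> span (set W)" using ex by blast
  obtain \<gamma> \<delta> w' where d: "d = \<gamma> *\<^sub>R a + \<delta> *\<^sub>R b + w'" "w' \<in> span (set W)" using ex by blast
  have xd: "\<phi> x d = \<gamma> * \<phi> x a + \<delta> * \<phi> x b" for x
    unfolding d(1) by (simp add: linear_add[OF lin2] linear_cmul[OF lin2] W0[OF d(2)])
  have xc: "\<phi> x c = \<alpha> * \<phi> x a + \<beta> * \<phi> x b" for x
    unfolding c(1) by (simp add: linear_add[OF lin2] linear_cmul[OF lin2] W0[OF c(2)])
  have ba: "\<phi> b a = - \<phi> a b" by (rule swap)
  have cx: "\<phi> c x = \<alpha> * \<phi> a x + \<beta> * \<phi> b x + \<phi> w x" for x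
    unfolding c(1) by (simp add: linear_add[OF lin1] linear_cmul[OF lin1])
  have wd: "\<phi> w d = 0" using swap[of w d] W0[OF c(2)] by simp
  have 1: "\<phi> a d = \<delta> * \<phi> a b" "\<phi> b d = - \<gamma> * \<phi> a b" "\<phi> a c = \<beta> * \<phi> a b" "\<phi> b c = - \<alpha> * \<phi> a b"
    by (simp_all add: xd xc self ba)
  have 2: "\<phi> c d = (\<alpha> * \<delta> - \<beta> * \<gamma>) * \<phi> a b"
    by (simp add: cx wd 1 algebra_simps)
  have "\<phi> a b * \<phi> c d = \<phi> a c * \<phi> b d - \<phi> a d * \<phi> b c" by (simp add: 1 2 algebra_simps)
  then show ?thesis by (simp add: \<phi>_def)
qed

text \<open>The bracket of the members of a sequence with indices in a set, taken in increasing order.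
  Positivity of all these brackets is total positivity of the sequence.\<close>

definition bracket_on :: "(nat \<Rightarrow> real ^ 'n::{finite,linorder}) \<Rightarrow> nat set \<Rightarrow> real" where
  "bracket_on w K = bracket (map w (sorted_list_of_set K))"

lemma sorted_list_of_set_split:
  fixes x :: "'a::linorder"
  assumes "finite K" "x \<notin> K"
  shows "sorted_list_of_set K = sorted_list_of_set {z\<in>K. z < x} @ sorted_list_of_set {z\<in>K. x < z}"
    and "sorted_list_of_set (insert x K) = sorted_list_of_set {z\<in>K. z < x} @ x # sorted_list_of_set {z\<in>K. x < z}"
proof -
  have mem: "z < x \<or> x < z" if "z \<in> K" for z using assms(2) that by (cases z x rule: linorder_cases) auto
  show "sorted_list_of_set K = sorted_list_of_set {z\<in>K. z < x} @ sorted_list_of_set {z\<in>K. x < z}"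
    by (rule sorted_distinct_set_unique) (use assms(1) in \<open>auto simp: sorted_append dest: mem\<close>)
  show "sorted_list_of_set (insert x K) = sorted_list_of_set {z\<in>K. z < x} @ x # sorted_list_of_set {z\<in>K. x < z}"
  proof (rule sorted_distinct_set_unique)
    have "finite (insert x K)" using assms(1) by simp
    then have "set (sorted_list_of_set (insert x K)) = insert x K" by (rule set_sorted_list_of_set)
    then show "set (sorted_list_of_set (insert x K))
        = set (sorted_list_of_set {z\<in>K. z < x} @ x # sorted_list_of_set {z\<in>K. x < z})"
      using assms(1) by (auto dest: mem)
  qed (use assms(1) in \<open>auto simp: sorted_append simp del: sorted_list_of_set_insert_remove intro: less_imp_le less_trans\<close>)
qed

text \<open>The sign that sorts a new index into place counts the smaller indices.\<close>

lemma bracket_insert: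
  fixes w :: "nat \<Rightarrow> real ^ 'n::{finite,linorder}"
  assumes "finite K" "x \<notin> K" "length A + card K + 1 = CARD('n)"
  shows "bracket (A @ w x # map w (sorted_list_of_set K))
    = (-1) ^ card {z\<in>K. z < x} * bracket (A @ map w (sorted_list_of_set (insert x K)))"
proof -
  let ?B = "map w (sorted_list_of_set {z\<in>K. z < x})" and ?C = "map w (sorted_list_of_set {z\<in>K. x < z})"
  have "card K = card {z\<in>K. z < x} + card {z\<in>K. x < z}"
    using sorted_list_of_set_split(1)[OF assms(1,2)] by (metis length_append length_sorted_list_of_set)
  then have "length A + length ?B + length ?C + 1 = CARD('n)" using assms(3) by simp
  from bracket_move[OF this, of "w x"] show ?thesis
    by (simp add: sorted_list_of_set_split[OF assms(1,2)])
qed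

lemma bracket_on_pair:
  fixes w :: "nat \<Rightarrow> real ^ 'n::{finite,linorder}"
  assumes "finite S" "x \<notin> S" "y \<notin> S" "x < y" "card S + 2 = CARD('n)"
  shows "bracket (w x # w y # map w (sorted_list_of_set S))
    = (-1) ^ card {z\<in>S. z < x} * (-1) ^ card {z\<in>S. z < y} * bracket_on w (S \<union> {x, y})"
proof -
  have "{z \<in> insert y S. z < x} = {z\<in>S. z < x}" using assms(4) by auto
  then show ?thesis
    using bracket_insert[of S y "[w x]" w] bracket_insert[of "insert y S" x "[]" w] assms
    by (simp add: bracket_on_def insert_commute)
qed

text \<open>In increasing order of the indices all signs in the three-term relation cancel, and it expresses
  one product as a sum of two products.\<close>

lemma bracket_on_three_term_positive:
  fixes w :: "nat \<Rightarrow> real ^ 'n::{finite,linorder}"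
  assumes S: "finite S" "card S + 2 = CARD('n)" "a \<notin> S" "b \<notin> S" "c \<notin> S" "d \<notin> S"
    and less: "a < b" "b < c" "c < d"
    and pos: "bracket_on w (S \<union> {a, b}) > 0" "bracket_on w (S \<union> {c, d}) > 0"
      "bracket_on w (S \<union> {a, d}) > 0" "bracket_on w (S \<union> {b, c}) > 0"
  shows "bracket_on w (S \<union> {a, c}) * bracket_on w (S \<union> {b, d}) > 0"
proof -
  let ?W = "map w (sorted_list_of_set S)"
  let ?e = "\<lambda>x. (-1 :: real) ^ card {z\<in>S. z < x}"
  let ?D = "\<lambda>x y. bracket_on w (S \<union> {x, y})"
  have len: "length ?W + 2 = CARD('n)" using S by simp
  have sgn: "?e x \<noteq> 0" "?e x * ?e x = 1" for x
    by (simp_all flip: power_add)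
  have pr: "bracket (w x # w y # ?W) = ?e x * ?e y * ?D x y"
    if "x \<notin> S" "y \<notin> S" "x < y" for x y
    using bracket_on_pair[of S x y w] that S by simp
  have "?e a * ?e b * ?D a b \<noteq> 0" using pos(1) sgn by simp
  then have nz: "bracket (w a # w b # ?W) \<noteq> 0" using pr[of a b] S less by simp
  have ac: "a < c" and bd: "b < d" and ad: "a < d" using less by auto
  note rel = bracket_grassmann_pluecker[OF len nz, of "w c" "w d"]
  have cancel: "x * y = z * u - v * t"
    if "(ea * eb * x) * (ec * ed * y) = (ea * ec * z) * (eb * ed * u) - (ea * ed * v) * (eb * ec * t)"
      "ea * eb * ec * ed \<noteq> 0" for x y z u v t ea eb ec ed :: real
  proof -
    have "ea * eb * ec * ed * (x * y - (z * u - v * t)) = 0" using that(1) by (simp add: algebra_simps)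
    then show ?thesis using that(2) by simp
  qed
  have "?D a b * ?D c d = ?D a c * ?D b d - ?D a d * ?D b c"
  proof (rule cancel)
    show "(?e a * ?e b * ?D a b) * (?e c * ?e d * ?D c d) = (?e a * ?e c * ?D a c) * (?e b * ?e d * ?D b d)
      - (?e a * ?e d * ?D a d) * (?e b * ?e c * ?D b c)"
      using rel unfolding pr[OF S(3,4) less(1)] pr[OF S(5,6) less(3)] pr[OF S(3,5) ac] pr[OF S(4,6) bd]
        pr[OF S(3,6) ad] pr[OF S(4,5) less(2)] .
    show "?e a * ?e b * ?e c * ?e d \<noteq> 0" by simp
  qed
  moreover have "?D a b * ?D c d > 0" "?D a d * ?D b c > 0"
    using pos by (simp_all only: mult_pos_pos)
  ultimately show ?thesis by linarith
qed

text \<open>This is Fekete's criterion for total positivity. The \<open>2 * n\<close> vectors form two blocks; a set is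
  considered that meets the first block in an initial segment, and the seeds are the sets whose
  part missing in the second block is an interval. If this missing part \<open>I\<close> has a gap \<open>r\<close>, the
  three-term relation for the last index \<open>j\<close> of the initial segment, the extreme elements of \<open>I\<close>
  and \<open>r\<close> involves only sets with a shorter initial segment or with a missing part of smaller
  spread.\<close>

lemma bracket_on_positive_initial:
  fixes w :: "nat \<Rightarrow> real ^ 'n::{finite,linorder}"
  defines "n \<equiv> CARD('n)"
  assumes seeds: "\<And>j m y. j + m + y = n \<Longrightarrow>
      bracket_on w ({..<j} \<union> {n..<n + m} \<union> {2 * n - y..<2 * n}) > 0"
    and K: "K \<subseteq> {..<2 * n}" "card K = n" "K \<inter> {..<n} = {..<j}"
  shows "bracket_on w K > 0"
proof -
  let ?B = "{n..<2 * n}"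
  have cardI: "card (?B - K) = j" if "K \<subseteq> {..<2 * n}" "card K = n" "K \<inter> {..<n} = {..<j}" for K j
  proof -
    have "finite K" using that(1) finite_subset by blast
    have "K = {..<j} \<union> (K \<inter> ?B)" using that by force
    moreover have "{..<j} \<inter> (K \<inter> ?B) = {}" using that by force
    ultimately have "card K = j + card (K \<inter> ?B)"
      by (metis (no_types, lifting) \<open>finite K\<close> card_Un_disjoint card_lessThan finite_Int finite_lessThan)
    moreover have "card (?B - K) + card (K \<inter> ?B) = n"
      using card_Int_Diff[of ?B K] by (simp add: Int_commute)
    ultimately show ?thesis using that by simp
  qed
  have "\<forall>K. K \<subseteq> {..<2 * n} \<and> card K = n \<and> K \<inter> {..<n} = {..<j} \<longrightarrow> bracket_on w K > 0"
  proof (induction j)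
    case 0
    have B: "K = ?B" if "K \<subseteq> {..<2 * n}" "card K = n" "K \<inter> {..<n} = {..<0}" for K
    proof (rule card_subset_eq)
      show "K \<subseteq> ?B" using that by force
    qed (use that in auto)
    have "bracket_on w ?B > 0" using seeds[of 0 n 0] by (simp add: mult_2)
    then show ?case using B by metis
  next
    case (Suc j)
    have "bracket_on w K > 0"
      if "K \<subseteq> {..<2 * n}" "card K = n" "K \<inter> {..<n} = {..<Suc j}" "Max (?B - K) - Min (?B - K) = d" for K d
      using that
    proof (induction d arbitrary: K rule: less_induct)
      case (less d)
      define I where "I = ?B - K"
      have cI: "card I = Suc j" using cardI[OF less.prems(1-3)] by (simp add: I_def)
      have fin: "finite I" "finite K" using less.prems(1) finite_subset by (auto simp: I_def)
      have ne: "I \<noteq> {}" using cI by auto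
      define a where "a = Min I"
      define b where "b = Max I"
      have ab: "a \<in> I" "b \<in> I" "\<And>i. i \<in> I \<Longrightarrow> a \<le> i" "\<And>i. i \<in> I \<Longrightarrow> i \<le> b"
        using fin ne by (auto simp: a_def b_def)
      have jn: "j < n" using less.prems(3) by auto
      show ?case
      proof (cases "I = {a..b}")
        case True
        then have "Suc b - a = Suc j" using cI by simp
        moreover have "n \<le> a" "b < 2 * n" "a \<le> b" using ab by (auto simp: I_def)
        moreover have "K = {..<Suc j} \<union> {n..<a} \<union> {Suc b..<2 * n}"
        proof -
          have "x \<in> K \<longleftrightarrow> x \<in> {..<Suc j} \<union> (?B - I)" for x
          proof (cases "x < n")
            case True
            then have "x \<in> K \<longleftrightarrow> x \<in> {..<Suc j}" using less.prems(3) by blast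
            then show ?thesis using True by auto
          next
            case False
            moreover have "x \<in> K \<Longrightarrow> x < 2 * n" using less.prems(1) by blast
            ultimately show ?thesis using jn unfolding I_def by fastforce
          qed
          then have "K = {..<Suc j} \<union> (?B - I)" by blast
          then show ?thesis using True \<open>n \<le> a\<close> \<open>b < 2 * n\<close> \<open>a \<le> b\<close> by auto
        qed
        ultimately show ?thesis
          using seeds[of "Suc j" "a - n" "2 * n - Suc b"] by simp
      next
        case False
        then obtain r where r: "a < r" "r < b" "r \<notin> I"
        proof -
          have "I \<subseteq> {a..b}" using ab by auto
          then obtain r where "r \<in> {a..b}" "r \<notin> I" using False by (meson subset_antisym subsetI)
          moreover then have "r \<noteq> a" "r \<noteq> b" using ab by auto
          ultimately show thesis by (intro that[of r]) auto
        qed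
        have bnd: "n \<le> a" "b < 2 * n" using ab by (auto simp: I_def)
        have rK: "r \<in> K" using r bnd by (auto simp: I_def)
        have aK: "a \<notin> K" "b \<notin> K" using ab by (auto simp: I_def)
        have jK: "j \<in> K" "j < a" using less.prems(3) jn bnd by auto
        define S where "S = K - {j, r}"
        have finS: "finite S" using fin by (simp add: S_def)
        have cS: "card S + 2 = n"
        proof -
          have "K = insert j (insert r S)" unfolding S_def using jK rK by blast
          moreover have "j \<notin> S" "r \<notin> S" "j \<noteq> r" using jK r by (auto simp: S_def)
          ultimately show ?thesis using less.prems(2) finS by simp
        qed
        have Kx: "S \<union> {j, r} = K" unfolding S_def using jK rK by blast
        have notin: "j \<notin> S" "a \<notin> S" "r \<notin> S" "b \<notin> S" using aK by (auto simp: S_def)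
        have card2: "card (S \<union> {x, y}) = n" if "x \<notin> S" "y \<notin> S" "x \<noteq> y" for x y
          using that finS cS by (simp add: card_insert_if)
        have sub: "S \<subseteq> {..<2 * n}" using less.prems by (auto simp: S_def)
        have "S \<inter> {..<n} = K \<inter> {..<n} - {j}" unfolding S_def using r(1) bnd(1) by auto
        also have "\<dots> = {..<j}" unfolding less.prems(3) by auto
        finally have Sn: "S \<inter> {..<n} = {..<j}" .
        have low: "bracket_on w (S \<union> {x, y}) > 0" if "x \<notin> S" "y \<notin> S" "x < y" "n \<le> x" "y < 2 * n" for x y
        proof (rule Suc.IH[rule_format], intro conjI)
          show "S \<union> {x, y} \<subseteq> {..<2 * n}" using sub that by auto
          show "card (S \<union> {x, y}) = n" using card2 that by auto
          show "(S \<union> {x, y}) \<inter> {..<n} = {..<j}" using Sn that by auto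
        qed
        have high: "bracket_on w (S \<union> {j, x}) > 0" if x: "x = a \<or> x = b" for x
        proof (rule less.IH[OF _ _ _ _ refl])
          have xn: "x \<notin> S" "n \<le> x" "x < 2 * n" using x notin bnd r by auto
          show "S \<union> {j, x} \<subseteq> {..<2 * n}" using sub jn xn by auto
          show "card (S \<union> {j, x}) = n" by (rule card2) (use notin xn jn in auto)
          have "(S \<union> {j, x}) \<inter> {..<n} = insert j (S \<inter> {..<n})" using jn xn by auto
          also have "\<dots> = {..<Suc j}" unfolding Sn by auto
          finally show "(S \<union> {j, x}) \<inter> {..<n} = {..<Suc j}" .
          let ?I = "?B - (S \<union> {j, x})"
          have xK: "x \<notin> K" using x aK by auto
          have I: "?I = insert r (I - {x})"
            using jn r bnd xK by (auto simp: I_def S_def)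
          have mem: "r \<in> ?I" unfolding I by simp
          have "finite ?I" by simp
          have Maxle: "Max ?I \<le> b" unfolding I using ab r fin by (subst Max_le_iff) auto
          have Minge: "a \<le> Min ?I" unfolding I using ab r fin by (subst Min_ge_iff) auto
          have rM: "r \<le> Max ?I" "Min ?I \<le> r" using mem by auto
          have "x = a \<Longrightarrow> a < Min ?I"
          proof -
            assume "x = a"
            then have "a \<notin> ?I" by auto
            moreover have "Min ?I \<in> ?I" using mem by (intro Min_in) auto
            ultimately show "a < Min ?I" using Minge by (metis le_neq_implies_less)
          qed
          moreover have "x = b \<Longrightarrow> Max ?I < b"
          proof -
            assume "x = b"
            then have "b \<notin> ?I" by auto
            moreover have "Max ?I \<in> ?I" using mem by (intro Max_in) auto
            ultimately show "Max ?I < b" using Maxle by (metis le_neq_implies_less)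
          qed
          ultimately show "Max ?I - Min ?I < d"
            using less.prems(4) x Maxle Minge rM r unfolding a_def b_def I_def by linarith
        qed
        have "bracket_on w (S \<union> {j, r}) * bracket_on w (S \<union> {a, b}) > 0"
        proof (rule bracket_on_three_term_positive[OF finS _ notin(1,2,3,4)])
          show "card S + 2 = CARD('n)" using cS n_def by simp
          show "j < a" "a < r" "r < b" using jK r by auto
          show "bracket_on w (S \<union> {j, a}) > 0" "bracket_on w (S \<union> {j, b}) > 0" using high by auto
          show "bracket_on w (S \<union> {r, b}) > 0" "bracket_on w (S \<union> {a, r}) > 0"
            using low notin r bnd by auto
        qed
        moreover have "bracket_on w (S \<union> {a, b}) > 0" using low notin r bnd by auto
        ultimately show ?thesis unfolding Kx by (simp add: zero_less_mult_iff)
      qed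
    qed
    then show ?case by blast
  qed
  then show ?thesis using K by blast
qed


text \<open>The elements of a block that are missing below the largest member of the set in this block. There
  are none precisely if the set meets the block in an initial segment.\<close>

definition gaps :: "nat set \<Rightarrow> nat set \<Rightarrow> nat set" where
  "gaps B K = {z\<in>B. z \<notin> K \<and> (\<exists>k\<in>K \<inter> B. z < k)}"

text \<open>Filling the least gap \<open>u\<close>, dropping the largest member \<open>v\<close>, or both, never creates gaps; this
  makes the number of gaps a measure for the induction in the next result.\<close>

lemma gaps_decreasing:
  assumes fin: "finite B" and KB: "v \<in> K \<inter> B" and max: "\<And>k. k \<in> K \<inter> B \<Longrightarrow> k \<le> v"
    and u: "u \<in> gaps B K" and least: "\<And>z. z \<in> gaps B K \<Longrightarrow> u \<le> z"
  shows "card (gaps B (insert u K)) < card (gaps B K)"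
    and "card (gaps B (K - {v})) \<le> card (gaps B K)"
    and "card (gaps B (insert u (K - {v}))) < card (gaps B K)"
proof -
  have finG: "finite (gaps B K)" using fin by (simp add: gaps_def)
  have uv: "u < v" "u \<notin> K" "u \<in> B" using u max by (force simp: gaps_def)+
  have vn: "v \<notin> gaps B K" using KB by (simp add: gaps_def)
  have 1: "gaps B (insert u K) \<subseteq> gaps B K - {u}"
  proof
    fix z assume "z \<in> gaps B (insert u K)"
    then have z: "z \<in> B" "z \<noteq> u" "z \<notin> K" "\<exists>k\<in>insert u K \<inter> B. z < k" by (auto simp: gaps_def)
    then have "z < v" using uv max by (metis IntE IntI insertE less_le_trans less_trans)
    then show "z \<in> gaps B K - {u}" using z KB by (auto simp: gaps_def)
  qed
  have 2: "gaps B (K - {v}) \<subseteq> gaps B K"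
  proof
    fix z assume "z \<in> gaps B (K - {v})"
    then obtain k where z: "z \<in> B" "z \<notin> K - {v}" "k \<in> K" "k \<in> B" "k \<noteq> v" "z < k" by (auto simp: gaps_def)
    then have "z \<noteq> v" using max[of k] by auto
    then show "z \<in> gaps B K" using z by (auto simp: gaps_def)
  qed
  have 3: "gaps B (insert u (K - {v})) \<subseteq> gaps B K - {u}"
  proof
    fix z assume "z \<in> gaps B (insert u (K - {v}))"
    then obtain k where z: "z \<in> B" "z \<noteq> u" "z \<notin> K - {v}" "k \<in> B" "z < k" "k = u \<or> k \<in> K - {v}"
      by (auto simp: gaps_def)
    have zv: "z < v" using z(5,6) uv(1) max[of k] z(4) by auto
    then have "z \<notin> K" using z by auto
    then have "z \<in> gaps B K" using z(1) zv KB by (auto simp: gaps_def)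
    then show "z \<in> gaps B K - {u}" using z(2) by simp
  qed
  have lt: "card (gaps B K - {u}) < card (gaps B K)" by (rule card_Diff1_less[OF finG u])
  show "card (gaps B (insert u K)) < card (gaps B K)"
    using card_mono[OF _ 1] finG lt by fastforce
  show "card (gaps B (K - {v})) \<le> card (gaps B K)" using card_mono[OF finG 2] .
  show "card (gaps B (insert u (K - {v}))) < card (gaps B K)"
    using card_mono[OF _ 3] finG lt by fastforce
qed

lemma gaps_other: "x \<notin> B \<Longrightarrow> gaps B (insert x K) = gaps B K" "x \<notin> B \<Longrightarrow> gaps B (K - {x}) = gaps B K"
  by (auto simp: gaps_def)

lemma gaps_empty_initial:
  assumes "gaps {l..<h} K = {}"
  shows "K \<inter> {l..<h} = {l..<l + card (K \<inter> {l..<h})}"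
proof (cases "K \<inter> {l..<h} = {}")
  case False
  let ?M = "Max (K \<inter> {l..<h})"
  have M: "?M \<in> K \<inter> {l..<h}" using False by (intro Max_in) auto
  have "K \<inter> {l..<h} = {l..?M}"
  proof (intro equalityI subsetI)
    fix x assume "x \<in> K \<inter> {l..<h}"
    then show "x \<in> {l..?M}" by simp
  next
    fix x assume x: "x \<in> {l..?M}"
    show "x \<in> K \<inter> {l..<h}"
    proof (cases "x = ?M")
      case False
      then have "x < ?M" using x by simp
      then have "x \<in> {l..<h}" using x M by auto
      moreover have "x \<notin> gaps {l..<h} K" using assms by simp
      ultimately show ?thesis using M \<open>x < ?M\<close> unfolding gaps_def by blast
    qed (use M in simp)
  qed
  moreover have "{l..?M} = {l..<l + card {l..?M}}" using M by auto
  ultimately show ?thesis by metis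
qed auto

text \<open>If the set is initial in neither block, let \<open>u\<close> and \<open>v\<close> be its least gap and its largest member
  in the first block and \<open>x\<close> and \<open>y\<close> those in the second block. In the three-term relation for
  \<open>u < v < x < y\<close> the set itself is one of six, and the other five have fewer gaps.\<close>

lemma bracket_on_positive:
  fixes w :: "nat \<Rightarrow> real ^ 'n::{finite,linorder}"
  defines "n \<equiv> CARD('n)"
  assumes init1: "\<And>K j. K \<subseteq> {..<2 * n} \<Longrightarrow> card K = n \<Longrightarrow> K \<inter> {0..<n} = {0..<0+j} \<Longrightarrow> bracket_on w K > 0"
    and init2: "\<And>K j. K \<subseteq> {..<2 * n} \<Longrightarrow> card K = n \<Longrightarrow> K \<inter> {n..<2 * n} = {n..<n + j} \<Longrightarrow> bracket_on w K > 0"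
    and K: "K \<subseteq> {..<2 * n}" "card K = n"
  shows "bracket_on w K > 0"
  using K
proof (induction "card (gaps {0..<n} K) + card (gaps {n..<2 * n} K)" arbitrary: K rule: less_induct)
  case less
  let ?B1 = "{0..<n}" and ?B2 = "{n..<2 * n}"
  let ?G1 = "gaps ?B1 K" and ?G2 = "gaps ?B2 K"
  have finK: "finite K" using less.prems(1) finite_subset by blast
  show ?case
  proof (cases "?G1 = {} \<or> ?G2 = {}")
    case True
    then show ?thesis
      using init1[OF less.prems] init2[OF less.prems] gaps_empty_initial by metis
  next
    case False
    have finG: "finite ?G1" "finite ?G2" by (auto simp: gaps_def)
    define u where "u = Min ?G1"
    define x where "x = Min ?G2"
    define v where "v = Max (K \<inter> ?B1)"
    define y where "y = Max (K \<inter> ?B2)"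
    have u: "u \<in> ?G1" "\<And>z. z \<in> ?G1 \<Longrightarrow> u \<le> z" using False finG by (auto simp: u_def)
    have x: "x \<in> ?G2" "\<And>z. z \<in> ?G2 \<Longrightarrow> x \<le> z" using False finG by (auto simp: x_def)
    have ne: "K \<inter> ?B1 \<noteq> {}" "K \<inter> ?B2 \<noteq> {}" using u(1) x(1) by (auto simp: gaps_def)
    have v: "v \<in> K \<inter> ?B1" "\<And>k. k \<in> K \<inter> ?B1 \<Longrightarrow> k \<le> v"
      unfolding v_def by (intro Max_in Max_ge; use ne finK in simp)+
    have y: "y \<in> K \<inter> ?B2" "\<And>k. k \<in> K \<inter> ?B2 \<Longrightarrow> k \<le> y"
      unfolding y_def by (intro Max_in Max_ge; use ne finK in simp)+
    note g1 = gaps_decreasing[OF _ v u, simplified]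
    note g2 = gaps_decreasing[OF _ y x, simplified]
    have uK: "u \<notin> K" "u < n" "u < v" using u(1) v(2) by (force simp: gaps_def)+
    have xK: "x \<notin> K" "n \<le> x" "x < 2 * n" "x < y" using x(1) y(2) by (force simp: gaps_def)+
    have vK: "v \<in> K" "v < n" and yK: "y \<in> K" "n \<le> y" "y < 2 * n" using v(1) y(1) by auto
    define S where "S = K - {v, y}"
    have finS: "finite S" using finK by (simp add: S_def)
    have notin: "u \<notin> S" "v \<notin> S" "x \<notin> S" "y \<notin> S" using uK xK by (auto simp: S_def)
    have Ky: "S \<union> {v, y} = K" using vK yK by (auto simp: S_def)
    have vy: "v \<noteq> y" using vK yK by auto
    have cS: "card S + 2 = n"
    proof -
      have "K = insert v (insert y S)" using vK yK by (auto simp: S_def)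
      then show ?thesis using less.prems(2) finS notin vy by simp
    qed
    have S2: "S \<subseteq> {..<2 * n}" using less.prems(1) by (auto simp: S_def)
    have IH: "bracket_on w (S \<union> {p, q}) > 0"
      if "p \<notin> S" "q \<notin> S" "p \<noteq> q" "p < 2 * n" "q < 2 * n"
        "card (gaps ?B1 (S \<union> {p, q})) + card (gaps ?B2 (S \<union> {p, q})) < card ?G1 + card ?G2" for p q
    proof (rule less.hyps)
      show "S \<union> {p, q} \<subseteq> {..<2 * n}" using that S2 by auto
      show "card (S \<union> {p, q}) = n" using that finS cS by (simp add: card_insert_if)
    qed (use that in auto)
    have nB: "u \<notin> ?B2" "v \<notin> ?B2" "x \<notin> ?B1" "y \<notin> ?B1" using uK vK xK yK by auto
    have e: "S \<union> {u, x} = insert x (insert u (K - {v}) - {y})" "S \<union> {u, x} = insert u (insert x (K - {y}) - {v})"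
      "S \<union> {u, v} = insert u K - {y}" "S \<union> {u, v} = insert u (K - {y})"
      "S \<union> {x, y} = insert x K - {v}" "S \<union> {x, y} = insert x (K - {v})"
      "S \<union> {u, y} = insert u (K - {v})" "S \<union> {v, x} = insert x (K - {y})"
      using uK vK xK yK vy by (auto simp: S_def)
    have pos: "bracket_on w (S \<union> {u, x}) > 0" "bracket_on w (S \<union> {u, v}) > 0" "bracket_on w (S \<union> {x, y}) > 0"
      "bracket_on w (S \<union> {u, y}) > 0" "bracket_on w (S \<union> {v, x}) > 0"
    proof -
      have a1: "gaps ?B1 (S \<union> {u, x}) = gaps ?B1 (insert u (K - {v}))"
        unfolding e(1) using nB by (simp add: gaps_other)
      have a2: "gaps ?B2 (S \<union> {u, x}) = gaps ?B2 (insert x (K - {y}))"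
        unfolding e(2) using nB by (simp add: gaps_other)
      show "bracket_on w (S \<union> {u, x}) > 0"
        by (rule IH) (use notin uK xK a1 a2 g1 g2 in auto)
      have a1: "gaps ?B1 (S \<union> {u, v}) = gaps ?B1 (insert u K)"
        unfolding e(3) using nB by (simp add: gaps_other)
      have a2: "gaps ?B2 (S \<union> {u, v}) = gaps ?B2 (K - {y})"
        unfolding e(4) using nB by (simp add: gaps_other)
      show "bracket_on w (S \<union> {u, v}) > 0"
        by (rule IH) (use notin uK vK a1 a2 g1 g2 in auto)
      have a1: "gaps ?B1 (S \<union> {x, y}) = gaps ?B1 (K - {v})"
        unfolding e(6) using nB by (simp add: gaps_other)
      have a2: "gaps ?B2 (S \<union> {x, y}) = gaps ?B2 (insert x K)"
        unfolding e(5) using nB by (simp add: gaps_other)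
      show "bracket_on w (S \<union> {x, y}) > 0"
        by (rule IH) (use notin xK yK a1 a2 g1 g2 in auto)
      have a1: "gaps ?B1 (S \<union> {u, y}) = gaps ?B1 (insert u (K - {v}))" unfolding e(7) ..
      have a2: "gaps ?B2 (S \<union> {u, y}) = gaps ?B2 K"
        unfolding e(7) using nB by (simp add: gaps_other)
      show "bracket_on w (S \<union> {u, y}) > 0"
        by (rule IH) (use notin uK yK a1 a2 g1 g2 in auto)
      have a1: "gaps ?B1 (S \<union> {v, x}) = gaps ?B1 K"
        unfolding e(8) using nB by (simp add: gaps_other)
      have a2: "gaps ?B2 (S \<union> {v, x}) = gaps ?B2 (insert x (K - {y}))" unfolding e(8) ..
      show "bracket_on w (S \<union> {v, x}) > 0"
        by (rule IH) (use notin vK xK a1 a2 g1 g2 in auto)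
    qed
    have "bracket_on w (S \<union> {u, x}) * bracket_on w (S \<union> {v, y}) > 0"
      by (rule bracket_on_three_term_positive[OF finS _ notin(1,2,3,4)])
        (use cS pos uK xK vK yK in \<open>auto simp: n_def\<close>)
    then show ?thesis using pos(1) unfolding Ky by (simp add: zero_less_mult_iff)
  qed
qed

section \<open>Sign changes\<close>

definition sign_list :: "real list \<Rightarrow> bool" where
  "sign_list s \<longleftrightarrow> set s \<subseteq> {-1, 1}"

lemma sign_list_nth: "sign_list s \<Longrightarrow> i < length s \<Longrightarrow> s ! i = -1 \<or> s ! i = 1"
  unfolding sign_list_def using nth_mem by blast

text \<open>The places where the sign changes, so that \<open>sign_changes\<close> is its cardinality.\<close>

definition change_set :: "real list \<Rightarrow> nat set" where
  "change_set s = {i. Suc i < length s \<and> s ! i \<noteq> s ! Suc i}"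

lemma finite_change_set [simp]: "finite (change_set s)"
  by (rule finite_subset[of _ "{..<length s}"]) (auto simp: change_set_def)

lemma sign_changes_eq: "sign_changes s = card (change_set s)"
  by (simp add: sign_changes_def change_set_def)

lemma sign_list_nth_parity:
  assumes "sign_list s" "i < length s"
  shows "s ! i = (-1) ^ card {j\<in>change_set s. j < i} * s ! 0"
  using assms(2)
proof (induction i)
  case (Suc i)
  have IH: "s ! i = (-1) ^ card {j\<in>change_set s. j < i} * s ! 0" using Suc by simp
  show ?case
  proof (cases "i \<in> change_set s")
    case True
    then have "{j\<in>change_set s. j < Suc i} = insert i {j\<in>change_set s. j < i}" by auto
    moreover have "s ! Suc i = - s ! i"
      using True sign_list_nth[OF assms(1), of i] sign_list_nth[OF assms(1), of "Suc i"] Suc.prems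
      by (auto simp: change_set_def)
    ultimately show ?thesis using IH by simp
  next
    case False
    then have "{j\<in>change_set s. j < Suc i} = {j\<in>change_set s. j < i}" by (auto simp: less_Suc_eq)
    moreover have "s ! Suc i = s ! i" using False Suc.prems by (auto simp: change_set_def)
    ultimately show ?thesis using IH by simp
  qed
qed simp

lemma last_sign_parity:
  assumes "sign_list s" "s \<noteq> []"
  shows "last s = (-1) ^ sign_changes s * hd s"
proof -
  have "{j\<in>change_set s. j < length s - 1} = change_set s" by (auto simp: change_set_def)
  then show ?thesis
    using sign_list_nth_parity[OF assms(1), of "length s - 1"] assms(2)
    by (simp add: last_conv_nth hd_conv_nth sign_changes_eq)
qed

text \<open>Reversal of a list with alternating signs. Applied to an adapted basis it exchanges the two
  flags of the pair, applied to signs it describes the effect of this exchange on coordinates.\<close>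

primrec alt_rev :: "'a::real_vector list \<Rightarrow> 'a list" where
  "alt_rev [] = []"
| "alt_rev (x # xs) = alt_rev xs @ [(-1) ^ length xs *\<^sub>R x]"

lemma length_alt_rev [simp]: "length (alt_rev xs) = length xs"
  by (induction xs) auto

lemma alt_rev_nth: "i < length xs \<Longrightarrow> alt_rev xs ! i = (-1) ^ i *\<^sub>R xs ! (length xs - 1 - i)"
proof (induction xs)
  case (Cons x xs)
  show ?case
  proof (cases "i < length xs")
    case True
    then have "length xs - i = Suc (length xs - 1 - i)" by simp
    then show ?thesis using True Cons.IH by (simp add: nth_append)
  next
    case False
    then have "i = length xs" using Cons.prems by simp
    then show ?thesis by (simp add: nth_append)
  qed
qed simp

lemma alt_rev_alt_rev:
  assumes "odd (length xs)"
  shows "alt_rev (alt_rev xs) = xs"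
proof (rule nth_equalityI)
  fix i assume "i < length (alt_rev (alt_rev xs))"
  then have i: "i < length xs" by simp
  then have "length xs - 1 - (length xs - 1 - i) = i" "i + (length xs - 1 - i) = length xs - 1" by auto
  moreover have "even (length xs - 1)" using assms by simp
  then have "(-1 :: real) ^ i * (-1) ^ (length xs - 1 - i) = 1"
    using calculation(2) by (simp flip: power_add)
  ultimately show "alt_rev (alt_rev xs) ! i = xs ! i" using i by (simp add: alt_rev_nth)
qed simp

lemma alt_rev_map:
  assumes "linear f"
  shows "alt_rev (map f xs) = map f (alt_rev xs)"
  by (induction xs) (simp_all add: linear_cmul[OF assms])

lemma sign_list_alt_rev:
  assumes "sign_list s"
  shows "sign_list (alt_rev s)"
  using assms
proof (induction s)
  case (Cons x s)
  then have "(-1) ^ length s * x = -1 \<or> (-1) ^ length s * x = 1"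
    by (cases "even (length s)") (auto simp: sign_list_def)
  then show ?case using Cons by (auto simp: sign_list_def)
qed simp

text \<open>Alternating the signs exchanges changes with non-changes.\<close>

lemma sign_changes_alt_rev:
  assumes "sign_list s"
  shows "sign_changes s + sign_changes (alt_rev s) = length s - 1"
proof -
  let ?n = "length s" and ?T = "{i. Suc i < length s}"
  have T: "?T = {..<?n - 1}" by auto
  have iff: "i \<in> change_set (alt_rev s) \<longleftrightarrow> ?n - 2 - i \<notin> change_set s" if "Suc i < ?n" for i
  proof -
    have e: "?n - 1 - i = Suc (?n - 2 - i)" "?n - 1 - Suc i = ?n - 2 - i" "Suc (?n - 2 - i) < ?n" using that by auto
    have pm: "(-1 :: real) ^ i = 1 \<or> (-1 :: real) ^ i = -1" by (cases "even i") auto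
    show ?thesis
      using that e pm sign_list_nth[OF assms, of "?n - 2 - i"] sign_list_nth[OF assms, of "Suc (?n - 2 - i)"]
      by (auto simp: change_set_def alt_rev_nth)
  qed
  have "bij_betw (\<lambda>i. ?n - 2 - i) (change_set (alt_rev s)) (?T - change_set s)"
  proof (rule bij_betw_byWitness[where f' = "\<lambda>i. ?n - 2 - i"])
    have sub: "Suc i < ?n" if "i \<in> change_set (alt_rev s)" for i using that by (simp add: change_set_def)
    show "(\<lambda>i. ?n - 2 - i) ` change_set (alt_rev s) \<subseteq> ?T - change_set s"
      using iff sub by fastforce
    show "(\<lambda>i. ?n - 2 - i) ` (?T - change_set s) \<subseteq> change_set (alt_rev s)"
    proof
      fix j assume "j \<in> (\<lambda>i. ?n - 2 - i) ` (?T - change_set s)"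
      then obtain i where i: "j = ?n - 2 - i" "Suc i < ?n" "i \<notin> change_set s" by auto
      then have "Suc j < ?n" "?n - 2 - j = i" by auto
      then show "j \<in> change_set (alt_rev s)" using iff[of j] i by simp
    qed
  qed (auto simp: change_set_def)
  then have "card (change_set (alt_rev s)) = card (?T - change_set s)" by (rule bij_betw_same_card)
  moreover have "card (?T - change_set s) + card (change_set s) = card ?T"
  proof -
    have "change_set s \<subseteq> ?T" "finite ?T" unfolding T[symmetric] by (auto simp: change_set_def T)
    then show ?thesis by (simp add: card_Diff_subset card_mono)
  qed
  ultimately show ?thesis by (simp add: sign_changes_eq T)
qed

text \<open>The sign patterns of the vectors in a halfspace.\<close>

definition low_variation :: "nat \<Rightarrow> real list \<Rightarrow> bool" where
  "low_variation k s \<longleftrightarrow> sign_changes s \<le> 2 * k \<or> sign_changes s = 2 * k + 1 \<and> last s = 1"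

text \<open>The number of changes becomes \<open>4 * k + 2\<close> minus the number before, and in the middle case
  \<open>2 * k + 1\<close> the last sign of the new sequence is the first sign of the old one, which is opposite to
  its last sign because \<open>2 * k + 1\<close> is odd.\<close>

lemma low_variation_alt_rev:
  assumes s: "sign_list s" "length s = 4 * k + 3"
  shows "low_variation k (alt_rev s) \<longleftrightarrow> \<not> low_variation k s"
proof -
  have ne: "s \<noteq> []" using s(2) by auto
  have sum: "sign_changes s + sign_changes (alt_rev s) = 4 * k + 2"
    using sign_changes_alt_rev[OF s(1)] s(2) by simp
  have ne': "alt_rev s \<noteq> []" using ne by (metis length_0_conv length_alt_rev)
  have "last (alt_rev s) = hd s"
    using s(2) alt_rev_nth[of "length s - 1" s] ne ne' by (simp add: last_conv_nth hd_conv_nth)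
  moreover have "last s = (-1) ^ sign_changes s * hd s" by (rule last_sign_parity[OF s(1) ne])
  moreover have "hd s = 1 \<or> hd s = -1" using s(1) ne by (auto simp: sign_list_def neq_Nil_conv)
  ultimately show ?thesis
    using sum unfolding low_variation_def by (cases "sign_changes s = 2 * k + 1") auto
qed

lemma sign_changes_append:
  assumes "s \<noteq> []" "t \<noteq> []"
  shows "sign_changes (s @ t) \<le> sign_changes s + sign_changes t + (if last s = hd t then 0 else 1)"
proof -
  let ?J = "if last s = hd t then {} else {length s - 1}"
  have "change_set (s @ t) \<subseteq> change_set s \<union> (+) (length s) ` change_set t \<union> ?J"
  proof
    fix i assume i: "i \<in> change_set (s @ t)"
    consider "Suc i < length s" | "Suc i = length s" | "i \<ge> length s" by linarith
    then show "i \<in> change_set s \<union> (+) (length s) ` change_set t \<union> ?J"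
    proof cases
      case 1
      then show ?thesis using i by (auto simp: change_set_def nth_append)
    next
      case 2
      then have "i = length s - 1" by simp
      then have "s ! i = last s" "i = length s - 1" "i < length s" using assms(1) by (auto simp: last_conv_nth)
      then show ?thesis using i 2 assms(2) by (auto simp: change_set_def nth_append hd_conv_nth)
    next
      case 3
      then have "i = length s + (i - length s)" "i - length s \<in> change_set t"
        using i by (auto simp: change_set_def nth_append Suc_diff_le)
      then show ?thesis by blast
    qed
  qed
  then have "card (change_set (s @ t)) \<le> card (change_set s \<union> (+) (length s) ` change_set t \<union> ?J)"
    by (intro card_mono) auto
  also have "\<dots> \<le> card (change_set s) + card ((+) (length s) ` change_set t) + card ?J"
    by (meson add_mono card_Un_le le_refl order_trans)
  also have "card ((+) (length s) ` change_set t) = card (change_set t)" by (simp add: card_image)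
  finally show ?thesis by (simp add: sign_changes_eq split: if_splits)
qed

lemma sign_changes_uminus: "sign_changes (map uminus s) = sign_changes s"
proof -
  have "change_set (map uminus s) = change_set s" by (auto simp: change_set_def)
  then show ?thesis by (simp add: sign_changes_eq)
qed

lemma exists_top_subset:
  fixes T :: "nat set"
  assumes "finite T" "m \<le> card T"
  shows "\<exists>X \<subseteq> T. card X = m \<and> (\<forall>x\<in>X. \<forall>t\<in>T - X. t < x)"
  using assms(2)
proof (induction m)
  case (Suc m)
  then obtain X where X: "X \<subseteq> T" "card X = m" "\<forall>x\<in>X. \<forall>t\<in>T - X. t < x" by auto
  have fin: "finite X" "finite (T - X)" using X(1) assms(1) finite_subset by auto
  have "T - X \<noteq> {}" using X(1,2) Suc.prems assms(1) by (metis Diff_eq_empty_iff Suc_n_not_le_n subset_antisym)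
  then have M: "Max (T - X) \<in> T - X" by (rule Max_in[OF fin(2)])
  have "\<forall>x\<in>insert (Max (T - X)) X. \<forall>t\<in>T - insert (Max (T - X)) X. t < x"
  proof (intro ballI)
    fix x t assume x: "x \<in> insert (Max (T - X)) X" and t: "t \<in> T - insert (Max (T - X)) X"
    then have "t \<in> T - X" "t \<noteq> Max (T - X)" by auto
    then have "t < Max (T - X)" using fin by (simp add: le_neq_implies_less)
    then show "t < x" using x X(3) \<open>t \<in> T - X\<close> by auto
  qed
  then show ?case using X M fin by (intro exI[of _ "insert (Max (T - X)) X"]) auto
qed (auto intro: exI[of _ "{}"])

text \<open>A sequence with all brackets positive behaves like a curve of maximal order: a linear functional
  that vanishes at \<open>n - 1\<close> members changes sign along the sequence exactly there. If the relation
  \<open>c\<close> had fewer than \<open>n\<close> sign changes, the zeros could be placed at these changes, and the functional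
  applied to the relation would be a sum of terms of one sign.\<close>

lemma alternating_dependency:
  fixes w :: "nat \<Rightarrow> real ^ 'n::{finite,linorder}"
  assumes pos: "\<And>K. K \<subseteq> {..<N} \<Longrightarrow> card K = CARD('n) \<Longrightarrow> bracket_on w K > 0"
    and N: "CARD('n) \<le> N"
    and dep: "(\<Sum>i<N. c i *\<^sub>R w i) = 0"
    and s: "sign_list s" "length s = N" "\<And>i. i < N \<Longrightarrow> 0 \<le> c i * s ! i"
    and few: "sign_changes s < CARD('n)"
    and i: "i < N"
  shows "c i = 0"
proof -
  let ?n = "CARD('n)"
  \<comment> \<open>The zeros of the functional: the places \<open>Z\<close> at which a new sign starts, filled up by the last
    indices \<open>X\<close> outside \<open>Z\<close>, which do not affect the sign at any other index.\<close>
  define Z where "Z = Suc ` change_set s"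
  have ZN: "Z \<subseteq> {..<N}" using s(2) by (auto simp: Z_def change_set_def)
  have finZ: "finite Z" by (simp add: Z_def)
  have cZ: "card Z = sign_changes s" by (simp add: Z_def card_image sign_changes_eq)
  have cT: "card ({..<N} - Z) = N - card Z" using ZN finZ by (simp add: card_Diff_subset)
  have "?n - 1 - card Z \<le> card ({..<N} - Z)" using cT N by simp
  then obtain X where X: "X \<subseteq> {..<N} - Z" "card X = ?n - 1 - card Z" "\<forall>x\<in>X. \<forall>t\<in>{..<N} - Z - X. t < x"
    using exists_top_subset[of "{..<N} - Z"] by blast
  have finX: "finite X" using X(1) finite_subset by blast
  define K where "K = Z \<union> X"
  have finK: "finite K" using finZ finX by (simp add: K_def)
  have KN: "K \<subseteq> {..<N}" using X ZN by (auto simp: K_def)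
  have cK: "card K + 1 = ?n"
  proof -
    have "card K = card Z + card X" unfolding K_def using finZ finX X(1) by (intro card_Un_disjoint) auto
    then show ?thesis using X(2) few cZ by simp
  qed
  have lin: "linear (\<lambda>u. bracket (u # map w (sorted_list_of_set L)))" if "finite L" "card L + 1 = ?n" for L
    using linear_bracket[of "[]" "map w (sorted_list_of_set L)"] that by simp
  have mem0: "bracket (w k # map w (sorted_list_of_set L)) = 0" if "finite L" "card L + 1 = ?n" "k \<in> L" for k L
    using bracket_repeated'[of "[]" "map w (sorted_list_of_set L)" "w k"] that by simp
  have ins: "bracket (w k # map w (sorted_list_of_set L)) = (-1) ^ card {z\<in>L. z < k} * bracket_on w (insert k L)"
    if "finite L" "card L + 1 = ?n" "k \<notin> L" for k L
    using bracket_insert[of L k "[]" w] that by (simp add: bracket_on_def)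
  have expand: "(\<Sum>k<N. c k * bracket (w k # map w (sorted_list_of_set L))) = 0"
    if "finite L" "card L + 1 = ?n" for L
  proof -
    have "0 = bracket ((\<Sum>k<N. c k *\<^sub>R w k) # map w (sorted_list_of_set L))"
      unfolding dep using linear_0[OF lin[OF that]] by simp
    also have "\<dots> = (\<Sum>k<N. c k * bracket (w k # map w (sorted_list_of_set L)))"
      using linear_sum[OF lin[OF that], of "\<lambda>k. c k *\<^sub>R w k" "{..<N}"] linear_cmul[OF lin[OF that]] by simp
    finally show ?thesis by simp
  qed
  have Ns: "N > 0" using i by simp
  have s0: "s ! 0 * s ! 0 = 1" using sign_list_nth[OF s(1), of 0] s(2) Ns by auto
  have sgn: "bracket (w k # map w (sorted_list_of_set K)) * s ! 0 = s ! k * bracket_on w (insert k K)"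
    if k: "k < N" "k \<notin> K" for k
  proof -
    have "{z\<in>K. z < k} = Suc ` {j\<in>change_set s. j < k}"
    proof (intro equalityI subsetI)
      fix z assume z: "z \<in> {z\<in>K. z < k}"
      have "k \<in> {..<N} - Z - X" using k by (auto simp: K_def)
      then have "z \<in> X \<Longrightarrow> k < z" using X(3) by blast
      then have "z \<notin> X" using z by auto
      then show "z \<in> Suc ` {j\<in>change_set s. j < k}" using z by (auto simp: K_def Z_def)
    next
      fix z assume "z \<in> Suc ` {j\<in>change_set s. j < k}"
      then obtain j where j: "z = Suc j" "j \<in> change_set s" "j < k" by auto
      then have "z \<in> K" by (auto simp: K_def Z_def)
      then have "z \<noteq> k" using k by auto
      then show "z \<in> {z\<in>K. z < k}" using j \<open>z \<in> K\<close> by auto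
    qed
    then have "card {z\<in>K. z < k} = card {j\<in>change_set s. j < k}" by (simp add: card_image)
    then have a: "bracket (w k # map w (sorted_list_of_set K)) =
        (-1) ^ card {j\<in>change_set s. j < k} * bracket_on w (insert k K)"
      using ins[OF finK cK k(2)] by simp
    have b: "s ! k = (-1) ^ card {j\<in>change_set s. j < k} * s ! 0"
      using sign_list_nth_parity[OF s(1), of k] s(2) k(1) by simp
    show ?thesis by (subst a, subst b) (rule mult.commute[THEN trans], simp only: mult.assoc mult.left_commute)
  qed
  have posk: "bracket_on w (insert k K) > 0" if "k < N" "k \<notin> K" for k
    using pos[of "insert k K"] that KN finK cK by auto
  have out: "c k = 0" if k: "k < N" "k \<notin> K" for k
  proof -
    let ?f = "\<lambda>k. if k \<in> K then 0 else c k * s ! k * bracket_on w (insert k K)"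
    have "(\<Sum>k<N. ?f k) = (\<Sum>k<N. c k * bracket (w k # map w (sorted_list_of_set K))) * s ! 0"
      unfolding sum_distrib_right
    proof (rule sum.cong[OF refl])
      fix k assume "k \<in> {..<N}"
      then show "?f k = c k * bracket (w k # map w (sorted_list_of_set K)) * s ! 0"
        using mem0[OF finK cK, of k] sgn[of k] by (auto simp: mult.assoc)
    qed
    then have "(\<Sum>k<N. ?f k) = 0" using expand[OF finK cK] by simp
    moreover have nn: "\<forall>k\<in>{..<N}. 0 \<le> ?f k" using s(3) posk by (auto intro: mult_nonneg_nonneg less_imp_le)
    ultimately have "?f k = 0" using k sum_nonneg_eq_0_iff[of "{..<N}" ?f] by blast
    then have "c k * s ! k = 0" using k posk[OF k] by simp
    then show ?thesis using sign_list_nth[OF s(1), of k] s(2) k by auto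
  qed
  show ?thesis
  proof (cases "i \<in> K")
    case True
    have "card K < card {..<N}" using cK N by simp
    then obtain k1 where k1: "k1 < N" "k1 \<notin> K"
      by (metis card_mono finK lessThan_iff not_less subsetI)
    \<comment> \<open>Exchanging \<open>i\<close> for an index outside \<open>K\<close> gives a functional that isolates the coefficient of \<open>i\<close>.\<close>
    let ?L = "insert k1 (K - {i})"
    have L: "finite ?L" "card ?L + 1 = ?n" "i \<notin> ?L" using finK k1 True cK card_Suc_Diff1[OF finK True] by auto
    have zero: "c k * bracket (w k # map w (sorted_list_of_set ?L)) = 0" if "k < N" "k \<noteq> i" for k
      using that out[of k] mem0[OF L(1,2), of k] by (cases "k \<in> K") auto
    have "0 = c i * bracket (w i # map w (sorted_list_of_set ?L))"
      using expand[OF L(1,2)] sum.remove[of "{..<N}" i "\<lambda>k. c k * bracket (w k # map w (sorted_list_of_set ?L))"]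
        i zero by (simp add: sum.neutral)
    moreover have "bracket (w i # map w (sorted_list_of_set ?L)) \<noteq> 0"
    proof -
      have "bracket_on w (insert i ?L) > 0"
        using pos[of "insert i ?L"] i k1 KN L by auto
      then show ?thesis using ins[OF L] by simp
    qed
    ultimately show ?thesis by simp
  qed (use out i in auto)
qed

text \<open>The two expansions of \<open>v\<close> give the relation with coefficients \<open>x\<close> followed by \<open>- y\<close>. Two low
  patterns have at most \<open>4 * k + 1\<close> changes together, apart from the case of \<open>2 * k + 1\<close> changes each.
  In this case the first pattern ends with plus and the negative of the second one starts with plus, so
  that no change is added at the junction. In every case at most \<open>n - 1\<close> changes result.\<close>

lemma opposite_low_variation:
  fixes e f :: "(real ^ 'n::{finite,linorder}) list"
  assumes n: "CARD('n) = 4 * k + 3"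
    and len: "length e = CARD('n)" "length f = CARD('n)"
    and pos: "\<And>K. K \<subseteq> {..<2 * CARD('n)} \<Longrightarrow> card K = CARD('n) \<Longrightarrow> bracket_on (nth (e @ f)) K > 0"
    and v: "v = (\<Sum>i<CARD('n). x i *\<^sub>R e ! i)" "v = (\<Sum>i<CARD('n). y i *\<^sub>R f ! i)"
    and s: "sign_list s" "length s = CARD('n)" "\<And>i. i < CARD('n) \<Longrightarrow> 0 \<le> x i * s ! i" "low_variation k s"
    and t: "sign_list t" "length t = CARD('n)" "\<And>i. i < CARD('n) \<Longrightarrow> 0 \<le> y i * t ! i" "low_variation k t"
  shows "v = 0"
proof -
  let ?n = "CARD('n)"
  let ?c = "\<lambda>i. if i < ?n then x i else - y (i - ?n)"
  let ?u = "s @ map uminus t"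
  have split: "(\<Sum>i<2 * ?n. h i) = (\<Sum>i<?n. h i) + (\<Sum>i<?n. h (?n + i))" for h :: "nat \<Rightarrow> real ^ 'n::{finite,linorder}"
    using sum.atLeastLessThan_concat[of 0 ?n "2 * ?n" h] sum.shift_bounds_nat_ivl[of h 0 ?n ?n]
    by (simp add: lessThan_atLeast0 mult_2 add.commute)
  have dep: "(\<Sum>i<2 * ?n. ?c i *\<^sub>R (e @ f) ! i) = 0"
    unfolding split using v len by (simp add: nth_append sum_negf)
  have ne: "s \<noteq> []" "t \<noteq> []" using s(2) t(2) by auto
  have hd_t: "hd t = -1 \<or> hd t = 1" "last s = -1 \<or> last s = 1"
    using s(1) t(1) hd_in_set[OF ne(2)] last_in_set[OF ne(1)] unfolding sign_list_def by blast+
  have "sign_changes ?u \<le> sign_changes s + sign_changes t + (if last s = hd (map uminus t) then 0 else 1)"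
    using sign_changes_append[of s "map uminus t"] ne by (simp add: sign_changes_uminus)
  moreover have "last s = hd (map uminus t)" if "sign_changes s = 2 * k + 1" "sign_changes t = 2 * k + 1"
    using that s(4) t(4) last_sign_parity[OF t(1) ne(2)] ne by (simp add: low_variation_def hd_map)
  ultimately have "sign_changes ?u < ?n"
    using s(4) t(4) n unfolding low_variation_def by (auto split: if_splits)
  moreover have "sign_list ?u" using s(1) t(1) by (auto simp: sign_list_def)
  moreover have "0 \<le> ?c i * ?u ! i" if "i < 2 * ?n" for i
    using that s(2,3) t(2,3) by (auto simp: nth_append)
  ultimately have "?c i = 0" if "i < 2 * ?n" for i
    using alternating_dependency[of "2 * ?n" "nth (e @ f)" ?c ?u i] pos dep that s(2) t(2) by simp
  then have "x i = 0" if "i < ?n" for i using that by (metis (full_types) mult_2 trans_less_add1)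
  then show ?thesis using v(1) by simp
qed

section \<open>Orientations and hyperconvex triples\<close>

lemma spanning_list_basis:
  fixes vs :: "(real ^ 'n::{finite,linorder}) list"
  assumes "length vs = CARD('n)" "span (set vs) = UNIV"
  shows "distinct vs" "independent (set vs)"
proof -
  have "CARD('n) \<le> card (set vs)"
    using dim_le_card[of "UNIV :: (real ^ 'n::{finite,linorder}) set" "set vs"] assms(2) by (simp add: dim_UNIV)
  then have c: "card (set vs) = length vs" using assms(1) card_length[of vs] by linarith
  then show "distinct vs" by (rule card_distinct)
  show "independent (set vs)"
    using card_le_dim_spanning[of "set vs" UNIV] assms c by (simp add: dim_UNIV)
qed

lemma span_list_combination:
  fixes b :: "(real ^ 'n::finite) list"
  assumes "distinct b" "x \<in> span (set b)"
  shows "\<exists>\<alpha>. x = (\<Sum>i<length b. \<alpha> i *\<^sub>R b ! i)"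
proof -
  obtain u where "x = (\<Sum>v\<in>set b. u v *\<^sub>R v)"
    using assms(2) span_finite[of "set b"] by auto
  also have "\<dots> = (\<Sum>i<length b. u (b ! i) *\<^sub>R b ! i)"
    by (rule sum.reindex_bij_betw[OF bij_betw_nth[OF assms(1) refl refl], symmetric])
  finally show ?thesis by (intro exI[of _ "\<lambda>i. u (b ! i)"])
qed

lemma ordered_bases_length:
  assumes "b \<in> ordered_bases V"
  shows "length b = dim V"
proof -
  have "card (set b) = dim V"
    using assms dim_eq_card_independent[of "set b"] unfolding ordered_bases_def by (metis (mono_tags, lifting) dim_span mem_Collect_eq)
  then show ?thesis using assms distinct_card by (force simp: ordered_bases_def)
qed

lemma ordered_bases_combination:
  assumes b: "b \<in> ordered_bases V" and c: "c \<in> ordered_bases V"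
  obtains M where "M \<in> carrier_mat (length b) (length b)"
    "\<And>j. j < length b \<Longrightarrow> c ! j = (\<Sum>i < length b. (M $$ (i, j)) *\<^sub>R (b ! i))"
proof -
  have len: "length c = length b" using assms ordered_bases_length by metis
  have "\<exists>\<alpha>. c ! j = (\<Sum>i<length b. \<alpha> i *\<^sub>R b ! i)" if "j < length b" for j
  proof (rule span_list_combination)
    have "c ! j \<in> set c" using that len by simp
    then show "c ! j \<in> span (set b)" using b c span_base unfolding ordered_bases_def by blast
  qed (use b in \<open>simp add: ordered_bases_def\<close>)
  then obtain \<alpha> where \<alpha>: "\<And>j. j < length b \<Longrightarrow> c ! j = (\<Sum>i<length b. \<alpha> j i *\<^sub>R b ! i)" by metis
  show thesis
    by (rule that[of "Matrix.mat (length b) (length b) (\<lambda>(i, j). \<alpha> j i)"]) (simp_all add: \<alpha>)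
qed

text \<open>A change of basis of a subspace is extended by the identity on the remaining vectors; the extended
  matrix is block diagonal.\<close>

lemma bracket_combination_append:
  fixes b c r :: "(real ^ 'n::{finite,linorder}) list"
  assumes len: "length b + length r = CARD('n)" "length c = length b"
    and M: "M \<in> carrier_mat (length b) (length b)"
    and c: "\<And>j. j < length b \<Longrightarrow> c ! j = (\<Sum>i < length b. (M $$ (i, j)) *\<^sub>R (b ! i))"
  shows "bracket (c @ r) = Determinant.det M * bracket (b @ r)"
proof -
  let ?l = "length b" and ?m = "length r"
  let ?M = "four_block_mat M (0\<^sub>m ?l ?m) (0\<^sub>m ?m ?l) (1\<^sub>m ?m)"
  have dims: "dim_row M = ?l" "dim_col M = ?l" using M by auto
  have sum_split: "(\<Sum>i<CARD('n). h i) = (\<Sum>i<?l. h i) + (\<Sum>i<?m. h (?l + i))" for h :: "nat \<Rightarrow> real ^ 'n::{finite,linorder}"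
    unfolding len(1)[symmetric]
    using sum.atLeastLessThan_concat[of 0 ?l "?l + ?m" h] sum.shift_bounds_nat_ivl[of h 0 ?l ?m]
    by (simp add: lessThan_atLeast0 add.commute)
  have "bracket (c @ r) = Determinant.det ?M * bracket (b @ r)"
  proof (rule bracket_combination)
    show "length (b @ r) = CARD('n)" "length (c @ r) = CARD('n)" using len by auto
    show "?M \<in> carrier_mat CARD('n) CARD('n)"
      using four_block_carrier_mat[OF M one_carrier_mat[of ?m]] len(1) by simp
    show "(c @ r) ! j = (\<Sum>i<CARD('n). (?M $$ (i, j)) *\<^sub>R (b @ r) ! i)" if "j < CARD('n)" for j
    proof (cases "j < ?l")
      case True
      then have "(\<Sum>i<?l. (?M $$ (i, j)) *\<^sub>R (b @ r) ! i) = (\<Sum>i<?l. (M $$ (i, j)) *\<^sub>R b ! i)"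
        by (intro sum.cong refl) (auto simp: dims nth_append)
      moreover have "(\<Sum>i<?m. (?M $$ (?l + i, j)) *\<^sub>R (b @ r) ! (?l + i)) = 0"
        using True by (intro sum.neutral) (auto simp: dims)
      ultimately show ?thesis unfolding sum_split using True c[of j] len(2) by (simp add: nth_append)
    next
      case False
      then have j: "j - ?l < ?m" using that len(1) by simp
      have "(\<Sum>i<?l. (?M $$ (i, j)) *\<^sub>R (b @ r) ! i) = 0"
        using False j by (intro sum.neutral) (auto simp: dims)
      moreover have "(\<Sum>i<?m. (?M $$ (?l + i, j)) *\<^sub>R (b @ r) ! (?l + i)) = (\<Sum>i<?m. if i = j - ?l then r ! i else 0)"
        using False j by (intro sum.cong refl) (auto simp: dims nth_append)
      ultimately show ?thesis unfolding sum_split using False j len(2) by (simp add: nth_append)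
    qed
  qed
  also have "Determinant.det ?M = Determinant.det M"
    by (subst det_four_block_mat_lower_left_zero[OF M]) auto
  finally show ?thesis .
qed

lemma same_orientation_refl:
  assumes "b \<in> ordered_bases V"
  shows "(b, b) \<in> same_orientation V"
proof -
  have "b ! j = (\<Sum>i<length b. (1\<^sub>m (length b) $$ (i, j)) *\<^sub>R b ! i)" if "j < length b" for j
  proof -
    have "(\<Sum>i<length b. (1\<^sub>m (length b) $$ (i, j)) *\<^sub>R b ! i) = (\<Sum>i<length b. if i = j then b ! i else 0)"
      using that by (intro sum.cong) auto
    then show ?thesis using that by simp
  qed
  then show ?thesis using assms unfolding same_orientation_def
    by (auto intro!: bexI[of _ "1\<^sub>m (length b)"])
qed

text \<open>An orientation is determined by completing one of its bases to a positively oriented basis of the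
  whole space. All later arguments about orientations are reduced to signs of brackets in this way.\<close>

lemma orientation_class_eq:
  fixes b r :: "(real ^ 'n::{finite,linorder}) list"
  assumes b: "b \<in> ordered_bases V" and len: "length b + length r = CARD('n)"
    and pos: "bracket (b @ r) > 0"
  shows "same_orientation V `` {b} = {c \<in> ordered_bases V. bracket (c @ r) > 0}"
proof (intro equalityI subsetI)
  fix c assume "c \<in> same_orientation V `` {b}"
  then obtain M where c: "c \<in> ordered_bases V" and M: "M \<in> carrier_mat (length b) (length b)" "Determinant.det M > 0"
    "\<And>j. j < length b \<Longrightarrow> c ! j = (\<Sum>i < length b. (M $$ (i, j)) *\<^sub>R (b ! i))"
    unfolding same_orientation_def by blast
  have "length c = length b" using b c ordered_bases_length by metis
  from bracket_combination_append[OF len this M(1,3)] show "c \<in> {c \<in> ordered_bases V. bracket (c @ r) > 0}"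
    using c M(2) pos by simp
next
  fix c assume c: "c \<in> {c \<in> ordered_bases V. bracket (c @ r) > 0}"
  then have cV: "c \<in> ordered_bases V" by simp
  obtain M where M: "M \<in> carrier_mat (length b) (length b)"
    "\<And>j. j < length b \<Longrightarrow> c ! j = (\<Sum>i < length b. (M $$ (i, j)) *\<^sub>R (b ! i))"
    using ordered_bases_combination[OF b cV] by blast
  have "length c = length b" using b cV ordered_bases_length by metis
  from bracket_combination_append[OF len this M] have "Determinant.det M > 0"
    using c pos by (simp add: zero_less_mult_iff)
  then show "c \<in> same_orientation V `` {b}"
    using b cV M unfolding same_orientation_def by blast
qed

lemma span_standard_basis: "span (set standard_basis) = (UNIV :: (real ^ 'n::{finite,linorder}) set)"
  by (rule bracket_nonzero_basis) (simp_all add: bracket_standard_basis)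

lemma ordered_bases_UNIV_iff:
  fixes b :: "(real ^ 'n::{finite,linorder}) list"
  shows "b \<in> ordered_bases UNIV \<longleftrightarrow> length b = CARD('n) \<and> bracket b \<noteq> 0"
proof
  assume b: "b \<in> ordered_bases UNIV"
  then have len: "length b = CARD('n)" using ordered_bases_length[OF b] by (simp add: dim_UNIV)
  have s: "standard_basis \<in> ordered_bases (UNIV :: (real ^ 'n::{finite,linorder}) set)"
    using bracket_nonzero_basis[of "standard_basis :: (real ^ 'n::{finite,linorder}) list"]
    by (simp add: ordered_bases_def bracket_standard_basis)
  obtain M where M: "M \<in> carrier_mat (length b) (length b)"
    "\<And>j. j < length b \<Longrightarrow> standard_basis ! j = (\<Sum>i < length b. (M $$ (i, j)) *\<^sub>R (b ! i))"
    using ordered_bases_combination[OF b s] by blast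
  have "bracket ((standard_basis :: (real ^ 'n::{finite,linorder}) list) @ []) = Determinant.det M * bracket (b @ [])"
    using bracket_combination_append[of b "[]" standard_basis M] M len by simp
  then show "length b = CARD('n) \<and> bracket b \<noteq> 0" using len by (auto simp: bracket_standard_basis)
next
  assume "length b = CARD('n) \<and> bracket b \<noteq> 0"
  then show "b \<in> ordered_bases UNIV" using bracket_nonzero_basis[of b] by (simp add: ordered_bases_def)
qed

lemma standard_space_eq:
  "standard_space = (UNIV, {c \<in> ordered_bases UNIV. bracket c > 0} :: (real ^ 'n::{finite,linorder}) list set)"
proof -
  have "same_orientation UNIV `` {standard_basis :: (real ^ 'n::{finite,linorder}) list} = {c \<in> ordered_bases UNIV. bracket c > 0 }"
    using orientation_class_eq[of "standard_basis :: (real ^ 'n::{finite,linorder}) list" UNIV "[]"]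
    by (simp add: bracket_standard_basis ordered_bases_UNIV_iff)
  then show ?thesis
    by (simp add: standard_space_def oriented_span_def span_standard_basis flip: standard_basis_def)
qed

lemma oriented_span_eq_standard_space_iff:
  fixes e :: "(real ^ 'n::{finite,linorder}) list"
  assumes "e \<in> ordered_bases UNIV"
  shows "oriented_span e = standard_space \<longleftrightarrow> bracket e > 0"
proof -
  have sp: "span (set e) = UNIV" and len: "length e = CARD('n)" using assms ordered_bases_UNIV_iff by (auto simp: ordered_bases_def)
  have e: "e \<in> same_orientation UNIV `` {e}" using same_orientation_refl[OF assms] by simp
  show ?thesis
  proof
    assume "oriented_span e = standard_space"
    then show "bracket e > 0" using e by (auto simp: oriented_span_def sp standard_space_eq)
  next
    assume "bracket e > 0"
    then show "oriented_span e = standard_space"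
      using orientation_class_eq[OF assms, of "[]"] len by (simp add: oriented_span_def sp standard_space_eq)
  qed
qed

lemma oriented_flagD:
  fixes F :: "'n::{finite,linorder} oriented_flag"
  assumes F: "F \<in> oriented_flags" and i: "i < CARD('n)"
  shows "subspace (fst (F i))" "dim (fst (F i)) = i"
    and "snd (F i) \<noteq> {}"
    and "b \<in> snd (F i) \<Longrightarrow> b \<in> ordered_bases (fst (F i))"
    and "b \<in> snd (F i) \<Longrightarrow> length b = i"
    and "b \<in> snd (F i) \<Longrightarrow> length b + length r = CARD('n) \<Longrightarrow> bracket (b @ r) > 0 \<Longrightarrow>
      snd (F i) = {c \<in> ordered_bases (fst (F i)). bracket (c @ r) > 0}"
proof -
  show "subspace (fst (F i))" and d: "dim (fst (F i)) = i" using F i by (auto simp: oriented_flags_def)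
  have "snd (F i) \<in> orientations (fst (F i))" using F i by (auto simp: oriented_flags_def)
  then obtain b0 where b0: "b0 \<in> ordered_bases (fst (F i))" "snd (F i) = same_orientation (fst (F i)) `` {b0}"
    by (auto simp: orientations_def elim: quotientE)
  show ne: "snd (F i) \<noteq> {}" using b0 same_orientation_refl by blast
  show ob: "b \<in> snd (F i) \<Longrightarrow> b \<in> ordered_bases (fst (F i))" for b
    unfolding b0(2) same_orientation_def by blast
  show "b \<in> snd (F i) \<Longrightarrow> length b = i" using ob ordered_bases_length d by metis
  show "snd (F i) = {c \<in> ordered_bases (fst (F i)). bracket (c @ r) > 0}"
    if b: "b \<in> snd (F i)" "length b + length r = CARD('n)" "bracket (b @ r) > 0"
  proof -
    obtain M where M: "M \<in> carrier_mat (length b0) (length b0)" "Determinant.det M > 0"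
      "\<And>j. j < length b0 \<Longrightarrow> b ! j = (\<Sum>i < length b0. (M $$ (i, j)) *\<^sub>R (b0 ! i))"
      using b(1) unfolding b0(2) same_orientation_def by blast
    have len: "length b = length b0" using ob[OF b(1)] b0(1) ordered_bases_length by metis
    then have l0: "length b0 + length r = CARD('n)" using b(2) by simp
    have "bracket (b0 @ r) > 0"
      using bracket_combination_append[OF l0 len M(1,3)] M(2) b(3) by (simp add: zero_less_mult_iff)
    from orientation_class_eq[OF b0(1) l0 this] show ?thesis unfolding b0(2) .
  qed
qed

lemma flag_0:
  fixes F :: "'n::{finite,linorder} oriented_flag"
  assumes "F \<in> oriented_flags"
  shows "snd (F 0) = {[]}" 
proof -
  have "0 < CARD('n)" by simp
  then show ?thesis using oriented_flagD(3,5)[OF assms] by (metis (no_types, lifting) length_0_conv equals0I insertI1 insert_absorb is_singletonI' is_singleton_def singletonD)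
qed

text \<open>A direct sum that is the standard oriented space has positive concatenated bases. The dimensions
  add up to \<open>n\<close>, so that spanning implies independence.\<close>

lemma hyperconvex_bracket:
  fixes F1 F2 F3 :: "'n::{finite,linorder} oriented_flag"
  assumes hc: "hyperconvex F1 F2 F3"
    and F: "F1 \<in> oriented_flags" "F2 \<in> oriented_flags" "F3 \<in> oriented_flags"
    and i: "i1 < CARD('n)" "i2 < CARD('n)" "i3 < CARD('n)" "i1 + i2 + i3 = CARD('n)"
    and b: "b1 \<in> snd (F1 i1)" "b2 \<in> snd (F2 i2)" "b3 \<in> snd (F3 i3)"
  shows "bracket (b1 @ b2 @ b3) > 0"
proof -
  have b': "b1 \<in> ordered_bases (fst (F1 i1))" "b2 \<in> ordered_bases (fst (F2 i2))" "b3 \<in> ordered_bases (fst (F3 i3))"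
    using oriented_flagD(4) F i b by blast+
  have len: "length b1 = i1" "length b2 = i2" "length b3 = i3"
    using oriented_flagD(5) F i b by blast+
  have eq: "oriented_sum (oriented_sum (F1 i1) (F2 i2)) (F3 i3) = standard_space"
    using hc i unfolding hyperconvex_def by blast
  have sp: "fst (F1 i1) = span (set b1)" "fst (F2 i2) = span (set b2)" "fst (F3 i3) = span (set b3)"
    using b' by (auto simp: ordered_bases_def)
  have f12: "fst (oriented_sum (F1 i1) (F2 i2)) = span (set (b1 @ b2))"
    by (simp add: oriented_sum_def Let_def sp span_Un)
  have f123: "fst (oriented_sum (oriented_sum (F1 i1) (F2 i2)) (F3 i3)) = span (set ((b1 @ b2) @ b3))"
    unfolding set_append[of "b1 @ b2" b3] span_Un f12[symmetric] sp(3)[symmetric]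
    by (simp add: oriented_sum_def Let_def)
  then have U: "span (set ((b1 @ b2) @ b3)) = UNIV" unfolding eq by (simp add: standard_space_eq)
  have l: "length ((b1 @ b2) @ b3) = CARD('n)" using len i by simp
  note bas = spanning_list_basis[OF l U]
  have ob12: "b1 @ b2 \<in> ordered_bases (span (set (b1 @ b2)))"
    using bas independent_mono[OF bas(2), of "set (b1 @ b2)"] by (auto simp: ordered_bases_def)
  have ob123: "(b1 @ b2) @ b3 \<in> ordered_bases UNIV"
    using bas U by (auto simp: ordered_bases_def)
  have s12: "b1 @ b2 \<in> snd (oriented_sum (F1 i1) (F2 i2))"
    using same_orientation_refl[OF ob12] b(1,2) f12 by (auto simp: oriented_sum_def Let_def)
  have "(b1 @ b2) @ b3 \<in> snd (oriented_sum (oriented_sum (F1 i1) (F2 i2)) (F3 i3))"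
  proof -
    have "(b1 @ b2) @ b3 \<in> same_orientation (fst (oriented_sum (oriented_sum (F1 i1) (F2 i2)) (F3 i3))) `` {(b1 @ b2) @ b3}"
      using same_orientation_refl[OF ob123] f123 U by simp
    then show ?thesis using s12 b(3) unfolding oriented_sum_def[of "oriented_sum (F1 i1) (F2 i2)"] Let_def
      by (simp, rule_tac bexI[of _ "b1 @ b2"], rule_tac bexI[of _ b3]) simp_all
  qed
  then show ?thesis unfolding eq by (simp add: standard_space_eq)
qed

section \<open>Halfspaces in coordinates\<close>

text \<open>The closed cone over the closure of a halfspace, as a finite union of closed orthants of the
  basis.\<close>

definition closed_half :: "nat \<Rightarrow> (real ^ 'n::{finite,linorder}) list \<Rightarrow> (real ^ 'n::{finite,linorder}) set" where
  "closed_half k e = {v. \<exists>s. sign_list s \<and> length s = CARD('n) \<and> low_variation k s \<and>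
     (\<forall>i < CARD('n). 0 \<le> coordinates e v ! i * s ! i)}"

lemma coordinates_expansion:
  fixes e :: "(real ^ 'n::{finite,linorder}) list"
  assumes "e \<in> ordered_bases UNIV"
  shows "v = (\<Sum>i<CARD('n). coordinates e v ! i *\<^sub>R e ! i)"
proof -
  have e: "distinct e" "independent (set e)" "span (set e) = UNIV" "length e = CARD('n)"
    using assms ordered_bases_UNIV_iff by (auto simp: ordered_bases_def)
  have "v = (\<Sum>b\<in>set e. representation (set e) v b *\<^sub>R b)"
    using sum_representation_eq[OF e(2), of v "set e"] e(3) by simp
  also have "\<dots> = (\<Sum>i<CARD('n). representation (set e) v (e ! i) *\<^sub>R e ! i)"
    unfolding e(4)[symmetric]
    by (rule sum.reindex_bij_betw[OF bij_betw_nth[OF e(1) refl refl], symmetric])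
  also have "\<dots> = (\<Sum>i<CARD('n). coordinates e v ! i *\<^sub>R e ! i)"
    using e(4) by (simp add: coordinates_def)
  finally show ?thesis .
qed

lemma coordinates_unique:
  fixes e :: "(real ^ 'n::{finite,linorder}) list"
  assumes e: "e \<in> ordered_bases UNIV" and v: "v = (\<Sum>i<CARD('n). c i *\<^sub>R e ! i)" and i: "i < CARD('n)"
  shows "coordinates e v ! i = c i"
proof -
  have l: "length e = CARD('n)" "bracket e \<noteq> 0" using e ordered_bases_UNIV_iff by auto
  define A where "A = take i e"
  define B where "B = drop (Suc i) e"
  have eAB: "e = A @ e ! i # B" using id_take_nth_drop[of i e] i l unfolding A_def B_def by simp
  have len: "length A + Suc (length B) = CARD('n)" using i l by (simp add: A_def B_def)
  define d where "d j = c j - coordinates e v ! j" for j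
  have "(\<Sum>j<CARD('n). d j *\<^sub>R e ! j) = 0"
    using v coordinates_expansion[OF e, of v] by (simp add: d_def scaleR_left_diff_distrib sum_subtractf)
  then have "0 = bracket (A @ (\<Sum>j<CARD('n). d j *\<^sub>R e ! j) # B)"
    using linear_0[OF linear_bracket[OF len]] by simp
  also have "\<dots> = (\<Sum>j<CARD('n). d j * bracket (A @ e ! j # B))"
    using linear_sum[OF linear_bracket[OF len], of "\<lambda>j. d j *\<^sub>R e ! j" "{..<CARD('n)}"]
      linear_cmul[OF linear_bracket[OF len]] by simp
  also have "\<dots> = (\<Sum>j<CARD('n). if j = i then d i * bracket e else 0)"
  proof (rule sum.cong[OF refl])
    fix j assume "j \<in> {..<CARD('n)}"
    then have j: "j < length e" using l by simp
    show "d j * bracket (A @ e ! j # B) = (if j = i then d i * bracket e else 0)"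
    proof (cases "j = i")
      case False
      have "e ! j \<in> set A \<union> set B"
      proof (cases "j < i")
        case True
        then have "e ! j = A ! j" "j < length A" using j i l by (auto simp: A_def)
        then show ?thesis by (metis UnI1 nth_mem)
      next
        case F: False
        then have "e ! j = B ! (j - Suc i)" "j - Suc i < length B" using j False by (auto simp: B_def)
        then show ?thesis by (metis UnI2 nth_mem)
      qed
      then show ?thesis using bracket_repeated'[OF len] False by simp
    qed (use eAB in simp)
  qed
  also have "\<dots> = d i * bracket e" using i by simp
  finally show ?thesis using l by (simp add: d_def)
qed

lemma linear_coordinates:
  fixes e :: "(real ^ 'n::{finite,linorder}) list"
  assumes "e \<in> ordered_bases UNIV" "i < CARD('n)"
  shows "linear (\<lambda>v. coordinates e v ! i)"
proof (rule linearI)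
  note ex = coordinates_expansion[OF assms(1)]
  show "coordinates e (x + y) ! i = coordinates e x ! i + coordinates e y ! i" for x y
  proof (rule coordinates_unique[OF assms(1) _ assms(2)])
    show "x + y = (\<Sum>i<CARD('n). (coordinates e x ! i + coordinates e y ! i) *\<^sub>R e ! i)"
      using ex[of x] ex[of y] by (simp add: scaleR_left_distrib sum.distrib)
  qed
  show "coordinates e (r *\<^sub>R x) ! i = r *\<^sub>R coordinates e x ! i" for r x
    unfolding real_scaleR_def
  proof (rule coordinates_unique[OF assms(1) _ assms(2)])
    show "r *\<^sub>R x = (\<Sum>i<CARD('n). (r * coordinates e x ! i) *\<^sub>R e ! i)"
      using arg_cong[OF ex[of x], of "\<lambda>u. r *\<^sub>R u"] by (simp add: scaleR_sum_right)
  qed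
qed

lemma sign_assignments_iff:
  "s \<in> sign_assignments c \<longleftrightarrow> sign_list s \<and> length s = length c \<and> (\<forall>i<length c. 0 \<le> c ! i * s ! i)"
proof
  assume s: "s \<in> sign_assignments c"
  then have "sign_list s"
    unfolding sign_list_def sign_assignments_def by (auto simp: in_set_conv_nth)
  moreover have "0 \<le> c ! i * s ! i" if "i < length c" for i
    using s that by (cases "c ! i = 0") (auto simp: sign_assignments_def abs_sgn[symmetric])
  ultimately show "sign_list s \<and> length s = length c \<and> (\<forall>i<length c. 0 \<le> c ! i * s ! i)"
    using s by (auto simp: sign_assignments_def)
next
  assume s: "sign_list s \<and> length s = length c \<and> (\<forall>i<length c. 0 \<le> c ! i * s ! i)"
  have "s ! i = sgn (c ! i)" if "i < length c" "c ! i \<noteq> 0" for i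
    using s that sign_list_nth[of s i] by (auto simp: sgn_if zero_le_mult_iff)
  then show "s \<in> sign_assignments c"
    using s sign_list_nth[of s] by (auto simp: sign_assignments_def)
qed

lemma finite_sign_assignments: "finite (sign_assignments c)"
  by (rule finite_subset[OF _ finite_lists_length_eq[of "{-1, 1 :: real}" "length c"]])
    (auto simp: sign_assignments_def in_set_conv_nth)

lemma sign_assignments_nonempty: "sign_assignments c \<noteq> {}"
proof -
  have "map (\<lambda>x. if x = 0 then 1 else sgn x) c \<in> sign_assignments c"
    by (auto simp: sign_assignments_def sgn_if)
  then show ?thesis by blast
qed

lemma closed_half_iff:
  fixes e :: "(real ^ 'n::{finite,linorder}) list"
  assumes "length e = CARD('n)"
  shows "v \<in> closed_half k e \<longleftrightarrow> (\<exists>s \<in> sign_assignments (coordinates e v). low_variation k s)"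
  unfolding closed_half_def using assms by (auto simp: sign_assignments_iff coordinates_def)

text \<open>If two consecutive signs over the trailing zeros agreed, flipping all later signs would add a
  change. So a maximal assignment alternates there.\<close>

lemma last_sign_maximizer:
  assumes s: "s \<in> sign_assignments c" "sign_changes s = max_sign_changes c"
    and m: "m < length c" "c ! m \<noteq> 0" "\<And>i. m < i \<Longrightarrow> i < length c \<Longrightarrow> c ! i = 0"
  shows "last s = (-1) ^ (length c - 1 - m) * sgn (c ! m)"
proof -
  have sl: "sign_list s" and len: "length s = length c" using s(1) by (auto simp: sign_assignments_iff)
  have step: "s ! Suc i = - s ! i" if i: "m \<le> i" "Suc i < length c" for i
  proof (rule ccontr)
    assume neq: "s ! Suc i \<noteq> - s ! i"
    define t where "t = take (Suc i) s @ map uminus (drop (Suc i) s)"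
    have lt: "length t = length c" using len i by (simp add: t_def)
    have tn: "t ! j = (if j \<le> i then s ! j else - s ! j)" if "j < length c" for j
      using that len i by (auto simp: t_def nth_append)
    have "t \<in> sign_assignments c"
      using s(1) m i lt tn by (auto simp: sign_assignments_def)
    then have "sign_changes t \<le> max_sign_changes c"
      unfolding max_sign_changes_def using finite_sign_assignments by (intro Max_ge) auto
    moreover have "change_set t = insert i (change_set s)"
    proof -
      have "i \<in> change_set t"
        using neq i lt tn sign_list_nth[OF sl, of i] sign_list_nth[OF sl, of "Suc i"] len
        by (auto simp: change_set_def)
      moreover have "\<forall>j. j \<noteq> i \<longrightarrow> (j \<in> change_set t \<longleftrightarrow> j \<in> change_set s)"
      proof (intro allI impI)
        fix j assume that: "j \<noteq> i"
        show "j \<in> change_set t \<longleftrightarrow> j \<in> change_set s"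
        using that lt len tn by (cases "j < i") (auto simp: change_set_def)
      qed
      ultimately have "x \<in> change_set t \<longleftrightarrow> x \<in> insert i (change_set s)" for x
        by (cases "x = i") simp_all
      then show ?thesis by (simp only: set_eq_iff simp_thms)
    qed
    moreover have "i \<notin> change_set s"
      using neq i len sign_list_nth[OF sl, of i] sign_list_nth[OF sl, of "Suc i"] by (auto simp: change_set_def)
    ultimately show False using s(2) by (simp add: sign_changes_eq)
  qed
  have "s ! (m + d) = (-1) ^ d * s ! m" if "m + d < length c" for d
    using that by (induction d) (auto simp: step)
  from this[of "length c - 1 - m"] have "s ! (length c - 1) = (-1) ^ (length c - 1 - m) * s ! m" using m by simp
  moreover have "last s = s ! (length c - 1)" using len m by (metis last_conv_nth list.size(3) not_less0)
  moreover have "s ! m = sgn (c ! m)" using s(1) m by (auto simp: sign_assignments_def)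
  ultimately show ?thesis by simp
qed

text \<open>By the previous result all maximal assignments end with the same sign. So the condition on one
  maximal assignment is a condition on all assignments.\<close>

lemma halfspace_condition_iff:
  assumes c: "\<exists>i<length c. c ! i \<noteq> 0"
  shows "(max_sign_changes c \<le> 2 * k + 1 \<and>
        (max_sign_changes c = 2 * k + 1 \<longrightarrow>
           (\<exists>s \<in> sign_assignments c. sign_changes s = max_sign_changes c \<and> last s = 1)))
    \<longleftrightarrow> (\<forall>s \<in> sign_assignments c. low_variation k s)"
proof -
  define m where "m = Max {i. i < length c \<and> c ! i \<noteq> 0}"
  have "m \<in> {i. i < length c \<and> c ! i \<noteq> 0}"
    unfolding m_def using c by (intro Max_in) auto
  moreover have "i \<le> m" if "i < length c" "c ! i \<noteq> 0" for i
    unfolding m_def using that by (intro Max_ge) auto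
  ultimately have m: "m < length c" "c ! m \<noteq> 0" "\<And>i. m < i \<Longrightarrow> i < length c \<Longrightarrow> c ! i = 0"
    by (auto simp: not_le[symmetric])
  note last = last_sign_maximizer[OF _ _ m]
  have le: "sign_changes s \<le> max_sign_changes c" if "s \<in> sign_assignments c" for s
    unfolding max_sign_changes_def using finite_sign_assignments that by (intro Max_ge) auto
  obtain s0 where s0: "s0 \<in> sign_assignments c" "sign_changes s0 = max_sign_changes c"
  proof -
    have "max_sign_changes c \<in> sign_changes ` sign_assignments c"
      unfolding max_sign_changes_def using finite_sign_assignments sign_assignments_nonempty by (intro Max_in) auto
    then show thesis using that by auto
  qed
  show ?thesis
  proof
    assume L: "max_sign_changes c \<le> 2 * k + 1 \<and> (max_sign_changes c = 2 * k + 1 \<longrightarrow>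
           (\<exists>s \<in> sign_assignments c. sign_changes s = max_sign_changes c \<and> last s = 1))"
    show "\<forall>s \<in> sign_assignments c. low_variation k s"
    proof
      fix s assume s: "s \<in> sign_assignments c"
      show "low_variation k s"
      proof (cases "sign_changes s \<le> 2 * k")
        case False
        then have sc: "sign_changes s = 2 * k + 1" "max_sign_changes c = 2 * k + 1" using le[OF s] L by auto
        then obtain s' where s': "s' \<in> sign_assignments c" "sign_changes s' = max_sign_changes c" "last s' = 1"
          using L by blast
        have "last s = 1" using last[OF s] last[OF s'(1,2)] sc s'(3) by simp
        then show ?thesis using sc by (simp add: low_variation_def)
      qed (simp add: low_variation_def)
    qed
  next
    assume R: "\<forall>s \<in> sign_assignments c. low_variation k s"
    then have "low_variation k s0" using s0 by blast
    then show "max_sign_changes c \<le> 2 * k + 1 \<and> (max_sign_changes c = 2 * k + 1 \<longrightarrow>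
           (\<exists>s \<in> sign_assignments c. sign_changes s = max_sign_changes c \<and> last s = 1))"
      using s0 unfolding low_variation_def by (metis add_diff_cancel_left' le_add1 le_trans nat_le_linear not_less_eq_eq
          Suc_eq_plus1 order_refl)
  qed
qed

text \<open>The signs of \<open>alt_rev\<close> are those that moving the vectors into the reversed order costs.\<close>

lemma bracket_alt_rev:
  fixes xs :: "(real ^ 'n::{finite,linorder}) list"
  assumes "length pre + length xs + length r = CARD('n)"
  shows "bracket (pre @ alt_rev xs @ r) = bracket (pre @ xs @ r)"
  using assms
proof (induction xs arbitrary: pre r)
  case (Cons x xs)
  have l: "length (pre @ alt_rev xs) + Suc (length r) = CARD('n)" using Cons.prems by simp
  have sq: "(-1 :: real) ^ length xs * ((-1) ^ length xs * y) = y" for y by (simp flip: power_add mult.assoc)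
  have "bracket (pre @ alt_rev (x # xs) @ r) = (-1) ^ length xs * bracket (pre @ alt_rev xs @ x # r)"
    using linear_cmul[OF linear_bracket[OF l], of "(-1) ^ length xs" x] by simp
  also have "bracket (pre @ alt_rev xs @ x # r) = bracket (pre @ xs @ x # r)"
    using Cons.IH[of pre "x # r"] Cons.prems by simp
  also have "\<dots> = (-1) ^ length xs * bracket (pre @ (x # xs) @ r)"
    using bracket_move[of pre xs r x] Cons.prems sq[of "bracket (pre @ xs @ x # r)"] by simp
  finally show ?case by (simp add: sq)
qed simp

section \<open>Adapted bases\<close>

lemma ordered_basesI_dim:
  fixes d :: "(real ^ 'n::{finite,linorder}) list"
  assumes "distinct d" "independent (set d)" "set d \<subseteq> V" "subspace V" "length d = dim V"
  shows "d \<in> ordered_bases V"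
proof -
  have "V \<subseteq> span (set d)"
    by (rule card_ge_dim_independent) (use assms distinct_card[OF assms(1)] in auto)
  moreover have "span (set d) \<subseteq> V" by (rule span_minimal[OF assms(3,4)])
  ultimately show ?thesis using assms(1,2) by (auto simp: ordered_bases_def)
qed

lemma bracket_append_parts:
  fixes b r :: "(real ^ 'n::{finite,linorder}) list"
  assumes "length (b @ r) = CARD('n)" "bracket (b @ r) \<noteq> 0"
  shows "distinct b" "independent (set b)" "distinct r" "independent (set r)" "span (set b) \<inter> span (set r) = {0}"
proof -
  note bas = bracket_nonzero_basis[OF assms]
  show "distinct b" "distinct r" using bas by auto
  show i: "independent (set b)" "independent (set r)"
    using independent_mono[OF bas(2)] by auto
  have "dim {x + y |x y. x \<in> span (set b) \<and> y \<in> span (set r)} + dim (span (set b) \<inter> span (set r))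
      = dim (span (set b)) + dim (span (set r))"
    by (rule dim_sums_Int) auto
  moreover have "{x + y |x y. x \<in> span (set b) \<and> y \<in> span (set r)} = UNIV"
    using bas(3) by (simp add: span_Un)
  moreover have "dim (span (set b)) + dim (span (set r)) = CARD('n)"
    using bas(1) assms(1) by (simp add: dim_eq_card_independent[OF i(1)] dim_eq_card_independent[OF i(2)] distinct_card)
  ultimately have "dim (span (set b) \<inter> span (set r)) = 0" by (simp add: dim_UNIV)
  then show "span (set b) \<inter> span (set r) = {0}"
    by (metis Int_iff dim_eq_0 singletonI span_zero subset_singleton_iff empty_iff)
qed

lemma adapted_basisD:
  fixes e :: "(real ^ 'n::{finite,linorder}) list"
  assumes e: "adapted_basis F G e"
  shows "length e = CARD('n)" "bracket e > 0" "e \<in> ordered_bases UNIV"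
    and "1 \<le> i \<Longrightarrow> i < CARD('n) \<Longrightarrow> F i = oriented_span (take i e)"
    and "1 \<le> i \<Longrightarrow> i < CARD('n) \<Longrightarrow> G i = oriented_span (drop (CARD('n) - i) e)"
    and "1 \<le> i \<Longrightarrow> i < CARD('n) \<Longrightarrow> take i e \<in> snd (F i)"
    and "1 \<le> i \<Longrightarrow> i < CARD('n) \<Longrightarrow> drop (CARD('n) - i) e \<in> snd (G i)"
proof -
  show ob: "e \<in> ordered_bases UNIV" using e by (simp add: adapted_basis_def)
  then show "length e = CARD('n)" using ordered_bases_UNIV_iff by blast
  show "bracket e > 0" using e oriented_span_eq_standard_space_iff[OF ob] by (simp add: adapted_basis_def)
  show F: "1 \<le> i \<Longrightarrow> i < CARD('n) \<Longrightarrow> F i = oriented_span (take i e)"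
    and G: "1 \<le> i \<Longrightarrow> i < CARD('n) \<Longrightarrow> G i = oriented_span (drop (CARD('n) - i) e)"
    using e by (auto simp: adapted_basis_def)
  have sub: "b \<in> ordered_bases (span (set b))" if "distinct b" "set b \<subseteq> set e" for b
    using ob that independent_mono by (auto simp: ordered_bases_def)
  have de: "distinct e" using ob by (simp add: ordered_bases_def)
  have mem: "b \<in> snd (oriented_span b)" if "distinct b" "set b \<subseteq> set e" for b
    using same_orientation_refl[OF sub[OF that]] by (simp add: oriented_span_def)
  show "1 \<le> i \<Longrightarrow> i < CARD('n) \<Longrightarrow> take i e \<in> snd (F i)"
    using F mem[of "take i e"] de set_take_subset[of i e] by simp
  show "1 \<le> i \<Longrightarrow> i < CARD('n) \<Longrightarrow> drop (CARD('n) - i) e \<in> snd (G i)"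
    using G mem[of "drop (CARD('n) - i) e"] de set_drop_subset[of "CARD('n) - i" e] by simp
qed

text \<open>Two bases of the same subspace that become positive with the same complement \<open>r\<close> define the same
  orientation.\<close>

lemma oriented_span_eqI:
  fixes F :: "'n::{finite,linorder} oriented_flag"
  assumes F: "F \<in> oriented_flags" "i < CARD('n)"
    and b: "b \<in> snd (F i)" "length b + length r = CARD('n)" "bracket (b @ r) > 0"
    and d: "set d \<subseteq> fst (F i)" "length d = i" "bracket (d @ r) > 0"
  shows "F i = oriented_span d"
proof -
  have lb: "length b = i" using oriented_flagD(5)[OF F b(1)] .
  have l: "length (d @ r) = CARD('n)" using lb b(2) d(2) by simp
  have ob: "d \<in> ordered_bases (fst (F i))"
    by (rule ordered_basesI_dim)
      (use bracket_append_parts[OF l] d oriented_flagD(1,2)[OF F] in auto)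
  then have sp: "span (set d) = fst (F i)" by (simp add: ordered_bases_def)
  have "snd (F i) = {c \<in> ordered_bases (fst (F i)). bracket (c @ r) > 0}"
    by (rule oriented_flagD(6)[OF F b])
  also have "\<dots> = same_orientation (fst (F i)) `` {d}"
    by (rule orientation_class_eq[OF ob _ d(3), symmetric]) (use lb b(2) d(2) in simp)
  finally show ?thesis by (simp add: oriented_span_def sp prod_eq_iff)
qed

text \<open>The spans are exchanged by the reversal. The orientations are compared by completing both bases
  with the rest of \<open>e\<close>; rotations do not matter in odd dimension.\<close>

lemma adapted_basis_alt_rev:
  fixes e :: "(real ^ 'n::{finite,linorder}) list"
  assumes e: "adapted_basis F G e" and F: "F \<in> oriented_flags" "G \<in> oriented_flags" and odd: "odd CARD('n)"
  shows "adapted_basis G F (alt_rev e)"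
proof -
  let ?n = "CARD('n)"
  have len: "length e = ?n" and pos: "bracket e > 0" using adapted_basisD[OF e] by auto
  have pos': "bracket (alt_rev e) > 0" using bracket_alt_rev[of "[]" e "[]"] len pos by simp
  have ob: "alt_rev e \<in> ordered_bases UNIV" using pos' len by (simp add: ordered_bases_UNIV_iff)
  have app: "alt_rev (xs @ ys) = alt_rev ys @ map (\<lambda>x. (-1) ^ length ys *\<^sub>R x) (alt_rev xs)"
    for xs ys :: "(real ^ 'n::{finite,linorder}) list"
    by (induction xs) (simp_all add: power_add)
  have sub: "set (alt_rev xs) \<subseteq> span (set xs)" for xs :: "(real ^ 'n::{finite,linorder}) list"
  proof (induction xs)
    case (Cons x xs)
    then show ?case using span_mono[of "set xs" "insert x (set xs)"] by (auto intro: span_scale span_base)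
  qed simp
  show ?thesis
    unfolding adapted_basis_def
  proof (intro conjI ballI)
    show "oriented_span (alt_rev e) = standard_space"
      using oriented_span_eq_standard_space_iff[OF ob] pos' by simp
    fix i assume "i \<in> {1..<?n}"
    then have i: "1 \<le> i" "i < ?n" by auto
    let ?l = "take (?n - i) e" and ?r = "drop (?n - i) e"
    have e_split: "?l @ ?r = e" by simp
    have a: "alt_rev e = alt_rev ?r @ map (\<lambda>x. (-1) ^ length ?r *\<^sub>R x) (alt_rev ?l)"
      by (subst e_split[symmetric], rule app)
    have "take i (alt_rev e) = alt_rev ?r" unfolding a using len i by simp
    moreover have "G i = oriented_span (alt_rev ?r)"
    proof (rule oriented_span_eqI[OF F(2) i(2), where r = ?l])
      show "?r \<in> snd (G i)" using adapted_basisD(7)[OF e i] .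
      show "bracket (?r @ ?l) > 0" using bracket_rotate[of ?r ?l] len i odd pos by simp
      then show "bracket (alt_rev ?r @ ?l) > 0" using bracket_alt_rev[of "[]" ?r ?l] len i by simp
      show "set (alt_rev ?r) \<subseteq> fst (G i)" using sub[of ?r] adapted_basisD(5)[OF e i] by (simp add: oriented_span_def)
    qed (use len i in auto)
    ultimately show "G i = oriented_span (take i (alt_rev e))" by simp
    let ?l = "take i e" and ?r = "drop i e"
    let ?d = "map (\<lambda>x. (-1) ^ length ?r *\<^sub>R x) (alt_rev ?l)"
    have e_split: "?l @ ?r = e" by simp
    have a: "alt_rev e = alt_rev ?r @ ?d"
      by (subst e_split[symmetric], rule app)
    have "drop (?n - i) (alt_rev e) = ?d" unfolding a using len i by simp
    moreover have "F i = oriented_span ?d"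
    proof (rule oriented_span_eqI[OF F(1) i(2), where r = ?r])
      show "?l \<in> snd (F i)" using adapted_basisD(6)[OF e i] .
      show "bracket (?l @ ?r) > 0" using pos by simp
      have "bracket (?d @ ?r) = bracket (?r @ ?d)" by (rule bracket_rotate) (use len i odd in auto)
      also have "\<dots> = bracket (alt_rev ?r @ ?d)" using bracket_alt_rev[of "[]" ?r ?d] len i by simp
      finally show "bracket (?d @ ?r) > 0" using pos' a by simp
      show "set ?d \<subseteq> fst (F i)"
        using sub[of ?l] adapted_basisD(4)[OF e i] by (auto simp: oriented_span_def intro: span_scale)
    qed (use len i in auto)
    ultimately show "F i = oriented_span (drop (?n - i) (alt_rev e))" by simp
  qed (rule ob)
qed

text \<open>The \<open>i\<close>-th vectors of both bases span the line in which the \<open>i\<close>-th step of the first flag meets the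
  opposite step of the second flag. Replacing the vectors one after another keeps the bracket
  positive, so the factors are positive.\<close>

lemma adapted_basis_unique:
  fixes e e' :: "(real ^ 'n::{finite,linorder}) list"
  assumes e: "adapted_basis F G e" and e': "adapted_basis F G e'" and F: "F \<in> oriented_flags"
  shows "\<exists>c. \<forall>i < CARD('n). c i > 0 \<and> e' ! i = c i *\<^sub>R e ! i"
proof -
  let ?n = "CARD('n)"
  note E = adapted_basisD[OF e] and E' = adapted_basisD[OF e']
  have spt: "span (set (take i e')) = span (set (take i e))" if le: "i \<le> ?n" for i
  proof -
    consider "i = 0" | "1 \<le> i" "i < ?n" | "i = ?n" using le by linarith
    then show ?thesis
    proof cases
      case 2
      then show ?thesis using E(4)[OF 2] E'(4)[OF 2] by (simp add: oriented_span_def)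
    next
      case 3
      then show ?thesis using E(1,3) E'(1,3) by (simp add: ordered_bases_def)
    qed simp
  qed
  have spd: "span (set (drop i e')) = span (set (drop i e))" if "i < ?n" for i
  proof (cases "i = 0")
    case True
    then show ?thesis using E(3) E'(3) by (simp add: ordered_bases_def)
  next
    case False
    then have "1 \<le> ?n - i" "?n - i < ?n" "?n - (?n - i) = i" using that by auto
    then show ?thesis using E(5)[of "?n - i"] E'(5)[of "?n - i"] by (simp add: oriented_span_def)
  qed
  have "\<exists>c. e' ! i = c *\<^sub>R e ! i" if i: "i < ?n" for i
  proof -
    define A where "A = take i e"
    define B where "B = drop (Suc i) e"
    define x where "x = e ! i"
    define y where "y = e' ! i"
    have eAB: "A @ x # B = e" using id_take_nth_drop[of i e] i E(1) by (simp add: A_def B_def x_def)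
    have len: "length A + Suc (length B) = ?n" using i E(1) by (simp add: A_def B_def)
    have nz: "bracket (A @ x # B) \<noteq> 0" using E(2) eAB by simp
    have "y \<in> set (take (Suc i) e')" using i E'(1) by (simp add: y_def take_Suc_conv_app_nth)
    then have "y \<in> span (set (take (Suc i) e))" using spt[of "Suc i"] i span_base by (metis Suc_leI)
    moreover have "take (Suc i) e = A @ [x]" using i E(1) by (simp add: A_def x_def take_Suc_conv_app_nth)
    ultimately have "y \<in> span (insert x (set A))" by simp
    then obtain \<alpha> where \<alpha>: "y - \<alpha> *\<^sub>R x \<in> span (set A)" by (auto simp: span_insert)
    have "y \<in> set (drop i e')" using i E'(1) by (simp add: y_def Cons_nth_drop_Suc[symmetric])
    then have "y \<in> span (set (drop i e))" using spd[of i] i span_base by metis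
    moreover have xB: "drop i e = x # B" using i E(1) by (simp add: B_def x_def Cons_nth_drop_Suc)
    ultimately have yxB: "y \<in> span (insert x (set B))" by simp
    then obtain \<beta> where \<beta>: "y - \<beta> *\<^sub>R x \<in> span (set B)" by (auto simp: span_insert)
    have "y - \<alpha> *\<^sub>R x \<in> span (set (x # B))"
      using yxB span_diff span_scale span_base by (metis insertI1 list.simps(15))
    moreover have "span (set A) \<inter> span (set (x # B)) = {0}"
      by (rule bracket_append_parts(5)) (use len nz in auto)
    ultimately have "y - \<alpha> *\<^sub>R x = 0" using \<alpha> by blast
    then show ?thesis by (auto simp: x_def y_def)
  qed
  then obtain c where c: "\<And>i. i < ?n \<Longrightarrow> e' ! i = c i *\<^sub>R e ! i" by metis
  have P: "bracket (take i e' @ drop i e) > 0" if le: "i \<le> ?n" for i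
  proof -
    consider "i = 0" | "1 \<le> i" "i < ?n" | "i = ?n" using le by linarith
    then show ?thesis
    proof cases
      case 2
      have "snd (F i) = {c \<in> ordered_bases (fst (F i)). bracket (c @ drop i e) > 0}"
        by (rule oriented_flagD(6)[OF F 2(2) E(6)[OF 2]]) (use 2 E(1,2) in auto)
      then show ?thesis using E'(6)[OF 2] by blast
    qed (use E E' in auto)
  qed
  have "c i > 0" if i: "i < ?n" for i
  proof -
    have len: "length (take i e') + Suc (length (drop (Suc i) e)) = ?n" using i E(1) E'(1) by simp
    have "take (Suc i) e' @ drop (Suc i) e = take i e' @ (c i *\<^sub>R e ! i) # drop (Suc i) e"
      using i E'(1) c[OF i] by (simp add: take_Suc_conv_app_nth)
    moreover have "drop i e = e ! i # drop (Suc i) e" using i E(1) by (simp add: Cons_nth_drop_Suc)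
    ultimately have "bracket (take (Suc i) e' @ drop (Suc i) e) = c i * bracket (take i e' @ drop i e)"
      using linear_cmul[OF linear_bracket[OF len], of "c i" "e ! i"] by simp
    then show ?thesis using P[of "Suc i"] P[of i] i by (simp add: zero_less_mult_iff)
  qed
  then show ?thesis using c by blast
qed

lemma closed_half_scale:
  fixes e e' :: "(real ^ 'n::{finite,linorder}) list"
  assumes e: "e \<in> ordered_bases UNIV" and e': "e' \<in> ordered_bases UNIV"
    and c: "\<And>i. i < CARD('n) \<Longrightarrow> c i > 0 \<and> e' ! i = c i *\<^sub>R e ! i"
  shows "closed_half k e' = closed_half k e"
proof -
  have "coordinates e v ! i = c i * coordinates e' v ! i" if "i < CARD('n)" for v i
  proof (rule coordinates_unique[OF e _ that])
    have "v = (\<Sum>i<CARD('n). coordinates e' v ! i *\<^sub>R e' ! i)" by (rule coordinates_expansion[OF e'])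
    also have "\<dots> = (\<Sum>i<CARD('n). (c i * coordinates e' v ! i) *\<^sub>R e ! i)"
      by (intro sum.cong refl) (simp add: c mult.commute)
    finally show "v = \<dots>" .
  qed
  then have "0 \<le> coordinates e v ! i * t \<longleftrightarrow> 0 \<le> coordinates e' v ! i * t" if "i < CARD('n)" for v i t
    using that c[OF that] by (simp add: zero_le_mult_iff mult.assoc)
  then show ?thesis unfolding closed_half_def by auto
qed

lemma coordinates_alt_rev:
  fixes e :: "(real ^ 'n::{finite,linorder}) list"
  assumes e: "e \<in> ordered_bases UNIV" and i: "i < CARD('n)"
  shows "coordinates (alt_rev e) v ! i = (-1) ^ i * coordinates e v ! (CARD('n) - 1 - i)"
proof -
  let ?n = "CARD('n)"
  have len: "length e = ?n" "bracket e \<noteq> 0" using e ordered_bases_UNIV_iff by auto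
  have ob: "alt_rev e \<in> ordered_bases UNIV"
    using bracket_alt_rev[of "[]" e "[]"] len by (simp add: ordered_bases_UNIV_iff)
  show ?thesis
  proof (rule coordinates_unique[OF ob _ i])
    have "v = (\<Sum>i<?n. coordinates e v ! i *\<^sub>R e ! i)" by (rule coordinates_expansion[OF e])
    also have "\<dots> = (\<Sum>i<?n. coordinates e v ! (?n - Suc i) *\<^sub>R e ! (?n - Suc i))"
      by (rule sum.nat_diff_reindex[symmetric])
    also have "\<dots> = (\<Sum>i<?n. ((-1) ^ i * coordinates e v ! (?n - 1 - i)) *\<^sub>R alt_rev e ! i)"
    proof (intro sum.cong refl)
      fix i assume "i \<in> {..<?n}"
      then have "alt_rev e ! i = (-1) ^ i *\<^sub>R e ! (?n - 1 - i)" using len alt_rev_nth[of i e] by simp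
      then show "coordinates e v ! (?n - Suc i) *\<^sub>R e ! (?n - Suc i)
          = ((-1) ^ i * coordinates e v ! (?n - 1 - i)) *\<^sub>R alt_rev e ! i"
        by (simp flip: power_mult_distrib add: mult.assoc[symmetric] mult.commute[of _ "coordinates _ _ ! _"])
    qed
    finally show "v = \<dots>" .
  qed
qed

text \<open>Sign assignments for \<open>alt_rev e\<close> are the images under \<open>alt_rev\<close> of those for \<open>e\<close>, and exactly one of
  both is low.\<close>

lemma not_closed_half_alt_rev_iff:
  fixes e :: "(real ^ 'n::{finite,linorder}) list"
  assumes n: "CARD('n) = 4 * k + 3" and e: "e \<in> ordered_bases UNIV"
  shows "v \<notin> closed_half k (alt_rev e) \<longleftrightarrow>
    (\<forall>s \<in> sign_assignments (coordinates e v). low_variation k s)"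
proof -
  let ?n = "CARD('n)"
  have len: "length e = ?n" using e ordered_bases_UNIV_iff by auto
  have lc: "length (coordinates e v) = ?n" "length (coordinates (alt_rev e) v) = ?n"
    by (simp_all add: coordinates_def len)
  have oddn: "odd ?n" using n by simp
  have map: "alt_rev s \<in> sign_assignments (coordinates (alt_rev e) v)" if s: "s \<in> sign_assignments (coordinates e v)" for s
  proof -
    have s': "sign_list s" "length s = ?n" "\<And>i. i < ?n \<Longrightarrow> 0 \<le> coordinates e v ! i * s ! i"
      using s lc by (auto simp: sign_assignments_iff)
    have "0 \<le> coordinates (alt_rev e) v ! i * alt_rev s ! i" if i: "i < ?n" for i
    proof -
      have "((-1) ^ i * (-1) ^ i :: real) = 1" by (simp flip: power_mult_distrib)
      then have "coordinates (alt_rev e) v ! i * alt_rev s ! i = coordinates e v ! (?n - 1 - i) * s ! (?n - 1 - i)"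
        using coordinates_alt_rev[OF e i] alt_rev_nth[of i s] s'(2) i by (simp add: mult.left_commute mult.commute)
      then show ?thesis using s'(3)[of "?n - 1 - i"] i by simp
    qed
    then show ?thesis using s' lc by (simp add: sign_assignments_iff sign_list_alt_rev)
  qed
  have map': "\<exists>s \<in> sign_assignments (coordinates e v). t = alt_rev s"
    if t: "t \<in> sign_assignments (coordinates (alt_rev e) v)" for t
  proof -
    have t': "sign_list t" "length t = ?n" "\<And>i. i < ?n \<Longrightarrow> 0 \<le> coordinates (alt_rev e) v ! i * t ! i"
      using t lc by (auto simp: sign_assignments_iff)
    have "0 \<le> coordinates e v ! i * alt_rev t ! i" if i: "i < ?n" for i
    proof -
      let ?j = "?n - 1 - i"
      have j: "?j < ?n" "?n - 1 - ?j = i" using i by auto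
      have "even (i + ?j)" using oddn i by simp
      then have "(-1 :: real) ^ i = (-1) ^ ?j" by (metis even_add minus_one_power_iff)
      then have "coordinates e v ! i * alt_rev t ! i = coordinates (alt_rev e) v ! ?j * t ! ?j"
        using coordinates_alt_rev[OF e j(1)] alt_rev_nth[of i t] t'(2) i j(2) by simp
      then show ?thesis using t'(3)[OF j(1)] by simp
    qed
    then have "alt_rev t \<in> sign_assignments (coordinates e v)"
      using t' lc by (simp add: sign_assignments_iff sign_list_alt_rev)
    moreover have "t = alt_rev (alt_rev t)" using alt_rev_alt_rev[of t] t'(2) oddn by simp
    ultimately show ?thesis by blast
  qed
  have low: "low_variation k (alt_rev s) \<longleftrightarrow> \<not> low_variation k s" if "s \<in> sign_assignments (coordinates e v)" for s
    by (rule low_variation_alt_rev) (use that lc n in \<open>auto simp: sign_assignments_iff\<close>)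
  show ?thesis
    using closed_half_iff[of "alt_rev e" v k] len map map' low by (metis length_alt_rev)
qed

text \<open>Adapted bases of the same pair differ by positive factors, so they have the same closed half and
  define the same halfspace.\<close>

lemma halfspace_eq:
  fixes F G :: "'n::{finite,linorder} oriented_flag"
  assumes n: "CARD('n) = 4 * k + 3" and F: "F \<in> oriented_flags" "G \<in> oriented_flags"
    and e: "adapted_basis F G e"
  shows "halfspace k F G = sphere 0 1 - closed_half k (alt_rev e)"
proof -
  have cond: "v \<in> sphere 0 1 \<Longrightarrow> (max_sign_changes (coordinates e v) \<le> 2 * k + 1 \<and>
        (max_sign_changes (coordinates e v) = 2 * k + 1 \<longrightarrow>
           (\<exists>s \<in> sign_assignments (coordinates e v).
              sign_changes s = max_sign_changes (coordinates e v) \<and> last s = 1)))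
       \<longleftrightarrow> v \<notin> closed_half k (alt_rev e)" if e: "adapted_basis F G e" for v e
  proof -
    assume v: "v \<in> sphere 0 1"
    have ob: "e \<in> ordered_bases UNIV" using adapted_basisD(3)[OF e] .
    have "length (coordinates e v) = CARD('n)" using adapted_basisD(1)[OF e] by (simp add: coordinates_def)
    moreover have "\<exists>i<CARD('n). coordinates e v ! i \<noteq> 0"
    proof (rule ccontr)
      assume "\<not> ?thesis"
      then have "v = 0" using coordinates_expansion[OF ob, of v] by simp
      then show False using v by simp
    qed
    ultimately show ?thesis
      using halfspace_condition_iff[of "coordinates e v" k] not_closed_half_alt_rev_iff[OF n ob, of v] by simp
  qed
  have "closed_half k (alt_rev e') = closed_half k (alt_rev e)" if e': "adapted_basis F G e'" for e'
  proof -
    have oddn: "odd CARD('n)" using n by simp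
    have a: "adapted_basis G F (alt_rev e)" "adapted_basis G F (alt_rev e')"
      using adapted_basis_alt_rev e e' F oddn by blast+
    obtain c where "\<forall>i < CARD('n). c i > 0 \<and> alt_rev e' ! i = c i *\<^sub>R alt_rev e ! i"
      using adapted_basis_unique[OF a F(2)] by blast
    then show ?thesis
      by (intro closed_half_scale[OF adapted_basisD(3)[OF a(1)] adapted_basisD(3)[OF a(2)], where c = c]) auto
  qed
  then show ?thesis unfolding halfspace_def using cond e by blast
qed

text \<open>Vectors that successively leave the steps of a flag form bases of the steps.\<close>

lemma triangular_ordered_bases:
  fixes z :: "nat \<Rightarrow> real ^ 'n::{finite,linorder}"
  assumes V: "\<And>i. i \<le> n \<Longrightarrow> subspace (V i) \<and> dim (V i) = i"
    and mono: "\<And>i. i < n \<Longrightarrow> V i \<subseteq> V (Suc i)"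
    and z: "\<And>i. i < n \<Longrightarrow> z i \<in> V (Suc i) \<and> z i \<notin> V i"
    and "i \<le> n"
  shows "map z [0..<i] \<in> ordered_bases (V i)"
  using \<open>i \<le> n\<close>
proof (induction i)
  case 0
  show ?case by (rule ordered_basesI_dim) (use V[of 0] independent_empty in auto)
next
  case (Suc i)
  then have IH: "map z [0..<i] \<in> ordered_bases (V i)" and i: "i < n" by auto
  have sp: "span (set (map z [0..<i])) = V i" and ind: "independent (set (map z [0..<i]))"
    and dist: "distinct (map z [0..<i])" using IH unfolding ordered_bases_def by blast+
  have zi: "z i \<in> V (Suc i)" "z i \<notin> span (set (map z [0..<i]))" using z[OF i] sp by auto
  have out: "z i \<notin> set (map z [0..<i])" using zi(2) span_base by blast
  have e: "map z [0..<Suc i] = map z [0..<i] @ [z i]" by simp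
  have st: "set (map z [0..<Suc i]) = insert (z i) (set (map z [0..<i]))" by (simp add: atLeast0_lessThan_Suc)
  show ?case
  proof (rule ordered_basesI_dim)
    show "distinct (map z [0..<Suc i])" unfolding e using dist out by simp
    show "independent (set (map z [0..<Suc i]))"
      unfolding st using ind zi(2) by (simp only: independent_insert if_not_P not_False_eq_True out if_False)
    have "set (map z [0..<i]) \<subseteq> V (Suc i)" using sp span_superset mono[OF i] by blast
    then show "set (map z [0..<Suc i]) \<subseteq> V (Suc i)" unfolding st using zi by blast
  qed (use V[of "Suc i"] Suc.prems in auto)
qed

lemma bracket_scale_initial:
  fixes z :: "nat \<Rightarrow> real ^ 'n::{finite,linorder}"
  assumes "i + length r = CARD('n)"
  shows "bracket (map (\<lambda>j. s j *\<^sub>R z j) [0..<i] @ r) = (\<Prod>j<i. s j) * bracket (map z [0..<i] @ r)"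
  using assms
proof (induction i arbitrary: r)
  case (Suc i)
  have len: "length (map z [0..<i]) + Suc (length r) = CARD('n)" using Suc.prems by simp
  have "bracket (map (\<lambda>j. s j *\<^sub>R z j) [0..<Suc i] @ r) = bracket (map (\<lambda>j. s j *\<^sub>R z j) [0..<i] @ (s i *\<^sub>R z i) # r)"
    by simp
  also have "\<dots> = (\<Prod>j<i. s j) * bracket (map z [0..<i] @ (s i *\<^sub>R z i) # r)"
    using Suc.IH[of "(s i *\<^sub>R z i) # r"] Suc.prems by simp
  also have "\<dots> = (\<Prod>j<Suc i. s j) * bracket (map z [0..<Suc i] @ r)"
    using linear_cmul[OF linear_bracket[OF len], of "s i" "z i"] by (simp add: mult.assoc)
  finally show ?case .
qed simp

text \<open>Transversality makes the intersection of the \<open>i\<close>-th step of one flag with the complementary step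
  of the other flag a line. Vectors \<open>z\<close> on these lines form a basis that is compatible with both
  flags, and it remains to choose their signs.\<close>

lemma exists_adapted_basis:
  fixes F G :: "'n::{finite,linorder} oriented_flag"
  assumes F: "F \<in> oriented_flags" and G: "G \<in> oriented_flags" and odd: "odd CARD('n)"
    and trans: "\<And>i b c. 1 \<le> i \<Longrightarrow> i < CARD('n) \<Longrightarrow> b \<in> snd (F i) \<Longrightarrow> c \<in> snd (G (CARD('n) - i)) \<Longrightarrow>
      bracket (b @ c) > 0"
  shows "\<exists>e. adapted_basis F G e"
proof -
  let ?n = "CARD('n)"
  define ext :: "'n oriented_flag \<Rightarrow> nat \<Rightarrow> (real ^ 'n::{finite,linorder}) set" where
    "ext H i = (if i < ?n then fst (H i) else UNIV)" for H i
  have ext: "subspace (ext H i) \<and> dim (ext H i) = i" if "H \<in> oriented_flags" "i \<le> ?n" for H i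
    using oriented_flagD(1,2)[OF that(1)] that(2) by (auto simp: ext_def dim_UNIV)
  have ext_Suc: "ext H i \<subseteq> ext H (Suc i)" if "H \<in> oriented_flags" "i < ?n" for H i
    using that by (auto simp: ext_def oriented_flags_def)
  have ext_mono: "ext H i \<subseteq> ext H j" if "H \<in> oriented_flags" "i \<le> j" "j \<le> ?n" for H i j
    using that(2,3)
  proof (induction j rule: dec_induct)
    case (step j)
    then show ?case using ext_Suc[OF that(1), of j] by auto
  qed simp
  have ob: "b \<in> ordered_bases (ext H i)" "length b = i" if "H \<in> oriented_flags" "i < ?n" "b \<in> snd (H i)" for H i b
    using oriented_flagD(4,5)[OF that] that(2) by (auto simp: ext_def)
  define b where "b i = (SOME x. x \<in> snd (F i))" for i
  have b: "b i \<in> snd (F i)" if "i < ?n" for i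
    using oriented_flagD(3)[OF F that] by (simp add: b_def some_in_eq)
  define c where "c i = (SOME x. x \<in> snd (G i))" for i
  have c: "c i \<in> snd (G i)" if "i < ?n" for i
    using oriented_flagD(3)[OF G that] by (simp add: c_def some_in_eq)
  have zero0: "ext H 0 = {0}" if "H \<in> oriented_flags" for H
  proof -
    have "dim (ext H 0) = 0" "0 \<in> ext H 0" using ext[OF that, of 0] subspace_0 by auto
    then show ?thesis by (metis dim_eq_0 subset_singletonD empty_iff)
  qed
  \<comment> \<open>Concatenated bases of the two steps have nonzero bracket, so the steps are complementary.\<close>
  have triv: "ext F i \<inter> ext G (?n - i) = {0}" if le: "i \<le> ?n" for i
  proof -
    have z: "0 \<in> ext F i" "0 \<in> ext G (?n - i)" using ext[OF F le] ext[OF G, of "?n - i"] subspace_0 by auto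
    consider "i = 0" | "i = ?n" | "1 \<le> i" "i < ?n" using le by linarith
    then show ?thesis
    proof cases
      case 3
      have "bracket (b i @ c (?n - i)) > 0" using trans[OF 3 b c] 3 by simp
      moreover have "length (b i @ c (?n - i)) = ?n"
        using ob(2)[OF F 3(2) b[OF 3(2)]] ob(2)[OF G _ c, of "?n - i"] 3 by simp
      ultimately have "span (set (b i)) \<inter> span (set (c (?n - i))) = {0}"
        by (intro bracket_append_parts(5)) auto
      moreover have "span (set (b i)) = ext F i" "span (set (c (?n - i))) = ext G (?n - i)"
        using ob(1)[OF F 3(2) b[OF 3(2)]] ob(1)[OF G _ c, of "?n - i"] 3 by (simp_all add: ordered_bases_def)
      ultimately show ?thesis by simp
    qed (use zero0[OF F] zero0[OF G] z in auto)
  qed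
  have "\<exists>z. z \<in> ext F (Suc i) \<and> z \<in> ext G (?n - i) \<and> z \<noteq> 0" if i: "i < ?n" for i
  proof (rule ccontr)
    let ?S = "ext F (Suc i)" and ?T = "ext G (?n - i)"
    assume "\<not> ?thesis"
    then have "?S \<inter> ?T \<subseteq> {0}" by auto
    then have "dim (?S \<inter> ?T) = 0" by (simp add: dim_eq_0)
    moreover have "dim {x + y |x y. x \<in> ?S \<and> y \<in> ?T} + dim (?S \<inter> ?T) = dim ?S + dim ?T"
      by (rule dim_sums_Int) (use ext F G i in auto)
    moreover have "dim {x + y |x y. x \<in> ?S \<and> y \<in> ?T} \<le> ?n" using dim_subset_UNIV[of "{x + y |x y. x \<in> ?S \<and> y \<in> ?T}"] by simp
    moreover have "dim ?S = Suc i" "dim ?T = ?n - i"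
      using ext[OF F, of "Suc i"] ext[OF G, of "?n - i"] i by auto
    ultimately show False using i by linarith
  qed
  then obtain z where z: "\<And>i. i < ?n \<Longrightarrow> z i \<in> ext F (Suc i) \<and> z i \<in> ext G (?n - i) \<and> z i \<noteq> 0" by metis
  have zn: "z i \<notin> ext F i" if "i < ?n" for i using z[OF that] triv[of i] that by auto
  have zob: "map z [0..<i] \<in> ordered_bases (ext F i)" if "i \<le> ?n" for i
    by (rule triangular_ordered_bases[of ?n "ext F"]) (use ext F ext_Suc z zn that in auto)
  have nz: "bracket (map z [0..<i] @ c (?n - i)) \<noteq> 0" if i: "1 \<le> i" "i \<le> ?n" for i
  proof (cases "i = ?n")
    case True
    have "c 0 = []" using c[of 0] flag_0[OF G] by simp
    moreover have "map z [0..<?n] \<in> ordered_bases UNIV" using zob[of ?n] by (simp add: ext_def)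
    ultimately show ?thesis using True by (simp add: ordered_bases_UNIV_iff)
  next
    case False
    then have i': "i < ?n" using i by simp
    have bi: "b i \<in> ordered_bases (ext F i)" "length (b i) = i" using ob[OF F i' b[OF i']] by auto
    have lc: "length (c (?n - i)) = ?n - i" using ob(2)[OF G _ c, of "?n - i"] i by simp
    obtain M where M: "M \<in> carrier_mat (length (map z [0..<i])) (length (map z [0..<i]))"
      "\<And>j. j < length (map z [0..<i]) \<Longrightarrow> b i ! j = (\<Sum>l < length (map z [0..<i]). (M $$ (l, j)) *\<^sub>R (map z [0..<i] ! l))"
      using ordered_bases_combination[OF zob[OF i(2)] bi(1)] by blast
    have "bracket (b i @ c (?n - i)) = Determinant.det M * bracket (map z [0..<i] @ c (?n - i))"
      by (rule bracket_combination_append[OF _ _ M]) (use bi lc i in auto)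
    moreover have "bracket (b i @ c (?n - i)) > 0" using trans[OF i(1) i' b[OF i'] c] i by simp
    ultimately show ?thesis by auto
  qed
  \<comment> \<open>\<open>\<eta> i\<close> is the orientation of the first \<open>i\<close> vectors \<open>z\<close> relative to the flag; the product of the
    first \<open>i\<close> chosen signs telescopes to \<open>\<eta> i\<close>.\<close>
  define \<eta> where "\<eta> i = (if i = 0 then 1 else sgn (bracket (map z [0..<i] @ c (?n - i))))" for i
  have sq: "\<eta> i * \<eta> i = 1" if "i \<le> ?n" for i
    using nz[of i] that by (auto simp: \<eta>_def sgn_if)
  define s where "s i = \<eta> i * \<eta> (Suc i)" for i
  have prods: "(\<Prod>j<i. s j) = \<eta> i" if "i \<le> ?n" for i
    using that
  proof (induction i)
    case (Suc i)
    then have "(\<Prod>j<Suc i. s j) = \<eta> i * \<eta> i * \<eta> (Suc i)" by (simp add: s_def)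
    then show ?case using sq[of i] Suc.prems by simp
  qed (simp add: \<eta>_def)
  define e where "e = map (\<lambda>j. s j *\<^sub>R z j) [0..<?n]"
  have len: "length e = ?n" by (simp add: e_def)
  have take_e: "take i e = map (\<lambda>j. s j *\<^sub>R z j) [0..<i]" if "i \<le> ?n" for i
    using that by (simp add: e_def take_map)
  have pos: "bracket (take i e @ c (?n - i)) > 0" if i: "1 \<le> i" "i \<le> ?n" for i
  proof -
    have "length (c (?n - i)) = ?n - i" using ob(2)[OF G _ c, of "?n - i"] i by simp
    then have "bracket (take i e @ c (?n - i)) = \<eta> i * bracket (map z [0..<i] @ c (?n - i))"
      unfolding take_e[OF i(2)] prods[OF i(2), symmetric] by (intro bracket_scale_initial) (use i in auto)
    then show ?thesis using nz[OF i] i by (simp add: \<eta>_def sgn_if)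
  qed
  have pos_e: "bracket e > 0"
  proof -
    have "c 0 = []" using c[of 0] flag_0[OF G] by simp
    then show ?thesis using pos[of ?n] len by simp
  qed
  have eob: "e \<in> ordered_bases UNIV" using pos_e len by (simp add: ordered_bases_UNIV_iff)
  have F_eq: "F i = oriented_span (take i e)" if i: "1 \<le> i" "i < ?n" for i
  proof (rule oriented_span_eqI[OF F i(2) b[OF i(2)], where r = "c (?n - i)"])
    have lc: "length (c (?n - i)) = ?n - i" using ob(2)[OF G _ c, of "?n - i"] i by simp
    show "length (b i) + length (c (?n - i)) = ?n" using lc ob(2)[OF F i(2) b[OF i(2)]] i by simp
    show "bracket (b i @ c (?n - i)) > 0" using trans[OF i b[OF i(2)] c] i by simp
    show "bracket (take i e @ c (?n - i)) > 0" using pos i by simp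
    have "set (map z [0..<i]) \<subseteq> ext F i"
      using zob[of i] i span_superset[of "set (map z [0..<i])"] by (simp add: ordered_bases_def)
    then have "set (map z [0..<i]) \<subseteq> fst (F i)" using i by (simp add: ext_def)
    then show "set (take i e) \<subseteq> fst (F i)"
      unfolding take_e[OF less_imp_le[OF i(2)]] using oriented_flagD(1)[OF F i(2)] by (auto intro!: subspace_scale)
  qed (use i len in auto)
  have G_eq: "G i = oriented_span (drop (?n - i) e)" if i: "1 \<le> i" "i < ?n" for i
  proof (rule oriented_span_eqI[OF G i(2) c[OF i(2)], where r = "take (?n - i) e"])
    have lc: "length (c i) = i" using ob(2)[OF G i(2) c[OF i(2)]] .
    then show l: "length (c i) + length (take (?n - i) e) = ?n" using len i by simp
    have "bracket (c i @ take (?n - i) e) = bracket (take (?n - i) e @ c i)" by (rule bracket_rotate[OF l odd])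
    then show "bracket (c i @ take (?n - i) e) > 0" using pos[of "?n - i"] i by simp
    have "bracket (drop (?n - i) e @ take (?n - i) e) = bracket (take (?n - i) e @ drop (?n - i) e)"
      by (rule bracket_rotate[OF _ odd]) (use len in simp)
    then show "bracket (drop (?n - i) e @ take (?n - i) e) > 0" using pos_e by simp
    show "set (drop (?n - i) e) \<subseteq> fst (G i)"
    proof
      fix x assume "x \<in> set (drop (?n - i) e)"
      then obtain j where j: "?n - i \<le> j" "j < ?n" "x = s j *\<^sub>R z j"
        by (auto simp: e_def drop_map)
      have "?n - j \<le> i" "i \<le> ?n" using j(1,2) i by linarith+
      then have "z j \<in> ext G i" using z[OF j(2)] ext_mono[OF G, of "?n - j" i] by blast
      then show "x \<in> fst (G i)" using j(3) i oriented_flagD(1)[OF G i(2)] by (simp add: ext_def subspace_scale)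
    qed
  qed (use i len in auto)
  show ?thesis
    unfolding adapted_basis_def using eob oriented_span_eq_standard_space_iff[OF eob] pos_e F_eq G_eq
    by (intro exI[of _ e]) auto
qed

text \<open>An injective linear map transports bases with their coordinate changes.\<close>

lemma oriented_span_image:
  fixes b :: "(real ^ 'n::{finite,linorder}) list"
  assumes lin: "linear f" and inj: "inj f" and b: "b \<in> ordered_bases (span (set b))"
  shows "oriented_span (map f b) = (f ` fst (oriented_span b), map f ` snd (oriented_span b))"
proof -
  let ?V = "span (set b)"
  have sp: "span (set (map f c)) = f ` span (set c)" for c using span_linear_image[OF lin] linear_span_image[OF lin] by simp
  have ob_iff: "map f c \<in> ordered_bases (f ` ?V) \<longleftrightarrow> c \<in> ordered_bases ?V" for c
  proof -
    have "distinct (map f c) \<longleftrightarrow> distinct c" using inj by (simp add: distinct_map inj_on_def)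
    moreover have "independent (set (map f c)) \<longleftrightarrow> independent (set c)"
    proof
      show "independent (set (map f c))" if "independent (set c)"
        using linear_independent_injective_image[OF lin that inj_on_subset[OF inj]] by simp
      show "independent (set c)" if ind: "independent (set (map f c))"
      proof
        assume "dependent (set c)"
        then obtain x where x: "x \<in> set c" "x \<in> span (set c - {x})" by (auto simp: dependent_def)
        have "f ` (set c - {x}) = set (map f c) - {f x}" using inj by (auto simp: inj_eq)
        then have "f x \<in> span (set (map f c) - {f x})"
          using x(2) linear_span_image[OF lin, of "set c - {x}"] by (metis imageI)
        then show False using ind x(1) by (auto simp: dependent_def)
      qed
    qed
    moreover have "span (set (map f c)) = f ` ?V \<longleftrightarrow> span (set c) = ?V"
      unfolding sp using inj by (simp add: inj_image_eq_iff)
    ultimately show ?thesis by (simp add: ordered_bases_def)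
  qed
  have rel: "map f c ! j = (\<Sum>i<length b. (M $$ (i, j)) *\<^sub>R map f b ! i)
      \<longleftrightarrow> c ! j = (\<Sum>i<length b. (M $$ (i, j)) *\<^sub>R b ! i)" if "j < length b" "length c = length b" for c j M
  proof -
    have e1: "f (\<Sum>i<length b. (M $$ (i, j)) *\<^sub>R b ! i) = (\<Sum>i<length b. (M $$ (i, j)) *\<^sub>R map f b ! i)"
      by (simp add: linear_sum[OF lin] linear_cmul[OF lin])
    have e2: "map f c ! j = f (c ! j)" using that by simp
    show ?thesis unfolding e1[symmetric] e2 by (rule inj_eq[OF inj])
  qed
  have len: "length c = length b" if "c \<in> ordered_bases ?V" for c
    using ordered_bases_length[OF that] ordered_bases_length[OF b] by simp
  have iff: "(map f b, map f c) \<in> same_orientation (f ` ?V) \<longleftrightarrow> (b, c) \<in> same_orientation ?V" for c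
  proof (cases "c \<in> ordered_bases ?V")
    case True
    then show ?thesis using b rel[OF _ len[OF True]] by (auto simp: same_orientation_def ob_iff)
  qed (auto simp: same_orientation_def ob_iff)
  have "same_orientation (f ` ?V) `` {map f b} = map f ` (same_orientation ?V `` {b})"
  proof (intro equalityI subsetI)
    fix d assume d: "d \<in> same_orientation (f ` ?V) `` {map f b}"
    then have dob: "d \<in> ordered_bases (f ` ?V)" by (simp add: same_orientation_def)
    then have "set d \<subseteq> f ` ?V" using span_superset by (auto simp: ordered_bases_def)
    then have "\<exists>c. d = map f c" by (metis (no_types, lifting) ex_map_conv imageE subsetD)
    then show "d \<in> map f ` (same_orientation ?V `` {b})" using d iff by auto
  next
    fix d assume "d \<in> map f ` (same_orientation ?V `` {b})"
    then show "d \<in> same_orientation (f ` ?V) `` {map f b}" using iff by auto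
  qed
  then show ?thesis by (simp only: oriented_span_def sp fst_conv snd_conv)
qed

lemma adapted_basis_flag_act:
  fixes e :: "(real ^ 'n::{finite,linorder}) list" and A :: "real ^ 'n::{finite,linorder} ^ 'n::{finite,linorder}"
  assumes e: "adapted_basis F G e" and A: "Determinants.det A = 1"
  shows "adapted_basis (flag_act A F) (flag_act A G) (map (\<lambda>x. A *v x) e)"
proof -
  let ?n = "CARD('n)" and ?f = "\<lambda>x. A *v x"
  note E = adapted_basisD[OF e]
  have inj: "inj ?f" using A by (intro inj_matrix_vector_mult) (simp add: Determinants.invertible_det_nz)
  have lin: "linear ?f" by simp
  have pos: "bracket (map ?f e) > 0" using bracket_matrix[OF E(1), of A] A E(2) by simp
  have ob: "map ?f e \<in> ordered_bases UNIV" using pos E(1) by (simp add: ordered_bases_UNIV_iff)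
  have part: "b \<in> ordered_bases (span (set b))" if "distinct b" "set b \<subseteq> set e" for b
    using E(3) that independent_mono by (auto simp: ordered_bases_def)
  have de: "distinct e" using E(3) by (simp add: ordered_bases_def)
  have "flag_act A F i = oriented_span (take i (map ?f e))"
    "flag_act A G i = oriented_span (drop (?n - i) (map ?f e))" if i: "1 \<le> i" "i < ?n" for i
    using oriented_span_image[OF lin inj part, of "take i e"] oriented_span_image[OF lin inj part, of "drop (?n - i) e"]
      E(4,5)[OF i] i de set_take_subset[of i e] set_drop_subset[of "?n - i" e]
    by (simp_all add: flag_act_def take_map drop_map)
  then show ?thesis
    unfolding adapted_basis_def using ob oriented_span_eq_standard_space_iff[OF ob] pos by auto
qed

lemma flag_act_inverse:
  fixes A B :: "real ^ 'n::{finite,linorder} ^ 'n::{finite,linorder}"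
  assumes "B ** A = Finite_Cartesian_Product.mat 1" "F \<in> oriented_flags"
  shows "flag_act B (flag_act A F) = F"
proof -
  have "B *v (A *v x) = x" for x using assms(1) by (simp add: matrix_vector_mul_assoc)
  then show ?thesis
    using assms(2) by (auto simp: flag_act_def oriented_flags_def image_image o_def fun_eq_iff extensional_def prod_eq_iff)
qed

section \<open>Halfspaces of different intervals\<close>

lemma coordinates_matrix:
  fixes e :: "(real ^ 'n::{finite,linorder}) list" and A :: "real ^ 'n::{finite,linorder} ^ 'n::{finite,linorder}"
  assumes e: "e \<in> ordered_bases UNIV" "map (\<lambda>x. A *v x) e \<in> ordered_bases UNIV" and i: "i < CARD('n)"
  shows "coordinates (map (\<lambda>x. A *v x) e) (A *v v) ! i = coordinates e v ! i"
proof (rule coordinates_unique[OF e(2) _ i])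
  have len: "length e = CARD('n)" using e(1) ordered_bases_UNIV_iff by blast
  have lin: "linear (\<lambda>x. A *v x)" by simp
  have "A *v v = A *v (\<Sum>i<CARD('n). coordinates e v ! i *\<^sub>R e ! i)" using coordinates_expansion[OF e(1)] by metis
  also have "\<dots> = (\<Sum>i<CARD('n). coordinates e v ! i *\<^sub>R map (\<lambda>x. A *v x) e ! i)"
    using len by (simp add: linear_sum[OF lin] linear_cmul[OF lin])
  finally show "A *v v = \<dots>" .
qed

lemma closed_half_matrix:
  fixes e :: "(real ^ 'n::{finite,linorder}) list" and A :: "real ^ 'n::{finite,linorder} ^ 'n::{finite,linorder}"
  assumes "e \<in> ordered_bases UNIV" "map (\<lambda>x. A *v x) e \<in> ordered_bases UNIV"
  shows "A *v v \<in> closed_half k (map (\<lambda>x. A *v x) e) \<longleftrightarrow> v \<in> closed_half k e"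
  by (simp add: closed_half_def coordinates_matrix[OF assms])

lemma sorted_list_of_set_append:
  fixes A B :: "nat set"
  assumes "finite A" "finite B" "\<And>a b. a \<in> A \<Longrightarrow> b \<in> B \<Longrightarrow> a < b"
  shows "sorted_list_of_set (A \<union> B) = sorted_list_of_set A @ sorted_list_of_set B"
  by (rule sorted_distinct_set_unique) (use assms in \<open>fastforce simp: sorted_append\<close>)+

lemma sorted_list_of_set_shift:
  fixes A :: "nat set"
  assumes "finite A"
  shows "sorted_list_of_set ((\<lambda>k. k + d) ` A) = map (\<lambda>k. k + d) (sorted_list_of_set A)"
  by (rule sorted_distinct_set_unique) (use assms in \<open>auto simp: sorted_map distinct_map\<close>)

lemma bracket_on_initial_positive:
  fixes e f :: "(real ^ 'n::{finite,linorder}) list"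
  assumes F: "F1 \<in> oriented_flags" "F2 \<in> oriented_flags" "G2 \<in> oriented_flags"
    and e: "adapted_basis F1 G1 e" and f: "adapted_basis F2 G2 f"
    and hc: "hyperconvex F1 F2 G2"
    and K: "K \<subseteq> {..<2 * CARD('n)}" "card K = CARD('n)" "K \<inter> {..<CARD('n)} = {..<j}"
  shows "bracket_on (nth (e @ f)) K > 0"
proof (rule bracket_on_positive_initial[OF _ K])
  let ?n = "CARD('n)"
  note E = adapted_basisD[OF e] and Fd = adapted_basisD[OF f]
  fix j m y assume sum: "j + m + y = ?n"
  have l: "sorted_list_of_set ({..<j} \<union> {?n..<?n + m} \<union> {2 * ?n - y..<2 * ?n})
      = [0..<j] @ [?n..<?n + m] @ [2 * ?n - y..<2 * ?n]"
    by (rule sorted_distinct_set_unique) (use sum in \<open>auto simp: sorted_append\<close>)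
  have "map (nth (e @ f)) [0..<j] = take j e"
    by (rule nth_equalityI) (use sum E(1) in \<open>auto simp: nth_append\<close>)
  moreover have "map (nth (e @ f)) [?n..<?n + m] = take m f"
    by (rule nth_equalityI) (use sum E(1) Fd(1) in \<open>auto simp: nth_append\<close>)
  moreover have "map (nth (e @ f)) [2 * ?n - y..<2 * ?n] = drop (?n - y) f"
    by (rule nth_equalityI) (use sum E(1) Fd(1) in \<open>auto simp: nth_append\<close>)
  ultimately have eq: "bracket_on (nth (e @ f)) ({..<j} \<union> {?n..<?n + m} \<union> {2 * ?n - y..<2 * ?n})
      = bracket (take j e @ take m f @ drop (?n - y) f)"
    by (simp add: bracket_on_def l)
  consider "j = ?n" | "m = ?n" | "y = ?n" | "j < ?n" "m < ?n" "y < ?n" using sum by linarith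
  then show "bracket_on (nth (e @ f)) ({..<j} \<union> {?n..<?n + m} \<union> {2 * ?n - y..<2 * ?n}) > 0"
    unfolding eq
  proof cases
    case 4
    have "take j e \<in> snd (F1 j)" using E(6)[of j] 4 flag_0[OF F(1)] by (cases "j = 0") auto
    moreover have "take m f \<in> snd (F2 m)" using Fd(6)[of m] 4 flag_0[OF F(2)] by (cases "m = 0") auto
    moreover have "drop (?n - y) f \<in> snd (G2 y)" using Fd(7)[of y] Fd(1) 4 flag_0[OF F(3)] by (cases "y = 0") auto
    ultimately show "bracket (take j e @ take m f @ drop (?n - y) f) > 0"
      using hyperconvex_bracket[OF hc F 4 sum] by blast
  qed (use sum E Fd in auto)
qed

text \<open>Exchanging the two blocks is a rotation of the chosen vectors.\<close>

lemma bracket_on_swap_blocks: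
  fixes e f :: "(real ^ 'n::{finite,linorder}) list"
  assumes odd: "odd CARD('n)" and len: "length e = CARD('n)" "length f = CARD('n)"
    and K: "K \<subseteq> {..<2 * CARD('n)}" "card K = CARD('n)"
  shows "bracket_on (nth (e @ f)) K = bracket_on (nth (f @ e))
    ({k. k < CARD('n) \<and> k + CARD('n) \<in> K} \<union> (\<lambda>k. k + CARD('n)) ` (K \<inter> {..<CARD('n)}))"
proof -
  let ?n = "CARD('n)"
  let ?K1 = "K \<inter> {..<?n}" and ?L = "{k. k < ?n \<and> k + ?n \<in> K}"
  have fin: "finite ?K1" "finite ?L" by auto
  have Kd: "K = ?K1 \<union> (\<lambda>k. k + ?n) ` ?L"
  proof (intro equalityI subsetI)
    fix k assume k: "k \<in> K"
    show "k \<in> ?K1 \<union> (\<lambda>k. k + ?n) ` ?L"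
    proof (cases "k < ?n")
      case False
      then have "k = (k - ?n) + ?n" "k - ?n \<in> ?L" using k K(1) by auto
      then show ?thesis by blast
    qed (use k in auto)
  qed auto
  have s1: "sorted_list_of_set K = sorted_list_of_set ?K1 @ map (\<lambda>k. k + ?n) (sorted_list_of_set ?L)"
    by (subst Kd, subst sorted_list_of_set_append) (use fin in \<open>auto simp: sorted_list_of_set_shift\<close>)
  have s2: "sorted_list_of_set (?L \<union> (\<lambda>k. k + ?n) ` ?K1) = sorted_list_of_set ?L @ map (\<lambda>k. k + ?n) (sorted_list_of_set ?K1)"
    by (subst sorted_list_of_set_append) (use fin in \<open>auto simp: sorted_list_of_set_shift\<close>)
  have m1: "map (nth (e @ f)) (sorted_list_of_set ?K1) = map (nth e) (sorted_list_of_set ?K1)"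
    "map (nth (f @ e)) (sorted_list_of_set ?L) = map (nth f) (sorted_list_of_set ?L)"
    using len fin by (auto simp: nth_append)
  have m2: "map (\<lambda>k. (e @ f) ! (k + ?n)) (sorted_list_of_set ?L) = map (nth f) (sorted_list_of_set ?L)"
    "map (\<lambda>k. (f @ e) ! (k + ?n)) (sorted_list_of_set ?K1) = map (nth e) (sorted_list_of_set ?K1)"
    using len by (auto simp: nth_append)
  have "length (sorted_list_of_set K) = ?n" using K(2) by simp
  then have l: "length (map (nth e) (sorted_list_of_set ?K1)) + length (map (nth f) (sorted_list_of_set ?L)) = ?n"
    unfolding s1 by simp
  have "bracket_on (nth (e @ f)) K = bracket (map (nth e) (sorted_list_of_set ?K1) @ map (nth f) (sorted_list_of_set ?L))"
    by (simp only: bracket_on_def s1 map_append map_map o_def m1 m2)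
  also have "\<dots> = bracket (map (nth f) (sorted_list_of_set ?L) @ map (nth e) (sorted_list_of_set ?K1))"
    by (rule bracket_rotate[OF l odd])
  also have "\<dots> = bracket_on (nth (f @ e)) (?L \<union> (\<lambda>k. k + ?n) ` ?K1)"
    by (simp only: bracket_on_def s2 map_append map_map o_def m1 m2)
  finally show ?thesis .
qed

text \<open>The two hyperconvexity hypotheses give the seeds for the sets that are initial in the first and in
  the second block, respectively. From these all brackets follow.\<close>

lemma opposite_pairs_bracket_positive:
  fixes e f :: "(real ^ 'n::{finite,linorder}) list"
  assumes odd: "odd CARD('n)"
    and F: "F1 \<in> oriented_flags" "G1 \<in> oriented_flags" "F2 \<in> oriented_flags" "G2 \<in> oriented_flags"
    and e: "adapted_basis F1 G1 e" and f: "adapted_basis F2 G2 f"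
    and hc: "hyperconvex F1 F2 G2" "hyperconvex F2 F1 G1"
    and K: "K \<subseteq> {..<2 * CARD('n)}" "card K = CARD('n)"
  shows "bracket_on (nth (e @ f)) K > 0"
proof (rule bracket_on_positive[OF _ _ K])
  let ?n = "CARD('n)"
  fix K j assume K: "K \<subseteq> {..<2 * ?n}" "card K = ?n"
  show "bracket_on (nth (e @ f)) K > 0" if "K \<inter> {0..<?n} = {0..<0 + j}"
    using bracket_on_initial_positive[OF F(1,3,4) e f hc(1) K, of j] that by (simp add: lessThan_atLeast0)
  show "bracket_on (nth (e @ f)) K > 0" if Kj: "K \<inter> {?n..<2 * ?n} = {?n..<?n + j}"
  proof -
    let ?L = "{k. k < ?n \<and> k + ?n \<in> K}"
    let ?K' = "?L \<union> (\<lambda>k. k + ?n) ` (K \<inter> {..<?n})"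
    have len: "length e = ?n" "length f = ?n" using adapted_basisD(1) e f by auto
    have L: "?L = {..<j}"
    proof -
      have "j \<le> ?n"
      proof (rule ccontr)
        assume "\<not> ?thesis"
        then have "2 * ?n \<in> {?n..<?n + j}" by simp
        then show False unfolding Kj[symmetric] by simp
      qed
      moreover have "k + ?n \<in> K \<longleftrightarrow> k < j" if "k < ?n" for k
      proof -
        have "k + ?n \<in> K \<longleftrightarrow> k + ?n \<in> K \<inter> {?n..<2 * ?n}" using that by simp
        then show ?thesis unfolding Kj by simp
      qed
      ultimately show ?thesis by auto
    qed
    have "bracket_on (nth (f @ e)) ?K' > 0"
    proof (rule bracket_on_initial_positive[OF F(3,1,2) f e hc(2)])
      show "?K' \<subseteq> {..<2 * ?n}" by auto
      show "?K' \<inter> {..<?n} = {..<j}" unfolding L[symmetric] by auto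
      have "K = (K \<inter> {..<?n}) \<union> (\<lambda>k. k + ?n) ` ?L"
      proof (intro equalityI subsetI)
        fix k assume k: "k \<in> K"
        show "k \<in> (K \<inter> {..<?n}) \<union> (\<lambda>k. k + ?n) ` ?L"
        proof (cases "k < ?n")
          case False
          then have "k = (k - ?n) + ?n" "k - ?n \<in> ?L" using k K(1) by auto
          then show ?thesis by blast
        qed (use k in auto)
      qed auto
      moreover have "card ((K \<inter> {..<?n}) \<union> (\<lambda>k. k + ?n) ` ?L) = card (K \<inter> {..<?n}) + card ?L"
        by (subst card_Un_disjoint) (auto simp: card_image)
      moreover have "card ?K' = card ?L + card (K \<inter> {..<?n})"
        by (subst card_Un_disjoint) (auto simp: card_image)
      ultimately show "card ?K' = ?n" using K(2) by simp
    qed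
    then show ?thesis using bracket_on_swap_blocks[OF odd len K] by simp
  qed
qed

lemma closed_halves_disjoint:
  fixes e f :: "(real ^ 'n::{finite,linorder}) list"
  assumes n: "CARD('n) = 4 * k + 3"
    and F: "F1 \<in> oriented_flags" "G1 \<in> oriented_flags" "F2 \<in> oriented_flags" "G2 \<in> oriented_flags"
    and e: "adapted_basis F1 G1 e" and f: "adapted_basis F2 G2 f"
    and hc: "hyperconvex F1 F2 G2" "hyperconvex F2 F1 G1"
  shows "closed_half k e \<inter> closed_half k f \<subseteq> {0}"
proof
  fix v assume v: "v \<in> closed_half k e \<inter> closed_half k f"
  obtain s where s: "sign_list s" "length s = CARD('n)" "low_variation k s" "\<And>i. i < CARD('n) \<Longrightarrow> 0 \<le> coordinates e v ! i * s ! i"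
    using v by (auto simp: closed_half_def)
  obtain t where t: "sign_list t" "length t = CARD('n)" "low_variation k t" "\<And>i. i < CARD('n) \<Longrightarrow> 0 \<le> coordinates f v ! i * t ! i"
    using v by (auto simp: closed_half_def)
  have odd: "odd CARD('n)" using n by simp
  have "v = 0"
    by (rule opposite_low_variation[OF n adapted_basisD(1)[OF e] adapted_basisD(1)[OF f]
          opposite_pairs_bracket_positive[OF odd F e f hc] coordinates_expansion[OF adapted_basisD(3)[OF e]]
          coordinates_expansion[OF adapted_basisD(3)[OF f]] s(1,2,4,3) t(1,2,4,3)])
  then show "v \<in> {0}" by simp
qed

section \<open>A nilpotent flow across the boundary of a halfspace\<close>

text \<open>The neighbour of an index other than \<open>p\<close> in the direction of \<open>p\<close>.\<close>

definition toward :: "nat \<Rightarrow> nat \<Rightarrow> nat" where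
  "toward p i = (if i < p then Suc i else i - 1)"

text \<open>The distance to \<open>p\<close>, which decreases along \<open>toward p\<close>.\<close>

definition steps :: "nat \<Rightarrow> nat \<Rightarrow> nat" where
  "steps p i = (if i < p then p - i else i - p)"

lemma toward_less: "i < n \<Longrightarrow> p < n \<Longrightarrow> toward p i < n"
  by (auto simp: toward_def)

lemma steps_toward: "i \<noteq> p \<Longrightarrow> steps p i = Suc (steps p (toward p i))"
  by (auto simp: toward_def steps_def)

text \<open>The vector field of the flow: every coordinate is driven by its neighbour in the direction of
  \<open>p\<close>, and the coordinate \<open>p\<close> is constant.\<close>

definition drift :: "(real ^ 'n::{finite,linorder}) list \<Rightarrow> nat \<Rightarrow> real ^ 'n::{finite,linorder} \<Rightarrow> real ^ 'n::{finite,linorder}" where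
  "drift e p v = (\<Sum>i<CARD('n). (if i = p then 0 else coordinates e v ! toward p i) *\<^sub>R e ! i)"

text \<open>The exponential of \<open>drift\<close>; the series is finite since \<open>drift\<close> is nilpotent.\<close>

definition flow :: "(real ^ 'n::{finite,linorder}) list \<Rightarrow> nat \<Rightarrow> real \<Rightarrow> real ^ 'n::{finite,linorder} \<Rightarrow> real ^ 'n::{finite,linorder}" where
  "flow e p t v = (\<Sum>d<CARD('n). (t ^ d / fact d) *\<^sub>R (drift e p ^^ d) v)"

lemma vector_eqI_coordinates:
  fixes e :: "(real ^ 'n::{finite,linorder}) list"
  assumes "e \<in> ordered_bases UNIV" "\<And>i. i < CARD('n) \<Longrightarrow> coordinates e v ! i = coordinates e w ! i"
  shows "v = w"
  using coordinates_expansion[OF assms(1), of v] coordinates_expansion[OF assms(1), of w] assms(2) by simp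

lemma continuous_coordinates:
  fixes e :: "(real ^ 'n::{finite,linorder}) list"
  assumes "e \<in> ordered_bases UNIV" "i < CARD('n)"
  shows "continuous_on S (\<lambda>v. coordinates e v ! i)"
  using linear_continuous_on[of "\<lambda>v. coordinates e v ! i"] linear_coordinates[OF assms]
  by (simp add: linear_conv_bounded_linear)

text \<open>Let \<open>r\<close> extend signs from \<open>p\<close> outwards, changing only where it is forced by \<open>s\<close>. On the way
  from \<open>p\<close> to either end, \<open>r\<close> has changed at most as often as \<open>s\<close>, and strictly less often while the
  two currently differ. In particular \<open>r\<close> ends like \<open>s\<close> if it has as many changes.\<close>

lemma low_variation_toward:
  assumes len: "length s = n" "length r = n" and p: "p < n" and eq: "s ! p = r ! p"
    and step: "\<And>i. i < n \<Longrightarrow> i \<noteq> p \<Longrightarrow> s ! i = r ! i \<or> r ! i = r ! toward p i"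
    and low: "low_variation k s"
  shows "low_variation k r"
proof -
  let ?R = "\<lambda>s a b. card {i\<in>change_set s. a \<le> i \<and> i < b}"
  have ins: "?R s a (Suc b) = ?R s a b + (if b \<in> change_set s then 1 else 0)" if "a \<le> b" for a b s
  proof -
    have "{i\<in>change_set s. a \<le> i \<and> i < Suc b} = {i\<in>change_set s. a \<le> i \<and> i < b} \<union> (if b \<in> change_set s then {b} else {})"
      using that by (auto simp: less_Suc_eq)
    then show ?thesis by simp
  qed
  have ins': "?R s a b = ?R s (Suc a) b + (if a \<in> change_set s then 1 else 0)" if "a < b" for a b s
  proof -
    have "{i\<in>change_set s. a \<le> i \<and> i < b} = {i\<in>change_set s. Suc a \<le> i \<and> i < b} \<union> (if a \<in> change_set s then {a} else {})"
      using that by (auto simp: Suc_le_eq le_less)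
    then show ?thesis by simp
  qed
  have key: "(if y = y' then 0 else 1) + (if x' = y' then 0 else 1) \<le> (if x = x' then 0 else 1) + (if x = y then 0 else (1 :: nat))"
    if "x' = y' \<or> y' = y" for x' y' y x :: real using that by auto
  have emp: "?R s a a = 0" for s a
  proof -
    have "{i\<in>change_set s. a \<le> i \<and> i < a} = {}" by auto
    then show ?thesis by (simp only: card.empty)
  qed
  have right: "p + d < n \<Longrightarrow> ?R r p (p + d) + (if s ! (p + d) = r ! (p + d) then 0 else 1) \<le> ?R s p (p + d)" for d
  proof (induction d)
    case (Suc d)
    have "s ! (p + Suc d) = r ! (p + Suc d) \<or> r ! (p + Suc d) = r ! (p + d)"
      using step[of "p + Suc d"] Suc.prems by (simp add: toward_def)
    moreover have "(if p + d \<in> change_set s then 1 else 0) = (if s ! (p + d) = s ! (p + Suc d) then 0 else (1 :: nat))"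
      "(if p + d \<in> change_set r then 1 else 0) = (if r ! (p + d) = r ! (p + Suc d) then 0 else (1 :: nat))"
      using len Suc.prems by (simp_all add: change_set_def)
    moreover have "?R r p (p + d) + (if s ! (p + d) = r ! (p + d) then 0 else 1) \<le> ?R s p (p + d)"
      using Suc by simp
    ultimately show ?case
      using ins[of p "p + d" s] ins[of p "p + d" r] key[of "s ! (p + Suc d)" "r ! (p + Suc d)" "r ! (p + d)" "s ! (p + d)"]
      unfolding add_Suc_right by linarith
  qed (simp add: eq emp)
  have left: "d \<le> p \<Longrightarrow> ?R r (p - d) p + (if s ! (p - d) = r ! (p - d) then 0 else 1) \<le> ?R s (p - d) p" for d
  proof (induction d)
    case (Suc d)
    have sd: "p - d = Suc (p - Suc d)" "p - Suc d < p" using Suc.prems by auto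
    have "s ! (p - Suc d) = r ! (p - Suc d) \<or> r ! (p - Suc d) = r ! (p - d)"
      using step[of "p - Suc d"] Suc.prems p by (simp add: toward_def sd)
    moreover have "(if p - Suc d \<in> change_set s then 1 else 0) = (if s ! (p - d) = s ! (p - Suc d) then 0 else (1 :: nat))"
      "(if p - Suc d \<in> change_set r then 1 else 0) = (if r ! (p - d) = r ! (p - Suc d) then 0 else (1 :: nat))"
      using len p sd by (auto simp: change_set_def)
    moreover have "?R r (p - d) p + (if s ! (p - d) = r ! (p - d) then 0 else 1) \<le> ?R s (p - d) p"
      using Suc by simp
    ultimately show ?case
      using ins'[OF sd(2), of s, folded sd(1)] ins'[OF sd(2), of r, folded sd(1)]
        key[of "s ! (p - Suc d)" "r ! (p - Suc d)" "r ! (p - d)" "s ! (p - d)"]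
      by linarith
  qed (simp add: eq emp)
  have total: "sign_changes s = ?R s 0 p + ?R s p (n - 1)" if "length s = n" for s
  proof -
    let ?A = "{i\<in>change_set s. 0 \<le> i \<and> i < p}" and ?B = "{i\<in>change_set s. p \<le> i \<and> i < n - 1}"
    have "i < n - 1" if "i \<in> change_set s" for i
      using that \<open>length s = n\<close> by (auto simp: change_set_def)
    then have "change_set s = ?A \<union> ?B" by (intro subset_antisym subsetI) auto
    moreover have "card (?A \<union> ?B) = card ?A + card ?B" by (rule card_Un_disjoint) auto
    ultimately show ?thesis unfolding sign_changes_eq by metis
  qed
  have "?R r 0 p \<le> ?R s 0 p" using left[of p] by simp
  moreover have "?R r p (n - 1) + (if s ! (n - 1) = r ! (n - 1) then 0 else 1) \<le> ?R s p (n - 1)"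
    using right[of "n - 1 - p"] p by simp
  moreover have last: "last s = s ! (n - 1)" "last r = r ! (n - 1)"
    using len p by (subst last_conv_nth; auto)+
  ultimately have le: "sign_changes r + (if last s = last r then 0 else 1) \<le> sign_changes s"
    unfolding total[OF len(1)] total[OF len(2)] last by linarith
  show ?thesis using low le unfolding low_variation_def by (auto split: if_splits)
qed

text \<open>A closed set of reals that with every point contains a small interval to the left of it extends
  to minus infinity.\<close>

lemma left_open_closed_down:
  fixes T :: "real set"
  assumes T: "closed T" and left: "\<And>t. t \<in> T \<Longrightarrow> eventually (\<lambda>s. t - s \<in> T) (at_right 0)"
    and b: "b \<in> T" and a: "a \<le> b"
  shows "a \<in> T"
proof (rule ccontr)
  assume aT: "a \<notin> T"
  define B where "B = {s. s \<le> b \<and> {s..b} \<subseteq> T}"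
  have bB: "b \<in> B" using b by (simp add: B_def)
  have lower: "a < s" if "s \<in> B" for s
  proof (rule ccontr)
    assume "\<not> a < s"
    then have "a \<in> {s..b}" using a by simp
    then show False using that aT by (auto simp: B_def)
  qed
  then have bdd: "bdd_below B" by (intro bdd_belowI[of _ a]) (auto intro: less_imp_le)
  define m where "m = Inf B"
  have mb: "m \<le> b" unfolding m_def by (rule cInf_lower[OF bB bdd])
  have sub: "{m<..b} \<subseteq> T"
  proof
    fix r assume r: "r \<in> {m<..b}"
    then have "Inf B < r" by (simp add: m_def)
    moreover have "B \<noteq> {}" using bB by auto
    ultimately obtain s where "s \<in> B" "s < r" using cInf_less_iff[OF _ bdd] by blast
    then show "r \<in> T" using r by (auto simp: B_def)
  qed
  have "m \<in> T"
  proof (cases "m = b")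
    case False
    then have "closure {m<..b} = {m..b}" using mb by simp
    moreover have "closure {m<..b} \<subseteq> T" by (rule closure_minimal[OF sub T])
    ultimately show ?thesis using mb by auto
  qed (use b in simp)
  then obtain \<epsilon> where \<epsilon>: "\<epsilon> > 0" "\<And>s. 0 < s \<Longrightarrow> s < \<epsilon> \<Longrightarrow> m - s \<in> T"
    using left[of m] unfolding eventually_at_right_field by auto
  have "m - \<epsilon> / 2 \<in> B"
    unfolding B_def
  proof (intro CollectI conjI subsetI)
    fix r assume r: "r \<in> {m - \<epsilon> / 2..b}"
    consider "r < m" | "r = m" | "r > m" by linarith
    then show "r \<in> T"
    proof cases
      case 1
      then show ?thesis using \<epsilon>(2)[of "m - r"] r \<epsilon>(1) by simp
    qed (use \<open>m \<in> T\<close> sub r in auto)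
  qed (use mb \<epsilon> in simp)
  then have "m \<le> m - \<epsilon> / 2" unfolding m_def by (rule cInf_lower[OF _ bdd])
  then show False using \<epsilon>(1) by simp
qed

context
  fixes e :: "(real ^ 'n::{finite,linorder}) list" and p :: nat
  assumes e: "e \<in> ordered_bases UNIV" and p: "p < CARD('n)"
begin

lemma coordinates_drift:
  "i < CARD('n) \<Longrightarrow> coordinates e (drift e p v) ! i = (if i = p then 0 else coordinates e v ! toward p i)"
  by (rule coordinates_unique[OF e]) (simp_all add: drift_def)

lemma linear_drift: "linear (drift e p)"
proof (rule linearI)
  note lin = linear_coordinates[OF e]
  show "drift e p (x + y) = drift e p x + drift e p y" for x y
    by (rule vector_eqI_coordinates[OF e])
      (simp add: coordinates_drift linear_add[OF lin] toward_less p)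
  show "drift e p (r *\<^sub>R x) = r *\<^sub>R drift e p x" for r x
    by (rule vector_eqI_coordinates[OF e])
      (simp add: coordinates_drift linear_cmul[OF lin] toward_less p)
qed

lemma linear_drift_power: "linear (drift e p ^^ d)"
proof (induction d)
  case 0
  show ?case by (simp add: linear_ident)
next
  case (Suc d)
  show ?case unfolding funpow.simps by (rule linear_compose[OF Suc linear_drift])
qed

lemma coordinates_drift_power:
  "i < CARD('n) \<Longrightarrow> steps p i < d \<Longrightarrow> coordinates e ((drift e p ^^ d) v) ! i = 0"
proof (induction d arbitrary: i)
  case (Suc d)
  show ?case
  proof (cases "i = p")
    case False
    then have "steps p (toward p i) < d" using Suc.prems(2) steps_toward[OF False] by simp
    then show ?thesis using Suc.IH[of "toward p i"] Suc.prems(1) p toward_less by (simp add: coordinates_drift)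
  qed (use Suc.prems in \<open>simp add: coordinates_drift\<close>)
qed simp

lemma drift_nilpotent:
  assumes "CARD('n) \<le> d"
  shows "(drift e p ^^ d) v = 0"
proof (rule vector_eqI_coordinates[OF e])
  fix i assume i: "i < CARD('n)"
  then have "steps p i < d" using assms p by (auto simp: steps_def)
  then show "coordinates e ((drift e p ^^ d) v) ! i = coordinates e 0 ! i"
    using coordinates_drift_power[OF i] linear_0[OF linear_coordinates[OF e i]] by simp
qed

lemma flow_zero [simp]: "flow e p 0 v = v"
proof -
  have "flow e p 0 v = (\<Sum>d<CARD('n). if d = 0 then v else 0)"
    unfolding flow_def by (intro sum.cong refl) auto
  then show ?thesis by simp
qed

lemma flow_flow: "flow e p s (flow e p t v) = flow e p (s + t) v"
proof -
  let ?n = "CARD('n)"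
  let ?N = "\<lambda>d. (drift e p ^^ d) v"
  have nz: "?N d \<noteq> 0 \<Longrightarrow> d < ?n" for d using drift_nilpotent[of d v] by (cases "d < ?n") auto
  let ?g = "\<lambda>a b. (s ^ a / fact a * (t ^ b / fact b)) *\<^sub>R ?N (a + b)"
  have "flow e p s (flow e p t v) = (\<Sum>a<?n. \<Sum>b<?n. ?g a b)"
    unfolding flow_def
    by (simp add: linear_sum[OF linear_drift_power] linear_cmul[OF linear_drift_power] scaleR_sum_right funpow_add)
  also have "\<dots> = sum (\<lambda>(a, b). ?g a b) ({..<?n} \<times> {..<?n})" by (rule sum.cartesian_product)
  also have "\<dots> = sum (\<lambda>(a, b). ?g a b) {(a, b). a + b < ?n}"
    by (rule sum.mono_neutral_right) (auto dest: nz)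
  also have "\<dots> = (\<Sum>d<?n. \<Sum>a\<le>d. ?g a (d - a))" by (rule sum.triangle_reindex)
  also have "\<dots> = (\<Sum>d<?n. ((s + t) ^ d / fact d) *\<^sub>R ?N d)"
  proof (intro sum.cong refl)
    fix d assume "d \<in> {..<?n}"
    have "(s + t) ^ d / fact d = (\<Sum>a\<le>d. s ^ a / fact a * (t ^ (d - a) / fact (d - a)))"
      unfolding binomial_ring sum_divide_distrib
      by (intro sum.cong refl) (simp add: binomial_fact field_simps)
    then show "(\<Sum>a\<le>d. ?g a (d - a)) = ((s + t) ^ d / fact d) *\<^sub>R ?N d"
      by (simp add: scaleR_sum_left)
  qed
  finally show ?thesis by (simp add: flow_def)
qed

lemma continuous_flow: "continuous_on S (\<lambda>z. flow e p (fst z) (snd z))"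
proof -
  have "continuous_on S (\<lambda>z. (drift e p ^^ d) (snd z))" for d and S :: "(real \<times> (real ^ 'n::{finite,linorder})) set"
    by (rule continuous_on_compose2[OF linear_continuous_on[of "drift e p ^^ d" UNIV] continuous_on_snd])
      (auto simp: linear_conv_bounded_linear[symmetric] linear_drift_power intro: continuous_on_id)
  then show ?thesis unfolding flow_def by (intro continuous_intros) auto
qed

lemma continuous_flow_time: "continuous_on S (\<lambda>t. flow e p t v)"
  unfolding flow_def by (intro continuous_intros) auto

lemma coordinates_flow_derivative:
  assumes i: "i < CARD('n)"
  shows "((\<lambda>t. coordinates e (flow e p t v) ! i) has_real_derivative
    (if i = p then 0 else coordinates e (flow e p t v) ! toward p i)) (at t)"
proof -
  let ?n = "CARD('n)"
  let ?c = "\<lambda>d. coordinates e ((drift e p ^^ d) v) ! i"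
  have lin: "linear (\<lambda>v. coordinates e v ! i)" by (rule linear_coordinates[OF e i])
  have eq: "coordinates e (flow e p t v) ! i = (\<Sum>d<?n. t ^ d / fact d * ?c d)" for t
    by (simp add: flow_def linear_sum[OF lin] linear_cmul[OF lin])
  obtain m where m: "?n = Suc m" by (metis card_gt_0_iff finite_class.finite_UNIV UNIV_not_empty gr0_implies_Suc)
  have "((\<lambda>t. \<Sum>d<?n. t ^ d / fact d * ?c d) has_real_derivative (\<Sum>d<?n. real d * t ^ (d - 1) / fact d * ?c d)) (at t)"
    by (auto intro!: derivative_eq_intros sum.cong)
  also have "(\<Sum>d<?n. real d * t ^ (d - 1) / fact d * ?c d) = (\<Sum>d<m. t ^ d / fact d * ?c (Suc d))"
  proof -
    have "real (Suc d) * t ^ d / fact (Suc d) = t ^ d / fact d" for d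
      by (simp del: of_nat_Suc)
    then show ?thesis unfolding m sum.lessThan_Suc_shift by (simp del: of_nat_Suc fact_Suc)
  qed
  also have "\<dots> = (\<Sum>d<?n. t ^ d / fact d * ?c (Suc d))"
    using drift_nilpotent[of "Suc m" v] m linear_0[OF lin] by (simp del: funpow.simps)
  also have "\<dots> = coordinates e (drift e p (flow e p t v)) ! i"
    by (simp add: flow_def linear_sum[OF linear_drift] linear_cmul[OF linear_drift] linear_sum[OF lin] linear_cmul[OF lin])
  also have "\<dots> = (if i = p then 0 else coordinates e (flow e p t v) ! toward p i)" by (rule coordinates_drift[OF i])
  finally show ?thesis unfolding eq .
qed

lemma coordinates_flow_centre: "coordinates e (flow e p t v) ! p = coordinates e v ! p"
proof -
  have "coordinates e (flow e p t v) ! p = coordinates e (flow e p 0 v) ! p"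
    by (rule DERIV_isconst_all) (use coordinates_flow_derivative[OF p] in simp)
  then show ?thesis by simp
qed

lemma coordinates_flow_adjacent:
  assumes q: "q < CARD('n)" "q \<noteq> p" "toward p q = p"
  shows "coordinates e (flow e p t v) ! q = coordinates e v ! q + t * coordinates e v ! p"
proof -
  let ?h = "\<lambda>t. coordinates e (flow e p t v) ! q - t * coordinates e v ! p"
  have "(?h has_real_derivative 0) (at t)" for t
    using coordinates_flow_derivative[OF q(1), of v t] q(2,3)
    by (auto intro!: derivative_eq_intros simp: coordinates_flow_centre)
  then have "?h t = ?h 0" by (intro DERIV_isconst_all) auto
  then show ?thesis by simp
qed

text \<open>A vanishing coordinate has the neighbour towards \<open>p\<close> as its derivative. By the mean value theorem
  it takes the sign that this neighbour has at small positive times.\<close>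

lemma flow_eventual_sign:
  assumes v: "coordinates e v ! p \<noteq> 0" and i: "i < CARD('n)"
  shows "\<exists>r \<in> {-1, 1}. eventually (\<lambda>t. sgn (coordinates e (flow e p t v) ! i) = r) (at_right 0) \<and>
    (coordinates e v ! i \<noteq> 0 \<longrightarrow> r = sgn (coordinates e v ! i)) \<and>
    (coordinates e v ! i = 0 \<longrightarrow> eventually (\<lambda>t. sgn (coordinates e (flow e p t v) ! toward p i) = r) (at_right 0))"
  using i
proof (induction "steps p i" arbitrary: i rule: less_induct)
  case less
  let ?f = "\<lambda>i t. coordinates e (flow e p t v) ! i"
  have cont: "isCont (?f i) t" if "i < CARD('n)" for i t
    using coordinates_flow_derivative[OF that] DERIV_isCont by blast
  show ?case
  proof (cases "coordinates e v ! i = 0")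
    case False
    have "(?f i \<longlongrightarrow> coordinates e v ! i) (at_right 0)"
      using cont[OF less.prems, of 0] by (simp add: isCont_def filterlim_at_split)
    then have "eventually (\<lambda>t. sgn (?f i t) = sgn (coordinates e v ! i)) (at_right 0)"
    proof (cases "coordinates e v ! i > 0")
      case True
      then show ?thesis using order_tendstoD(1)[OF \<open>(?f i \<longlongrightarrow> _) _\<close>, of 0]
        by (auto elim!: eventually_mono simp: sgn_if)
    next
      case F: False
      then show ?thesis using order_tendstoD(2)[OF \<open>(?f i \<longlongrightarrow> _) _\<close>, of 0] False
        by (auto elim!: eventually_mono simp: sgn_if)
    qed
    then show ?thesis using False by (intro bexI[of _ "sgn (coordinates e v ! i)"]) (auto simp: sgn_if)
  next
    case True
    then have ip: "i \<noteq> p" using v by auto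
    let ?j = "toward p i"
    have "?j < CARD('n)" "steps p ?j < steps p i" using less.prems p toward_less steps_toward[OF ip] by auto
    then obtain r where r: "r \<in> {-1, 1}" "eventually (\<lambda>t. sgn (?f ?j t) = r) (at_right 0)"
      using less.hyps by blast
    then obtain \<epsilon> where \<epsilon>: "\<epsilon> > 0" "\<And>t. 0 < t \<Longrightarrow> t < \<epsilon> \<Longrightarrow> sgn (?f ?j t) = r"
      unfolding eventually_at_right_field by auto
    have "sgn (?f i t) = r" if t: "0 < t" "t < \<epsilon>" for t
    proof -
      obtain z where z: "0 < z" "z < t" "?f i t - ?f i 0 = (t - 0) * ?f ?j z"
        using MVT2[OF t(1), of "?f i" "?f ?j"] coordinates_flow_derivative[OF less.prems, of v] ip by auto
      then have "?f i t = t * ?f ?j z" using True by simp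
      then show ?thesis using \<epsilon>(2)[of z] z t by (simp add: sgn_mult)
    qed
    then have "eventually (\<lambda>t. sgn (?f i t) = r) (at_right 0)"
      unfolding eventually_at_right_field using \<epsilon>(1) by auto
    then show ?thesis using r True by auto
  qed
qed

text \<open>At small positive times no coordinate vanishes, and the only possible signs arise from those of
  \<open>v\<close> by extension from \<open>p\<close> outwards. So they are low.\<close>

lemma flow_enters:
  assumes n: "CARD('n) = 4 * k + 3" and v: "coordinates e v ! p \<noteq> 0" and vC: "v \<in> closed_half k e"
  shows "eventually (\<lambda>t. flow e p t v \<notin> closed_half k (alt_rev e)) (at_right 0)"
proof -
  let ?n = "CARD('n)"
  let ?f = "\<lambda>i t. coordinates e (flow e p t v) ! i"
  have len: "length e = ?n" using e ordered_bases_UNIV_iff by blast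
  let ?Q = "\<lambda>i r. r \<in> {-1, 1} \<and> eventually (\<lambda>t. sgn (?f i t) = r) (at_right 0) \<and>
    (coordinates e v ! i \<noteq> 0 \<longrightarrow> r = sgn (coordinates e v ! i)) \<and>
    (coordinates e v ! i = 0 \<longrightarrow> eventually (\<lambda>t. sgn (?f (toward p i) t) = r) (at_right 0))"
  have "\<forall>i\<in>{..<?n}. \<exists>r. ?Q i r"
    using flow_eventual_sign[OF v] unfolding Bex_def by simp
  from bchoice[OF this] obtain r where "\<forall>i\<in>{..<?n}. ?Q i (r i)" by (rule exE)
  then have Q: "?Q i (r i)" if "i < ?n" for i using that by simp
  have r: "\<And>i. i < ?n \<Longrightarrow> r i \<in> {-1, 1}"
    "\<And>i. i < ?n \<Longrightarrow> eventually (\<lambda>t. sgn (?f i t) = r i) (at_right 0)"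
    "\<And>i. i < ?n \<Longrightarrow> coordinates e v ! i \<noteq> 0 \<Longrightarrow> r i = sgn (coordinates e v ! i)"
    "\<And>i. i < ?n \<Longrightarrow> coordinates e v ! i = 0 \<Longrightarrow> eventually (\<lambda>t. sgn (?f (toward p i) t) = r i) (at_right 0)"
    using Q by blast+
  have rt: "r i = r (toward p i)" if "i < ?n" "coordinates e v ! i = 0" for i
  proof -
    have "eventually (\<lambda>t. r i = r (toward p i)) (at_right (0 :: real))"
      using r(4)[OF that] r(2)[OF toward_less[OF that(1) p]] by eventually_elim simp
    then show ?thesis by simp
  qed
  obtain s where s: "sign_list s" "length s = ?n" "low_variation k s" "\<And>i. i < ?n \<Longrightarrow> 0 \<le> coordinates e v ! i * s ! i"
    using vC by (auto simp: closed_half_def)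
  let ?r = "map r [0..<?n]"
  have sr: "s ! i = ?r ! i" if "i < ?n" "coordinates e v ! i \<noteq> 0" for i
    using s(4)[OF that(1)] sign_list_nth[OF s(1), of i] s(2) that r(3)[OF that]
    by (auto simp: sgn_if zero_le_mult_iff)
  have low: "low_variation k ?r"
  proof (rule low_variation_toward[OF s(2) _ p])
    fix i assume i: "i < ?n" "i \<noteq> p"
    show "s ! i = ?r ! i \<or> ?r ! i = ?r ! toward p i"
      using sr[OF i(1)] rt[OF i(1)] i(1) toward_less[OF i(1) p] by (cases "coordinates e v ! i = 0") auto
  qed (use sr[OF p v] s in auto)
  have "eventually (\<lambda>t. \<forall>i\<in>{..<?n}. sgn (?f i t) = r i) (at_right 0)"
    by (rule eventually_ball_finite) (use r(2) in auto)
  then show ?thesis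
  proof eventually_elim
    case (elim t)
    have "u = ?r" if u: "u \<in> sign_assignments (coordinates e (flow e p t v))" for u
    proof (rule nth_equalityI)
      show lu: "length u = length ?r" using u len by (simp add: sign_assignments_def coordinates_def)
      fix i assume "i < length u"
      then have i: "i < ?n" using lu by simp
      then have "sgn (?f i t) = r i" using elim by simp
      moreover then have "?f i t \<noteq> 0" using r(1)[OF i] by auto
      ultimately show "u ! i = ?r ! i" using u i len by (simp add: sign_assignments_def coordinates_def)
    qed
    then show ?case using not_closed_half_alt_rev_iff[OF n e] low by blast
  qed
qed

end

text \<open>The alternating signs of \<open>alt_rev\<close> reverse the direction of the flow. So statements about
  leaving a closed half follow from those about entering one.\<close>

lemma flow_alt_rev:
  fixes e :: "(real ^ 'n::{finite,linorder}) list"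
  assumes e: "e \<in> ordered_bases UNIV" and p: "p < CARD('n)" and e': "alt_rev e \<in> ordered_bases UNIV"
  shows "flow (alt_rev e) (CARD('n) - 1 - p) t v = flow e p (- t) v"
proof -
  let ?n = "CARD('n)"
  let ?p = "?n - 1 - p"
  have p': "?p < ?n" using p by simp
  have dr: "drift (alt_rev e) ?p v = - drift e p v" for v
  proof (rule vector_eqI_coordinates[OF e'])
    fix i assume i: "i < ?n"
    let ?i = "?n - 1 - i"
    have i': "?i < ?n" using i by simp
    have neg: "coordinates (alt_rev e) (- w) ! i = - coordinates (alt_rev e) w ! i" for w
      using linear_neg[OF linear_coordinates[OF e' i]] .
    show "coordinates (alt_rev e) (drift (alt_rev e) ?p v) ! i = coordinates (alt_rev e) (- drift e p v) ! i"
    proof (cases "i = ?p")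
      case True
      then have "?i = p" using p by simp
      have "coordinates (alt_rev e) (drift (alt_rev e) ?p v) ! i = 0"
        unfolding coordinates_drift[OF e' p' i] using True by (simp only: if_True refl)
      moreover have "coordinates (alt_rev e) (- drift e p v) ! i = 0"
        unfolding neg unfolding coordinates_alt_rev[OF e i] coordinates_drift[OF e p i'] if_P[OF \<open>?i = p\<close>] by simp
      ultimately show ?thesis by simp
    next
      case False
      then have ne: "?i \<noteq> p" using i by auto
      have t: "toward ?p i < ?n" "?n - 1 - toward ?p i = toward p ?i"
      proof -
        obtain a where a: "?n = Suc (i + a)" using i less_iff_Suc_add by auto
        obtain b where b: "?n = Suc (p + b)" using p less_iff_Suc_add by auto
        have ia: "i + a = p + b" using a b by simp
        have e: "?n - 1 - i = a" "?n - 1 - p = b" using a b by simp_all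
        have ib: "i \<noteq> b" using False e by simp
        show "toward ?p i < ?n" unfolding e toward_def using ia ib i b by (cases "i < b") auto
        show "?n - 1 - toward ?p i = toward p ?i"
          unfolding e toward_def using ia ib a by (cases "i < b") auto
      qed
      have "odd (i + toward ?p i)" using False by (auto simp: toward_def)
      then have "(-1 :: real) ^ toward ?p i = - ((-1) ^ i)" by (simp add: minus_one_power_iff)
      then show ?thesis
        unfolding neg unfolding coordinates_drift[OF e' p' i] unfolding coordinates_alt_rev[OF e i] coordinates_alt_rev[OF e t(1)]
          coordinates_drift[OF e p i'] t(2) if_not_P[OF False] if_not_P[OF ne] by simp
    qed
  qed
  have "(drift (alt_rev e) ?p ^^ d) v = (-1) ^ d *\<^sub>R (drift e p ^^ d) v" for d
  proof (induction d)
    case (Suc d)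
    have "(drift (alt_rev e) ?p ^^ Suc d) v = - drift e p ((-1) ^ d *\<^sub>R (drift e p ^^ d) v)"
      unfolding funpow.simps o_def Suc dr ..
    also have "\<dots> = (-1) ^ Suc d *\<^sub>R (drift e p ^^ Suc d) v"
      unfolding linear_cmul[OF linear_drift[OF e p]] by simp
    finally show ?case .
  qed simp
  then show ?thesis
    unfolding flow_def by (intro sum.cong refl) (simp add: power_minus[of t] mult.commute)
qed


lemma flow_exits:
  fixes e :: "(real ^ 'n::{finite,linorder}) list"
  assumes n: "CARD('n) = 4 * k + 3" and e: "e \<in> ordered_bases UNIV" and p: "p < CARD('n)"
    and v: "coordinates e v ! p \<noteq> 0" and vC: "v \<in> closed_half k (alt_rev e)"
  shows "eventually (\<lambda>t. flow e p (- t) v \<notin> closed_half k e) (at_right 0)"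
proof -
  have len: "length e = CARD('n)" "bracket e \<noteq> 0" using e ordered_bases_UNIV_iff by auto
  have e': "alt_rev e \<in> ordered_bases UNIV"
    using bracket_alt_rev[of "[]" e "[]"] len by (simp add: ordered_bases_UNIV_iff)
  let ?p = "CARD('n) - 1 - p"
  have p': "?p < CARD('n)" "CARD('n) - 1 - ?p = p" using p by auto
  have ee: "alt_rev (alt_rev e) = e" by (rule alt_rev_alt_rev) (simp add: len n)
  have "coordinates (alt_rev e) v ! ?p \<noteq> 0" unfolding coordinates_alt_rev[OF e p'(1)] p'(2) using v by simp
  from flow_enters[OF e' p'(1) n this vC] show ?thesis
    unfolding ee flow_alt_rev[OF e p e'] .
qed

lemma closed_closed_half:
  fixes e :: "(real ^ 'n::{finite,linorder}) list"
  assumes "e \<in> ordered_bases UNIV"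
  shows "closed (closed_half k e)"
proof -
  let ?S = "{s. set s \<subseteq> {-1, 1 :: real} \<and> length s = CARD('n)}"
  have "closed_half k e = (\<Union>s\<in>{s\<in>?S. low_variation k s}. \<Inter>i\<in>{..<CARD('n)}. {v. 0 \<le> coordinates e v ! i * s ! i})"
    by (auto simp: closed_half_def sign_list_def)
  moreover have "closed (\<Union>s\<in>{s\<in>?S. low_variation k s}. \<Inter>i\<in>{..<CARD('n)}. {v. 0 \<le> coordinates e v ! i * s ! i})"
  proof (rule closed_UN)
    show "finite {s\<in>?S. low_variation k s}"
      by (rule finite_subset[OF _ finite_lists_length_eq[of "{-1, 1 :: real}" "CARD('n)"]]) auto
    show "\<forall>s\<in>{s\<in>?S. low_variation k s}. closed (\<Inter>i\<in>{..<CARD('n)}. {v. 0 \<le> coordinates e v ! i * s ! i})"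
    proof (intro ballI closed_INT)
      fix s i assume "i \<in> {..<CARD('n)}"
      then have "continuous_on UNIV (\<lambda>v. coordinates e v ! i)" using continuous_coordinates[OF assms] by simp
      then show "closed {v. 0 \<le> coordinates e v ! i * s ! i}"
        by (intro closed_Collect_le continuous_intros)
    qed
  qed
  ultimately show ?thesis by simp
qed

lemma closed_half_positive_scale:
  fixes e :: "(real ^ 'n::{finite,linorder}) list"
  assumes "e \<in> ordered_bases UNIV" "c > 0"
  shows "c *\<^sub>R v \<in> closed_half k e \<longleftrightarrow> v \<in> closed_half k e"
proof -
  have "coordinates e (c *\<^sub>R v) ! i = c * coordinates e v ! i" if "i < CARD('n)" for i
    using linear_cmul[OF linear_coordinates[OF assms(1) that]] by simp
  moreover have "0 \<le> c * x * y \<longleftrightarrow> 0 \<le> x * y" for x y :: real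
    using assms(2) by (simp add: mult.assoc zero_le_mult_iff)
  ultimately show ?thesis by (simp add: closed_half_def)
qed

lemma sgn_closed_half_iff:
  fixes e :: "(real ^ 'n::{finite,linorder}) list"
  assumes "e \<in> ordered_bases UNIV"
  shows "sgn v \<in> closed_half k e \<longleftrightarrow> v \<in> closed_half k e"
proof (cases "v = 0")
  case False
  then show ?thesis using closed_half_positive_scale[OF assms, of "inverse (norm v)"] by (simp add: sgn_div_norm)
qed simp

lemma closed_half_cover:
  fixes e :: "(real ^ 'n::{finite,linorder}) list"
  assumes n: "CARD('n) = 4 * k + 3" and e: "e \<in> ordered_bases UNIV"
  shows "v \<in> closed_half k e \<or> v \<in> closed_half k (alt_rev e)"
proof -
  have "length e = CARD('n)" using e ordered_bases_UNIV_iff by blast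
  then show ?thesis
    using not_closed_half_alt_rev_iff[OF n e, of v] closed_half_iff[of e v k] sign_assignments_nonempty by blast
qed

section \<open>Walls are polyhedral hypersurfaces\<close>

definition wall :: "nat \<Rightarrow> (real ^ 'n::{finite,linorder}) list \<Rightarrow> (real ^ 'n::{finite,linorder}) set" where
  "wall k e = sphere 0 1 \<inter> closed_half k e \<inter> closed_half k (alt_rev e)"

lemma exists_nonzero_coordinate:
  fixes e :: "(real ^ 'n::{finite,linorder}) list"
  assumes "e \<in> ordered_bases UNIV" "v \<noteq> 0"
  shows "\<exists>p<CARD('n). coordinates e v ! p \<noteq> 0"
  using coordinates_expansion[OF assms(1), of v] assms(2) by (metis (no_types, lifting) lessThan_iff scale_zero_left sum.neutral)

lemma alt_rev_ordered_bases:
  fixes e :: "(real ^ 'n::{finite,linorder}) list"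
  assumes "e \<in> ordered_bases UNIV"
  shows "alt_rev e \<in> ordered_bases UNIV"
  using assms bracket_alt_rev[of "[]" e "[]"] by (simp add: ordered_bases_UNIV_iff)

text \<open>Following the flow for a short time leads from a point of the wall into the open halfspace.\<close>

lemma wall_in_closure:
  fixes e :: "(real ^ 'n::{finite,linorder}) list"
  assumes n: "CARD('n) = 4 * k + 3" and e: "e \<in> ordered_bases UNIV" and x: "x \<in> wall k e"
    and U: "open U" "x \<in> U"
  shows "\<exists>y \<in> sphere 0 1 \<inter> U. y \<notin> closed_half k (alt_rev e)"
proof -
  have x': "norm x = 1" "x \<in> closed_half k e" using x by (auto simp: wall_def)
  then have "x \<noteq> 0" by auto
  obtain p where p: "p < CARD('n)" "coordinates e x ! p \<noteq> 0"
    using exists_nonzero_coordinate[OF e \<open>x \<noteq> 0\<close>] by blast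
  have cont: "((\<lambda>t. flow e p t x) \<longlongrightarrow> flow e p 0 x) (at_right 0)"
    using continuous_flow_time[OF e p(1), of UNIV x] by (auto simp: continuous_on_eq_continuous_at isCont_def filterlim_at_split)
  have sg: "((\<lambda>t. sgn (flow e p t x)) \<longlongrightarrow> x) (at_right 0)"
    using tendsto_sgn[OF cont] \<open>x \<noteq> 0\<close> x'(1) flow_zero[OF e p(1)] by (simp add: sgn_div_norm)
  have "eventually (\<lambda>t. sgn (flow e p t x) \<in> U) (at_right 0)"
    using topological_tendstoD[OF sg U] .
  moreover have "eventually (\<lambda>t. flow e p t x \<notin> closed_half k (alt_rev e)) (at_right 0)"
    by (rule flow_enters[OF e p(1) n p(2) x'(2)])
  ultimately have "eventually (\<lambda>t. sgn (flow e p t x) \<in> U \<and> flow e p t x \<notin> closed_half k (alt_rev e)) (at_right 0)"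
    by (rule eventually_conj)
  then obtain t where t: "sgn (flow e p t x) \<in> U" "flow e p t x \<notin> closed_half k (alt_rev e)"
    using eventually_happens'[OF trivial_limit_at_right_real] by blast
  have "flow e p t x \<noteq> 0"
    using coordinates_flow_centre[OF e p(1), of t x] p linear_0[OF linear_coordinates[OF e p(1)]] by auto
  then have "sgn (flow e p t x) \<in> sphere 0 1" by (simp add: norm_sgn)
  then show ?thesis using t sgn_closed_half_iff[OF alt_rev_ordered_bases[OF e]] by blast
qed

text \<open>The times at which an orbit is in the opposite closed half are closed to the past by
  \<open>flow_exits\<close>. Right after a crossing the orbit is not in it, so there is no later crossing.\<close>

lemma flow_crossing_unique:
  fixes e :: "(real ^ 'n::{finite,linorder}) list"
  assumes n: "CARD('n) = 4 * k + 3" and e: "e \<in> ordered_bases UNIV" and p: "p < CARD('n)"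
    and y: "coordinates e y ! p \<noteq> 0"
    and 1: "flow e p t1 y \<in> closed_half k e" "flow e p t1 y \<in> closed_half k (alt_rev e)"
    and 2: "flow e p t2 y \<in> closed_half k e" "flow e p t2 y \<in> closed_half k (alt_rev e)"
  shows "t1 = t2"
proof -
  have no: False if "a < b" "flow e p a y \<in> closed_half k e" "flow e p b y \<in> closed_half k (alt_rev e)" for a b
  proof -
    let ?T = "{t. flow e p t y \<in> closed_half k (alt_rev e)}"
    have nz: "coordinates e (flow e p t y) ! p \<noteq> 0" for t using coordinates_flow_centre[OF e p] y by simp
    have "isCont (\<lambda>t. flow e p t y) t" for t
      using continuous_flow_time[OF e p, of UNIV y] by (simp add: continuous_on_eq_continuous_at)
    then have "closed ((\<lambda>t. flow e p t y) -` closed_half k (alt_rev e))"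
      using continuous_closed_vimage[OF closed_closed_half[OF alt_rev_ordered_bases[OF e]]] by blast
    then have "closed ?T" by (simp add: vimage_def)
    moreover have "eventually (\<lambda>s. t - s \<in> ?T) (at_right 0)" if "t \<in> ?T" for t
    proof -
      have "eventually (\<lambda>s. flow e p (- s) (flow e p t y) \<notin> closed_half k e) (at_right 0)"
        by (rule flow_exits[OF n e p nz]) (use that in simp)
      then show ?thesis
      proof eventually_elim
        case (elim s)
        then have "flow e p (t - s) y \<notin> closed_half k e" by (simp add: flow_flow[OF e p])
        then show ?case using closed_half_cover[OF n e] by blast
      qed
    qed
    ultimately have down: "t \<in> ?T" if "t \<le> b" for t
      using left_open_closed_down[of ?T b t] that \<open>flow e p b y \<in> _\<close> by blast
    have "eventually (\<lambda>s. flow e p s (flow e p a y) \<notin> closed_half k (alt_rev e)) (at_right 0)"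
      by (rule flow_enters[OF e p n nz that(2)])
    then have "eventually (\<lambda>s. a + s \<notin> ?T) (at_right 0)" by (simp add: flow_flow[OF e p] add.commute)
    then obtain \<epsilon> where "\<epsilon> > 0" "\<And>s. 0 < s \<Longrightarrow> s < \<epsilon> \<Longrightarrow> a + s \<notin> ?T"
      unfolding eventually_at_right_field by auto
    then have "a + min (\<epsilon> / 2) (b - a) \<notin> ?T" using that(1) by auto
    moreover have "a + min (\<epsilon> / 2) (b - a) \<le> b" using min.cobounded2[of "\<epsilon> / 2" "b - a"] by linarith
    ultimately show False using down by blast
  qed
  show ?thesis using no[of t1 t2] no[of t2 t1] 1 2 by (metis linorder_neqE_linordered_idom)
qed

lemma coordinates_basis_vector:
  fixes e :: "(real ^ 'n::{finite,linorder}) list"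
  assumes "e \<in> ordered_bases UNIV" "i < CARD('n)" "j < CARD('n)"
  shows "coordinates e (e ! i) ! j = (if j = i then 1 else 0)"
proof (rule coordinates_unique[OF assms(1) _ assms(3)])
  have "(\<Sum>j<CARD('n). (if j = i then 1 else 0) *\<^sub>R e ! j) = (\<Sum>j<CARD('n). if j = i then e ! i else 0)"
    by (intro sum.cong) auto
  then show "e ! i = (\<Sum>j<CARD('n). (if j = i then 1 else 0) *\<^sub>R e ! j)" using assms(2) by simp
qed

text \<open>The orbits of the flow meet the slice where the coordinate \<open>p\<close> is \<open>\<sigma>\<close> and the adjacent coordinate
  \<open>q\<close> vanishes exactly once, because \<open>q\<close> moves with constant nonzero speed. Sliding a point of
  the wall along its orbit into the slice is the chart. It is injective since an orbit crosses the wall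
  at most once, and open since an orbit that changes sides does so together with all orbits nearby.\<close>

lemma hypersurface_wall:
  fixes e :: "(real ^ 'n::{finite,linorder}) list"
  assumes n: "CARD('n) = 4 * k + 3" and e: "e \<in> ordered_bases UNIV"
  shows "hypersurface (wall k e)"
  unfolding hypersurface_def
proof (intro conjI ballI)
  show "wall k e \<subseteq> sphere 0 1" by (auto simp: wall_def)
  fix x assume x: "x \<in> wall k e"
  let ?n = "CARD('n)"
  let ?C = "closed_half k e" and ?C' = "closed_half k (alt_rev e)"
  have e': "alt_rev e \<in> ordered_bases UNIV" by (rule alt_rev_ordered_bases[OF e])
  have len: "length e = ?n" using e ordered_bases_UNIV_iff by blast
  have "x \<noteq> 0" using x by (auto simp: wall_def)
  then obtain p where p: "p < ?n" "coordinates e x ! p \<noteq> 0" using exists_nonzero_coordinate[OF e] by blast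
  define q where "q = (if p = 0 then 1 else p - 1)"
  have q: "q < ?n" "q \<noteq> p" "toward p q = p" using p(1) n by (auto simp: q_def toward_def)
  define cp where "cp v = coordinates e v ! p" for v
  define cq where "cq v = coordinates e v ! q" for v
  have linp: "linear cp" and linq: "linear cq"
    unfolding cp_def[abs_def] cq_def[abs_def] using linear_coordinates[OF e] p q by auto
  have contp: "continuous_on S cp" and contq: "continuous_on S cq" for S
    unfolding cp_def[abs_def] cq_def[abs_def] using continuous_coordinates[OF e] p q by auto
  define \<sigma> where "\<sigma> = sgn (cp x)"
  have \<sigma>: "\<sigma> * \<sigma> = 1" "\<sigma> \<noteq> 0" using p(2) by (auto simp: \<sigma>_def cp_def sgn_if)
  let ?b = "\<sigma> *\<^sub>R e ! p"
  note unit = coordinates_basis_vector[OF e]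
  have cb: "cp ?b = \<sigma>" "cq ?b = 0"
    using unit[OF p(1) p(1)] unit[OF p(1) q(1)] q(2) linear_cmul[OF linp] linear_cmul[OF linq]
    by (auto simp: cp_def cq_def)
  \<comment> \<open>The slice is the translate of \<open>W\<close> by \<open>\<sigma> *\<^sub>R e ! p\<close>, and \<open>G w\<close> is the orbit of the point \<open>w\<close>.\<close>
  define W where "W = {w. cp w = 0 \<and> cq w = 0}"
  have subW: "subspace W"
    unfolding W_def subspace_def
    by (auto simp: linear_0[OF linp] linear_0[OF linq] linear_add[OF linp] linear_add[OF linq] linear_cmul[OF linp] linear_cmul[OF linq])
  have dimW: "dim W = ?n - 2"
  proof -
    have de: "distinct e" "independent (set e)" using e by (auto simp: ordered_bases_def)
    let ?B = "set e - {e ! p, e ! q}"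
    have "?B \<subseteq> W"
    proof
      fix b assume b: "b \<in> ?B"
      then obtain i where i: "i < ?n" "b = e ! i" using len by (auto simp: in_set_conv_nth)
      then have "i \<noteq> p" "i \<noteq> q" using b by auto
      then show "b \<in> W" using unit[OF i(1) p(1)] unit[OF i(1) q(1)] i by (simp add: W_def cp_def cq_def)
    qed
    then have 1: "span ?B \<subseteq> W" using span_minimal subW by blast
    have 2: "W \<subseteq> span ?B"
    proof
      fix w assume w: "w \<in> W"
      have "coordinates e w ! i *\<^sub>R e ! i \<in> span ?B" if i: "i < ?n" for i
      proof (cases "i = p \<or> i = q")
        case True
        then show ?thesis using w by (auto simp: W_def cp_def cq_def span_zero)
      next
        case False
        then have "e ! i \<in> ?B" using i len p q nth_eq_iff_index_eq[OF de(1)] by auto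
        then show ?thesis by (intro span_scale span_base)
      qed
      then have "(\<Sum>i<?n. coordinates e w ! i *\<^sub>R e ! i) \<in> span ?B" by (intro span_sum) auto
      then show "w \<in> span ?B" using coordinates_expansion[OF e, of w] by simp
    qed
    have "independent ?B" using independent_mono[OF de(2)] by blast
    then have "dim (span ?B) = card ?B" by (simp add: dim_eq_card_independent)
    also have "card ?B = ?n - 2"
    proof -
      have "e ! p \<noteq> e ! q" using nth_eq_iff_index_eq[OF de(1)] len p q by auto
      moreover have "e ! p \<in> set e" "e ! q \<in> set e" using len p q by auto
      ultimately show ?thesis using distinct_card[OF de(1)] len by (simp add: card_Diff_subset)
    qed
    finally show ?thesis using 1 2 by (metis subset_antisym)
  qed
  define G where "G w t = flow e p t (w + ?b)" for w t
  have Gp: "cp (G w t) = \<sigma>" and Gq: "cq (G w t) = t * \<sigma>" if "w \<in> W" for w t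
  proof -
    have y: "cp (w + ?b) = \<sigma>" "cq (w + ?b) = 0"
      using that cb by (auto simp: W_def linear_add[OF linp] linear_add[OF linq])
    show "cp (G w t) = \<sigma>" using coordinates_flow_centre[OF e p(1)] y by (simp add: cp_def G_def)
    show "cq (G w t) = t * \<sigma>" using coordinates_flow_adjacent[OF e p(1) q] y by (simp add: cp_def cq_def G_def)
  qed
  have G0: "G w t \<noteq> 0" if "w \<in> W" for w t using Gp[OF that, of t] \<sigma> linear_0[OF linp] by auto
  have contG: "continuous_on UNIV (\<lambda>z. G (fst z) (snd z))"
    unfolding G_def
    by (rule continuous_on_compose2[OF continuous_flow[OF e p(1), of UNIV], of _ "\<lambda>z. (snd z, fst z + ?b)", simplified])
      (intro continuous_intros)
  have GG: "G w (t + s) = flow e p s (G w t)" for w s t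
    by (simp add: G_def flow_flow[OF e p(1)] add.commute)
  define U where "U = wall k e \<inter> {v. 0 < \<sigma> * cp v}"
  \<comment> \<open>A vector is rescaled so that its coordinate \<open>p\<close> is \<open>\<sigma>\<close>; then \<open>\<tau>\<close> is the time since its orbit
    passed the slice, and \<open>f\<close> is the chart.\<close>
  define u where "u v = (1 / (\<sigma> * cp v)) *\<^sub>R v" for v
  define \<tau> where "\<tau> v = \<sigma> * cq (u v)" for v
  define f where "f v = flow e p (- \<tau> v) (u v) - ?b" for v
  have opU: "open {v. 0 < \<sigma> * cp v}"
    by (intro open_Collect_less continuous_intros contp)
  have xU: "x \<in> U" using x p(2) by (auto simp: U_def \<sigma>_def cp_def sgn_if mult_pos_pos mult_neg_neg)
  have opinU: "openin (top_of_set (wall k e)) U" unfolding U_def using opU by (simp add: openin_open_Int)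
  have up: "cp (u v) = \<sigma>" if "v \<in> U" for v
  proof -
    have "\<sigma> * cp v > 0" using that by (simp add: U_def)
    then have "\<sigma> \<noteq> 0" "cp v \<noteq> 0" by auto
    then have "cp (u v) * \<sigma> = 1" using linear_cmul[OF linp] by (simp add: u_def)
    then show ?thesis using \<sigma> by (metis mult.assoc mult.commute mult.right_neutral)
  qed
  have fW: "f v \<in> W" if "v \<in> U" for v
  proof -
    have a: "cp (flow e p t (u v)) = \<sigma>" "cq (flow e p t (u v)) = cq (u v) + t * \<sigma>" for t
      using coordinates_flow_centre[OF e p(1)] coordinates_flow_adjacent[OF e p(1) q] up[OF that]
      by (simp_all add: cp_def cq_def)
    have "cp (f v) = 0" by (simp add: f_def linear_diff[OF linp] a cb)
    moreover have "cq (f v) = 0"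
      using \<sigma>(1) by (simp add: f_def linear_diff[OF linq] a cb \<tau>_def mult.commute mult.left_commute)
    ultimately show ?thesis by (simp add: W_def)
  qed
  have Gf: "G (f v) (\<tau> v) = u v" for v
    by (simp add: G_def f_def flow_flow[OF e p(1)] flow_zero[OF e p(1)])
  have sgn_u: "sgn (u v) = v" if "v \<in> U" for v
  proof -
    have "norm v = 1" "\<sigma> * cp v > 0" using that by (auto simp: U_def wall_def)
    moreover then have "\<sigma> \<noteq> 0" "cp v \<noteq> 0" by auto
    ultimately show ?thesis by (simp add: u_def sgn_div_norm)
  qed
  have fG: "f (sgn (G w t)) = w" "\<tau> (sgn (G w t)) = t" if w: "w \<in> W" for w t
  proof -
    let ?z = "G w t"
    have z: "cp ?z = \<sigma>" "?z \<noteq> 0" using Gp[OF w] G0[OF w] by auto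
    have "cp (sgn ?z) = inverse (norm ?z) * \<sigma>" using linear_cmul[OF linp] z by (simp add: sgn_div_norm)
    then have "\<sigma> * cp (sgn ?z) = inverse (norm ?z)" using \<sigma>(1) by (simp add: mult.left_commute)
    then have us: "u (sgn ?z) = ?z" using z(2) by (simp add: u_def sgn_div_norm)
    then show \<tau>: "\<tau> (sgn ?z) = t" using Gq[OF w, of t] \<sigma>(1) by (simp add: \<tau>_def mult.left_commute)
    show "f (sgn ?z) = w"
      unfolding f_def us \<tau> by (simp add: G_def flow_flow[OF e p(1)] flow_zero[OF e p(1)])
  qed
  have wallG: "sgn (G w t) \<in> U \<longleftrightarrow> G w t \<in> ?C \<and> G w t \<in> ?C'" if w: "w \<in> W" for w t
  proof -
    have "\<sigma> * cp (sgn (G w t)) = inverse (norm (G w t))"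
      using linear_cmul[OF linp] Gp[OF w] \<sigma>(1) by (simp add: sgn_div_norm)
    then have "0 < \<sigma> * cp (sgn (G w t))" using G0[OF w] by simp
    then show ?thesis
      using G0[OF w] by (simp add: U_def wall_def sgn_closed_half_iff[OF e] sgn_closed_half_iff[OF e'] norm_sgn)
  qed
  have contf: "continuous_on U f"
  proof -
    have "\<forall>v\<in>U. \<sigma> * cp v \<noteq> 0" by (auto simp: U_def)
    then have cu: "continuous_on U u" unfolding u_def by (intro continuous_intros contp) auto
    have ct: "continuous_on U \<tau>"
      unfolding \<tau>_def by (intro continuous_intros continuous_on_compose2[OF contq[of UNIV] cu]) auto
    have "continuous_on U (\<lambda>v. flow e p (- \<tau> v) (u v))"
      by (rule continuous_on_compose2[OF continuous_flow[OF e p(1), of UNIV], of _ "\<lambda>v. (- \<tau> v, u v)", simplified])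
        (intro continuous_intros cu ct)
    then show ?thesis unfolding f_def by (intro continuous_intros)
  qed
  have inj: "inj_on f U"
  proof (rule inj_onI)
    fix v v' assume v: "v \<in> U" "v' \<in> U" "f v = f v'"
    let ?w = "f v"
    have w: "?w \<in> W" using fW[OF v(1)] .
    have g: "sgn (G ?w (\<tau> v)) = v" unfolding Gf by (rule sgn_u[OF v(1)])
    have g': "sgn (G ?w (\<tau> v')) = v'" unfolding v(3) Gf by (rule sgn_u[OF v(2)])
    have c: "G ?w (\<tau> v) \<in> ?C" "G ?w (\<tau> v) \<in> ?C'" "G ?w (\<tau> v') \<in> ?C" "G ?w (\<tau> v') \<in> ?C'"
      using wallG[OF w, of "\<tau> v"] wallG[OF w, of "\<tau> v'"] v(1,2) unfolding g g' by simp_all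
    have "cp (?w + ?b) = \<sigma>" using Gp[OF w, of 0] unfolding G_def flow_zero[OF e p(1)] .
    then have nz: "coordinates e (?w + ?b) ! p \<noteq> 0" using \<sigma>(2) by (simp add: cp_def)
    have "\<tau> v = \<tau> v'" by (rule flow_crossing_unique[OF n e p(1) nz c[unfolded G_def]])
    then have "sgn (G ?w (\<tau> v)) = sgn (G ?w (\<tau> v'))" by (rule arg_cong)
    then show "v = v'" unfolding g g' .
  qed
  have open_map: "openin (top_of_set W) (f ` T)" if T: "openin (top_of_set U) T" for T
    unfolding openin_contains_ball
  proof (intro conjI ballI)
    have TU: "T \<subseteq> U" using T openin_imp_subset by blast
    show "f ` T \<subseteq> W" using fW TU by blast
    obtain O1 where O1: "open O1" "T = U \<inter> O1" using T by (auto simp: openin_open)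
    fix w0 assume "w0 \<in> f ` T"
    then obtain x0 where x0: "x0 \<in> T" "w0 = f x0" by blast
    have x0U: "x0 \<in> U" "x0 \<in> O1" using x0 O1 by auto
    have w0: "w0 \<in> W" using fW x0U x0 by simp
    define t0 where "t0 = \<tau> x0"
    have g0: "sgn (G w0 t0) = x0" using Gf[of x0] sgn_u[OF x0U(1)] by (simp add: x0(2) t0_def)
    have C0: "G w0 t0 \<in> ?C" "G w0 t0 \<in> ?C'" using wallG[OF w0, of t0] g0 x0U by simp_all
    have nz0: "coordinates e (G w0 t0) ! p \<noteq> 0" using Gp[OF w0] \<sigma> by (simp add: cp_def)
    define O2 where "O2 = sgn -` O1 \<inter> - {0 :: real ^ 'n::{finite,linorder}}"
    have "continuous_on (- {0 :: real ^ 'n::{finite,linorder}}) sgn" by (intro continuous_intros) auto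
    then have "open (- {0} \<inter> sgn -` O1)" by (rule continuous_open_preimage[OF _ _ O1(1)]) auto
    then have O2: "open O2" unfolding O2_def by (simp only: Int_commute)
    have "open ((\<lambda>z. G (fst z) (snd z)) -` O2)" using open_vimage[OF O2 contG] .
    moreover have "(w0, t0) \<in> (\<lambda>z. G (fst z) (snd z)) -` O2" using G0[OF w0] g0 x0U by (simp add: O2_def)
    ultimately obtain A B where AB: "open A" "open B" "w0 \<in> A" "t0 \<in> B" "A \<times> B \<subseteq> (\<lambda>z. G (fst z) (snd z)) -` O2"
      by (elim open_prod_elim) auto
    obtain \<epsilon> where \<epsilon>: "\<epsilon> > 0" "ball t0 \<epsilon> \<subseteq> B" using AB(2,4) open_contains_ball by blast
    have "eventually (\<lambda>s. s < \<epsilon>) (at_right (0::real))" using \<epsilon>(1) by (auto simp: eventually_at_right_field)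
    moreover have "eventually (\<lambda>s. 0 < s) (at_right (0::real))" by (auto simp: eventually_at_right_field intro: exI[of _ 1])
    moreover have "eventually (\<lambda>s. flow e p s (G w0 t0) \<notin> ?C') (at_right 0)"
      by (rule flow_enters[OF e p(1) n nz0 C0(1)])
    moreover have "eventually (\<lambda>s. flow e p (- s) (G w0 t0) \<notin> ?C) (at_right 0)"
      by (rule flow_exits[OF n e p(1) nz0 C0(2)])
    ultimately have "eventually (\<lambda>s. s < \<epsilon> \<and> 0 < s \<and> flow e p s (G w0 t0) \<notin> ?C' \<and> flow e p (- s) (G w0 t0) \<notin> ?C) (at_right 0)"
      by eventually_elim simp
    then obtain \<eta> where \<eta>: "0 < \<eta>" "\<eta> < \<epsilon>" "flow e p \<eta> (G w0 t0) \<notin> ?C'" "flow e p (- \<eta>) (G w0 t0) \<notin> ?C"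
      using eventually_happens'[OF trivial_limit_at_right_real] by blast
    have contw: "continuous_on UNIV (\<lambda>w. G w t)" for t
      by (rule continuous_on_compose2[OF contG, of _ "\<lambda>w. (w, t)", simplified]) (intro continuous_intros)
    have contt: "continuous_on S (\<lambda>t. G w t)" for w S
      unfolding G_def by (rule continuous_flow_time[OF e p(1)])
    define A' where "A' = A \<inter> ((\<lambda>w. G w (t0 + \<eta>)) -` (- ?C') \<inter> (\<lambda>w. G w (t0 - \<eta>)) -` (- ?C))"
    have "open A'"
      unfolding A'_def
      by (intro open_Int AB(1) open_vimage contw open_Compl closed_closed_half[OF e] closed_closed_half[OF e'])
    moreover have "w0 \<in> A'" using AB(3) \<eta> GG[of w0 t0 \<eta>] GG[of w0 t0 "- \<eta>"] by (simp add: A'_def)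
    ultimately obtain \<delta> where \<delta>: "\<delta> > 0" "ball w0 \<delta> \<subseteq> A'" using open_contains_ball by blast
    show "\<exists>\<delta>>0. ball w0 \<delta> \<inter> W \<subseteq> f ` T"
    proof (intro exI conjI subsetI)
      fix w assume w: "w \<in> ball w0 \<delta> \<inter> W"
      then have wA: "w \<in> A" "G w (t0 + \<eta>) \<notin> ?C'" "G w (t0 - \<eta>) \<notin> ?C" and wW: "w \<in> W"
        using \<delta>(2) by (auto simp: A'_def)
      let ?I = "{t0 - \<eta>..t0 + \<eta>}"
      have cl: "closed (?I \<inter> (\<lambda>t. G w t) -` ?C)" "closed (?I \<inter> (\<lambda>t. G w t) -` ?C')"
        using continuous_closed_preimage[OF contt closed_atLeastAtMost closed_closed_half[OF e]]
          continuous_closed_preimage[OF contt closed_atLeastAtMost closed_closed_half[OF e']] by blast+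
      \<comment> \<open>The orbit of \<open>w\<close> is on different sides at the ends of the interval, so it meets the wall.\<close>
      have "\<exists>t\<in>?I. G w t \<in> ?C \<and> G w t \<in> ?C'"
      proof (rule ccontr)
        assume "\<not> ?thesis"
        then have 1: "?I \<inter> (\<lambda>t. G w t) -` ?C \<inter> (?I \<inter> (\<lambda>t. G w t) -` ?C') \<inter> ?I = {}" by auto
        have 2: "?I \<subseteq> (?I \<inter> (\<lambda>t. G w t) -` ?C) \<union> (?I \<inter> (\<lambda>t. G w t) -` ?C')"
          using closed_half_cover[OF n e] by auto
        have 3: "t0 + \<eta> \<in> ?I \<inter> (\<lambda>t. G w t) -` ?C" "t0 - \<eta> \<in> ?I \<inter> (\<lambda>t. G w t) -` ?C'"
          using wA(2,3) closed_half_cover[OF n e] \<eta>(1) by auto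
        have "connected ?I" by simp
        from connected_closedD[OF this 1 2 cl] show False using 3 by blast
      qed
      then obtain t where t: "t \<in> ?I" "G w t \<in> ?C" "G w t \<in> ?C'" by blast
      have "t \<in> ball t0 \<epsilon>" using t(1) \<eta> by (auto simp: dist_real_def)
      then have "(w, t) \<in> A \<times> B" using \<epsilon>(2) wA(1) by blast
      then have "G w t \<in> O2" using AB(5) by auto
      then have "sgn (G w t) \<in> T" using wallG[OF wW, of t] t O1(2) by (simp add: O2_def)
      then show "w \<in> f ` T" using fG(1)[OF wW, of t] by (metis image_eqI)
    qed (rule \<delta>(1))
  qed
  have "openin (top_of_set W) (f ` U)" by (rule open_map) simp
  moreover have "U homeomorphic f ` U"
  proof -
    have "openin (top_of_set (f ` U)) (f ` T)" if T: "openin (top_of_set U) T" for T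
      by (rule openin_subset_trans[OF open_map[OF T]]) (use openin_imp_subset[OF T] fW in blast)+
    then obtain g where "homeomorphism U (f ` U) f g"
      using homeomorphism_injective_open_map[OF contf refl inj] by blast
    then show ?thesis by (auto simp: homeomorphic_def)
  qed
  ultimately show "\<exists>U. \<exists>W :: (real ^ 'n::{finite,linorder}) set. \<exists>V. x \<in> U \<and> openin (top_of_set (wall k e)) U \<and>
        subspace W \<and> dim W = CARD('n) - 2 \<and> openin (top_of_set W) V \<and> U homeomorphic V"
    using xU opinU subW dimW by blast
qed

text \<open>A vector of the wall admits a low pattern \<open>s\<close> and a pattern \<open>s'\<close> that is not low. They differ at
  some index, where the coordinate must vanish.\<close>

lemma polyhedral_hypersurface_wall:
  fixes e :: "(real ^ 'n::{finite,linorder}) list"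
  assumes n: "CARD('n) = 4 * k + 3" and e: "e \<in> ordered_bases UNIV"
  shows "polyhedral_hypersurface (wall k e)"
proof -
  let ?n = "CARD('n)"
  let ?S = "{s. set s \<subseteq> {-1, 1 :: real} \<and> length s = ?n}"
  have lc: "length (coordinates e v) = ?n" for v
    using e ordered_bases_UNIV_iff by (auto simp: coordinates_def)
  have "\<exists>a. \<forall>v. coordinates e v ! i = a \<bullet> v" if "i < ?n" for i
  proof -
    note lin = linear_coordinates[OF e that]
    have "coordinates e v ! i = (\<Sum>b\<in>Basis. coordinates e b ! i *\<^sub>R b) \<bullet> v" for v
    proof -
      have "coordinates e v ! i = coordinates e (\<Sum>b\<in>Basis. (v \<bullet> b) *\<^sub>R b) ! i" by (simp add: euclidean_representation)
      also have "\<dots> = (\<Sum>b\<in>Basis. (v \<bullet> b) * coordinates e b ! i)"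
        by (simp add: linear_sum[OF lin] linear_cmul[OF lin])
      also have "\<dots> = (\<Sum>b\<in>Basis. coordinates e b ! i *\<^sub>R b) \<bullet> v"
        by (simp add: inner_sum_left) (simp add: inner_commute mult.commute)
      finally show ?thesis .
    qed
    then show ?thesis by blast
  qed
  then obtain a where a: "\<And>i v. i < ?n \<Longrightarrow> coordinates e v ! i = a i \<bullet> v" by metis
  define \<C> where "\<C> s s' = {v. \<forall>i<?n. 0 \<le> coordinates e v ! i * s ! i \<and> 0 \<le> coordinates e v ! i * s' ! i}" for s s'
  let ?F = "{\<C> s s' | s s'. s \<in> ?S \<and> s' \<in> ?S \<and> low_variation k s \<and> \<not> low_variation k s'}"
  have fin: "finite ?F"
  proof (rule finite_subset)
    show "?F \<subseteq> (\<lambda>(s, s'). \<C> s s') ` (?S \<times> ?S)" by auto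
    show "finite ((\<lambda>(s, s'). \<C> s s') ` (?S \<times> ?S))"
      using finite_lists_length_eq[of "{-1, 1 :: real}" ?n] by (intro finite_imageI finite_cartesian_product) auto
  qed
  have each: "polyhedron C \<and> cone C \<and> (\<exists>a. a \<noteq> 0 \<and> C \<subseteq> {x. a \<bullet> x = 0})" if "C \<in> ?F" for C
  proof -
    obtain s s' where C: "C = \<C> s s'" and s: "s \<in> ?S" "s' \<in> ?S" "low_variation k s" "\<not> low_variation k s'"
      using \<open>C \<in> ?F\<close> by blast
    have "C = \<Inter> ((\<lambda>i. {v. (s ! i *\<^sub>R a i) \<bullet> v \<ge> 0} \<inter> {v. (s' ! i *\<^sub>R a i) \<bullet> v \<ge> 0}) ` {..<?n})"
      unfolding C \<C>_def by (auto simp: a mult.commute)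
    moreover have "polyhedron \<dots>"
    proof (rule polyhedron_Inter)
      have "polyhedron ({v. (s ! i *\<^sub>R a i) \<bullet> v \<ge> 0} \<inter> {v. (s' ! i *\<^sub>R a i) \<bullet> v \<ge> 0})" for i
        by (intro polyhedron_Int polyhedron_halfspace_ge)
      then show "polyhedron H" if "H \<in> (\<lambda>i. {v. (s ! i *\<^sub>R a i) \<bullet> v \<ge> 0} \<inter> {v. (s' ! i *\<^sub>R a i) \<bullet> v \<ge> 0}) ` {..<?n}" for H
        using that by blast
    qed simp
    ultimately have "polyhedron C" by simp
    moreover have "cone C"
      unfolding C \<C>_def cone_def by (auto simp: a mult.assoc mult_nonneg_nonneg)
    moreover have "\<exists>a. a \<noteq> 0 \<and> C \<subseteq> {x. a \<bullet> x = 0}"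
    proof -
      have "s \<noteq> s'" using s by auto
      then obtain i where i: "i < ?n" "s ! i \<noteq> s' ! i" using s(1,2) by (metis (mono_tags, lifting) mem_Collect_eq nth_equalityI)
      have "s ! i \<in> {-1, 1}" "s' ! i \<in> {-1, 1}" using s(1,2) i(1) sign_list_nth[of s i] sign_list_nth[of s' i] by (auto simp: sign_list_def)
      then have "a i \<bullet> v = 0" if "v \<in> C" for v
        using that i a[OF i(1), of v] unfolding C \<C>_def by force
      moreover have "a i \<noteq> 0"
      proof
        assume "a i = 0"
        then have z: "coordinates e v ! i = 0" for v using a[OF i(1), of v] by simp
        have "coordinates e (e ! i) ! i = 1" using coordinates_basis_vector[OF e i(1) i(1)] by simp
        then show False using z by simp
      qed
      ultimately show ?thesis by blast
    qed
    ultimately show ?thesis by blast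
  qed
  have mem: "v \<in> closed_half k e \<and> v \<in> closed_half k (alt_rev e) \<longleftrightarrow> v \<in> \<Union>?F" for v
  proof -
    have 1: "v \<in> closed_half k e \<longleftrightarrow> (\<exists>s\<in>?S. low_variation k s \<and> (\<forall>i<?n. 0 \<le> coordinates e v ! i * s ! i))"
      by (auto simp: closed_half_def sign_list_def)
    have 2: "v \<in> closed_half k (alt_rev e) \<longleftrightarrow> (\<exists>s\<in>?S. \<not> low_variation k s \<and> (\<forall>i<?n. 0 \<le> coordinates e v ! i * s ! i))"
    proof -
      have "s \<in> sign_assignments (coordinates e v) \<longleftrightarrow> s \<in> ?S \<and> (\<forall>i<?n. 0 \<le> coordinates e v ! i * s ! i)" for s
        by (simp add: sign_assignments_iff sign_list_def lc)
      then show ?thesis using not_closed_half_alt_rev_iff[OF n e, of v] by blast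
    qed
    show ?thesis unfolding 1 2 \<C>_def by blast
  qed
  have union: "wall k e = (\<Union>C\<in>?F. sgn ` (C - {0}))"
  proof (intro equalityI subsetI)
    fix v assume v: "v \<in> wall k e"
    then have "v \<in> \<Union>?F" "norm v = 1" using mem[of v] by (auto simp: wall_def)
    then obtain C where C: "C \<in> ?F" "v \<in> C" by blast
    have "v \<noteq> 0" "sgn v = v" using \<open>norm v = 1\<close> by (auto simp: sgn_div_norm)
    then have "v \<in> sgn ` (C - {0})" using C(2) by (metis Diff_iff image_eqI singletonD)
    then show "v \<in> (\<Union>C\<in>?F. sgn ` (C - {0}))" using C(1) by blast
  next
    fix v assume "v \<in> (\<Union>C\<in>?F. sgn ` (C - {0}))"
    then obtain C y where y: "C \<in> ?F" "y \<in> C" "y \<noteq> 0" "v = sgn y" by blast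
    then have "y \<in> \<Union>?F" by blast
    then have "y \<in> closed_half k e" "y \<in> closed_half k (alt_rev e)" using mem[of y] by auto
    then show "v \<in> wall k e"
      using y(3,4) sgn_closed_half_iff[OF e] sgn_closed_half_iff[OF alt_rev_ordered_bases[OF e]]
      by (simp add: wall_def norm_sgn)
  qed
  show ?thesis
    unfolding polyhedral_hypersurface_def
    by (intro conjI hypersurface_wall[OF assms] exI[of _ ?F] ballI fin union) (use each in blast)+
qed

section \<open>Cyclic order of the endpoints\<close>

text \<open>The oriented area, whose sign gives the cyclic order of lines in the plane.\<close>

definition area :: "real ^ 2 \<Rightarrow> real ^ 2 \<Rightarrow> real" where
  "area u v = Determinants.det (vector [u, v] :: real ^ 2 ^ 2)"

lemma area_eq: "area u v = u $ 1 * v $ 2 - u $ 2 * v $ 1"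
  by (simp add: area_def Determinants.det_2)

lemma positively_ordered_iff:
  "positively_ordered x y z \<longleftrightarrow>
     (\<exists>u v w. x = span {u} \<and> y = span {v} \<and> z = span {w} \<and> area u v * area v w * area w u > 0)"
  by (simp add: positively_ordered_def area_def)

lemma span_singleton_scale: "c \<noteq> 0 \<Longrightarrow> span {c *\<^sub>R w} = span {w}"
  for w :: "'a::real_vector"
proof (rule span_eq[THEN iffD2], intro conjI)
  assume c: "c \<noteq> 0"
  show "{c *\<^sub>R w} \<subseteq> span {w}" by (simp add: span_base span_scale)
  have "(1 / c) *\<^sub>R (c *\<^sub>R w) \<in> span {c *\<^sub>R w}" by (intro span_scale span_base) simp
  then show "{w} \<subseteq> span {c *\<^sub>R w}" using c by simp
qed

lemma area_nonzero:
  assumes "u \<noteq> 0" "w \<noteq> 0" "span {u} \<noteq> span {w}"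
  shows "area u w \<noteq> 0"
proof
  assume z: "area u w = 0"
  have "\<exists>c. u = c *\<^sub>R w"
  proof (cases "w $ 1 = 0")
    case True
    then have "w $ 2 \<noteq> 0" using assms(2) by (auto simp: Finite_Cartesian_Product.vec_eq_iff forall_2)
    then show ?thesis using z True
      by (intro exI[of _ "u $ 2 / w $ 2"]) (auto simp: Finite_Cartesian_Product.vec_eq_iff forall_2 area_eq)
  next
    case False
    then show ?thesis using z
      by (intro exI[of _ "u $ 1 / w $ 1"]) (auto simp: Finite_Cartesian_Product.vec_eq_iff forall_2 area_eq field_simps)
  qed
  then obtain c where "u = c *\<^sub>R w" by blast
  then show False using span_singleton_scale[of c w] assms by (cases "c = 0") auto
qed

lemma topspace_RP1: "topspace RP1_topology = RP1"
proof (rule subset_antisym)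
  show "topspace RP1_topology \<subseteq> RP1"
    using openin_topspace[of RP1_topology] unfolding openin_RP1_topology by (rule conjunct1)
  have "{v :: real ^ 2. v \<noteq> 0 \<and> span {v} \<in> RP1} = - {0}" by (auto simp: RP1_def)
  then have "openin RP1_topology RP1" by (simp add: openin_RP1_topology open_Compl)
  then show "RP1 \<subseteq> topspace RP1_topology" by (rule openin_subset)
qed

lemma arc_subset: "arc a b \<subseteq> RP1"
proof
  fix x assume "x \<in> arc a b"
  then obtain u v w where "x = span {v}" "area u v * area v w * area w u > 0"
    by (auto simp: arc_def positively_ordered_iff)
  moreover then have "v \<noteq> 0" by (auto simp: area_eq)
  ultimately show "x \<in> RP1" by (auto simp: RP1_def)
qed

text \<open>The sign of \<open>\<epsilon>\<close> is free, so the perturbed line can be placed on either side of \<open>span {u}\<close>.\<close>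

lemma small_perturbation_in_open:
  fixes u w :: "real ^ 2"
  assumes T: "openin RP1_topology T" "span {u} \<in> T" "u \<noteq> 0" and d: "d \<noteq> 0"
  shows "\<exists>\<epsilon>. \<epsilon> * d < 0 \<and> span {u + \<epsilon> *\<^sub>R w} \<in> T"
proof -
  let ?V = "{v. v \<noteq> 0 \<and> span {v} \<in> T}"
  have "open ?V" "u \<in> ?V" using T by (auto simp: openin_RP1_topology)
  then obtain r where r: "r > 0" "ball u r \<subseteq> ?V" using open_contains_ball by blast
  define \<delta> where "\<delta> = r / (2 * (norm w + 1))"
  have nw: "norm w + 1 > 0" using norm_ge_zero[of w] by linarith
  have \<delta>: "\<delta> > 0" using r nw by (simp add: \<delta>_def)
  have "\<delta> * norm w < r"
  proof -
    have "\<delta> * norm w \<le> \<delta> * (norm w + 1)" using \<delta> by simp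
    also have "\<dots> = r / 2" using nw by (simp add: \<delta>_def field_simps)
    finally show ?thesis using r(1) by linarith
  qed
  moreover define \<epsilon> where "\<epsilon> = - \<delta> * sgn d"
  have "\<bar>\<epsilon>\<bar> = \<delta>" using d \<delta> by (auto simp: \<epsilon>_def sgn_if)
  ultimately have "u + \<epsilon> *\<^sub>R w \<in> ball u r" by (simp add: dist_norm)
  then have "span {u + \<epsilon> *\<^sub>R w} \<in> T" using r(2) by blast
  moreover have "\<epsilon> * d = - (\<delta> * \<bar>d\<bar>)" by (simp add: \<epsilon>_def abs_sgn mult.commute)
  then have "\<epsilon> * d < 0" using d \<delta> by simp
  ultimately show ?thesis by blast
qed

text \<open>Adding a small multiple of one endpoint to the other gives lines in the arc, if the sign is chosen
  suitably.\<close>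

lemma endpoints_in_closure_arc:
  assumes "a \<in> RP1" "b \<in> RP1" "a \<noteq> b"
  shows "a \<in> RP1_topology closure_of arc a b" "b \<in> RP1_topology closure_of arc a b"
proof -
  obtain u where u: "a = span {u}" "u \<noteq> 0" using assms(1) by (auto simp: RP1_def)
  obtain w where w: "b = span {w}" "w \<noteq> 0" using assms(2) by (auto simp: RP1_def)
  let ?d = "area u w"
  have d: "?d \<noteq> 0" using area_nonzero u w assms(3) by auto
  have ord: "positively_ordered a (span {v}) b" if "area u v * area v w * area w u > 0" for v
    using that u w by (auto simp: positively_ordered_iff)
  have dd: "0 < ?d * ?d" using d by (metis power2_eq_square zero_less_power2)
  have neg: "- \<epsilon> * ?d * (?d * ?d) > 0" if "\<epsilon> * ?d < 0" for \<epsilon>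
  proof -
    have "0 < - (\<epsilon> * ?d) * (?d * ?d)"
      by (rule mult_pos_pos) (use that dd in auto)
    then show ?thesis by simp
  qed
  show "a \<in> RP1_topology closure_of arc a b"
    unfolding in_closure_of topspace_RP1
  proof (intro conjI allI impI assms(1))
    fix T assume "a \<in> T \<and> openin RP1_topology T"
    then obtain \<epsilon> where \<epsilon>: "\<epsilon> * ?d < 0" "span {u + \<epsilon> *\<^sub>R w} \<in> T"
      using small_perturbation_in_open[of T u ?d w] u d by blast
    have "area u (u + \<epsilon> *\<^sub>R w) * area (u + \<epsilon> *\<^sub>R w) w * area w u = - \<epsilon> * ?d * (?d * ?d)"
      by (simp add: area_eq algebra_simps)
    then show "\<exists>y. y \<in> arc a b \<and> y \<in> T" using ord[of "u + \<epsilon> *\<^sub>R w"] neg[OF \<epsilon>(1)] \<epsilon>(2) by (auto simp: arc_def)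
  qed
  show "b \<in> RP1_topology closure_of arc a b"
    unfolding in_closure_of topspace_RP1
  proof (intro conjI allI impI assms(2))
    fix T assume "b \<in> T \<and> openin RP1_topology T"
    then obtain \<epsilon> where \<epsilon>: "\<epsilon> * ?d < 0" "span {w + \<epsilon> *\<^sub>R u} \<in> T"
      using small_perturbation_in_open[of T w ?d u] w d by blast
    have "area u (w + \<epsilon> *\<^sub>R u) * area (w + \<epsilon> *\<^sub>R u) w * area w u = - \<epsilon> * ?d * (?d * ?d)"
      by (simp add: area_eq algebra_simps)
    then show "\<exists>y. y \<in> arc a b \<and> y \<in> T" using ord[of "w + \<epsilon> *\<^sub>R u"] neg[OF \<epsilon>(1)] \<epsilon>(2) by (auto simp: arc_def)
  qed
qed

text \<open>Three distinct lines have a nonzero product of areas, and an exchange of two lines changes its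
  sign.\<close>

lemma positively_ordered_swap:
  assumes "x \<in> RP1" "y \<in> RP1" "z \<in> RP1" "x \<noteq> y" "y \<noteq> z" "x \<noteq> z" "\<not> positively_ordered x y z"
  shows "positively_ordered y x z"
proof -
  obtain u v w where u: "x = span {u}" "u \<noteq> 0" and v: "y = span {v}" "v \<noteq> 0" and w: "z = span {w}" "w \<noteq> 0"
    using assms(1-3) by (auto simp: RP1_def)
  have "area u v * area v w * area w u \<noteq> 0" using area_nonzero u v w assms(4-6) by auto
  moreover have "\<not> area u v * area v w * area w u > 0" using assms(7) u v w by (auto simp: positively_ordered_iff)
  ultimately have "area u v * area v w * area w u < 0" by linarith
  moreover have "area v u * area u w * area w v = - (area u v * area v w * area w u)"
    by (simp add: area_eq algebra_simps)
  ultimately have "area v u * area u w * area w v > 0" by linarith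
  then show ?thesis using u v w by (auto simp: positively_ordered_iff)
qed

text \<open>An endpoint of one interval lies outside the closure of the other interval.\<close>

lemma schottky_intervals_ordered:
  assumes S: "schottky_intervals g A a b" and ij: "i < g" "j < g" "(i, s) \<noteq> (j, t)"
  shows "positively_ordered (a i s) (a j t) (b j t)"
proof -
  have P: "a i s \<in> RP1" "b i s \<in> RP1" "a i s \<noteq> b i s" "a j t \<in> RP1" "b j t \<in> RP1" "a j t \<noteq> b j t"
    using S ij by (auto simp: schottky_intervals_def)
  have disj: "(RP1_topology closure_of arc (a i s) (b i s)) \<inter> (RP1_topology closure_of arc (a j t) (b j t)) = {}"
    by (rule S[unfolded schottky_intervals_def, THEN conjunct2, THEN conjunct2, THEN conjunct1, rule_format, OF ij])
  have cl: "a i s \<in> RP1_topology closure_of arc (a i s) (b i s)"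
    "a j t \<in> RP1_topology closure_of arc (a j t) (b j t)" "b j t \<in> RP1_topology closure_of arc (a j t) (b j t)"
    using endpoints_in_closure_arc P by blast+
  have out: "a i s \<notin> RP1_topology closure_of arc (a j t) (b j t)" using cl(1) disj by blast
  then have "a i s \<notin> arc (a j t) (b j t)"
    using closure_of_subset[of "arc (a j t) (b j t)" RP1_topology] arc_subset topspace_RP1 by blast
  then have "\<not> positively_ordered (a j t) (a i s) (b j t)" by (simp add: arc_def)
  moreover have "a i s \<noteq> a j t" "a i s \<noteq> b j t" using out cl by auto
  ultimately show ?thesis using positively_ordered_swap[of "a j t" "a i s" "b j t"] P by auto
qed

section \<open>The free group of reduced words\<close>

definition inv_letter :: "nat \<times> bool \<Rightarrow> nat \<times> bool" where
  "inv_letter x = (fst x, \<not> snd x)"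

lemma inv_letter_inv_letter [simp]: "inv_letter (inv_letter x) = x"
  by (simp add: inv_letter_def)

definition reduced :: "(nat \<times> bool) list \<Rightarrow> bool" where
  "reduced = successively (\<lambda>x y. \<not> (fst x = fst y \<and> snd x \<noteq> snd y))"

lemma cancels_iff: "fst x = fst y \<and> snd x \<noteq> snd y \<longleftrightarrow> y = inv_letter x"
  by (cases x; cases y) (auto simp: inv_letter_def)

lemma reduced_simps [simp]:
  "reduced []" "reduced [x]" "reduced (x # y # w) \<longleftrightarrow> y \<noteq> inv_letter x \<and> reduced (y # w)"
  unfolding reduced_def cancels_iff by simp_all

lemma reduced_ConsD: "reduced (x # w) \<Longrightarrow> reduced w"
  by (cases w) auto

lemma cancel_cons_Cons: "cancel_cons x (y # w) = (if y = inv_letter x then w else x # y # w)"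
  by (simp flip: cancels_iff)

declare cancel_cons.simps(2) [simp del]

lemma reduced_cancel_cons: "reduced w \<Longrightarrow> reduced (cancel_cons x w)"
  by (cases w) (auto simp: cancel_cons_Cons dest: reduced_ConsD)

text \<open>Every letter acts on reduced words by a permutation, with the inverse letter acting as its
  inverse. This gives associativity.\<close>

lemma cancel_cons_inv:
  assumes "reduced w"
  shows "cancel_cons (inv_letter x) (cancel_cons x w) = w"
proof (cases w)
  case (Cons y ys)
  show ?thesis
  proof (cases "y = inv_letter x")
    case True
    then have "cancel_cons x w = ys" using Cons by (simp add: cancel_cons_Cons)
    moreover have "cancel_cons y ys = y # ys" using assms Cons by (cases ys) (auto simp: cancel_cons_Cons)
    ultimately show ?thesis using True Cons by simp
  qed (use Cons in \<open>simp add: cancel_cons_Cons\<close>)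
qed (simp add: cancel_cons_Cons)

lemma reduced_foldr: "reduced w \<Longrightarrow> reduced (foldr cancel_cons u w)"
  by (induction u) (simp_all add: reduced_cancel_cons)

lemma foldr_cancel_cons:
  assumes "reduced w"
  shows "foldr cancel_cons (cancel_cons x v) w = cancel_cons x (foldr cancel_cons v w)"
proof (cases v)
  case (Cons y ys)
  show ?thesis
  proof (cases "y = inv_letter x")
    case True
    then show ?thesis
      using Cons cancel_cons_inv[OF reduced_foldr[OF assms], of y ys] by (simp add: cancel_cons_Cons)
  qed (use Cons in \<open>simp add: cancel_cons_Cons\<close>)
qed simp

lemma foldr_assoc:
  assumes "reduced w"
  shows "foldr cancel_cons (foldr cancel_cons u v) w = foldr cancel_cons u (foldr cancel_cons v w)"
  by (induction u) (simp_all add: foldr_cancel_cons reduced_foldr assms)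

lemma set_cancel_cons: "set (cancel_cons x w) \<subseteq> insert x (set w)"
  by (cases w) (auto simp: cancel_cons_Cons)

lemma set_foldr_cancel_cons: "set (foldr cancel_cons u w) \<subseteq> set u \<union> set w"
proof (induction u)
  case (Cons x u)
  then show ?case using set_cancel_cons[of x "foldr cancel_cons u w"] by auto
qed simp

lemma carrier_free_group: "w \<in> carrier (free_group g) \<longleftrightarrow> set w \<subseteq> {..<g} \<times> UNIV \<and> reduced w"
  by (simp add: free_group_def reduced_def)

lemma mult_free_group: "u \<otimes>\<^bsub>free_group g\<^esub> v = foldr cancel_cons u v"
  by (simp add: free_group_def)

lemma one_free_group: "\<one>\<^bsub>free_group g\<^esub> = []"
  by (simp add: free_group_def)

lemma foldr_inverse: "reduced u \<Longrightarrow> foldr cancel_cons (rev (map inv_letter u)) u = []"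
proof (induction u)
  case (Cons x u)
  have "cancel_cons (inv_letter x) (x # u) = u" by (simp add: cancel_cons_Cons)
  then show ?case using Cons reduced_ConsD by simp
qed simp

lemma group_free_group: "group (free_group g)"
proof (rule groupI)
  fix x y z
  assume x: "x \<in> carrier (free_group g)" and y: "y \<in> carrier (free_group g)"
  show "x \<otimes>\<^bsub>free_group g\<^esub> y \<in> carrier (free_group g)"
    using x y set_foldr_cancel_cons[of x y] reduced_foldr[of y x] unfolding carrier_free_group mult_free_group by blast
  show "\<one>\<^bsub>free_group g\<^esub> \<otimes>\<^bsub>free_group g\<^esub> x = x" by (simp add: mult_free_group one_free_group)
  show "x \<otimes>\<^bsub>free_group g\<^esub> y \<otimes>\<^bsub>free_group g\<^esub> z = x \<otimes>\<^bsub>free_group g\<^esub> (y \<otimes>\<^bsub>free_group g\<^esub> z)"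
    if "z \<in> carrier (free_group g)"
    using y that by (simp add: mult_free_group carrier_free_group foldr_assoc)
  have "reduced (rev (map inv_letter x))"
    using x unfolding carrier_free_group reduced_def successively_rev successively_map
    by (auto simp: inv_letter_def elim!: successively_mono)
  moreover have "set (rev (map inv_letter x)) \<subseteq> {..<g} \<times> UNIV"
    using x by (auto simp: carrier_free_group inv_letter_def)
  ultimately show "\<exists>y\<in>carrier (free_group g). y \<otimes>\<^bsub>free_group g\<^esub> x = \<one>\<^bsub>free_group g\<^esub>"
    using foldr_inverse[of x] x unfolding carrier_free_group mult_free_group one_free_group
    by (intro bexI[of _ "rev (map inv_letter x)"]) (simp_all add: carrier_free_group)
qed (simp add: carrier_free_group one_free_group)

lemma Cons_free_group:
  assumes "s # w \<in> carrier (free_group g)"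
  shows "[s] \<in> carrier (free_group g)" "w \<in> carrier (free_group g)" "s # w = [s] \<otimes>\<^bsub>free_group g\<^esub> w"
    and "w = t # w' \<Longrightarrow> t \<noteq> inv_letter s"
proof -
  show "[s] \<in> carrier (free_group g)" "w \<in> carrier (free_group g)"
    using assms by (auto simp: carrier_free_group dest: reduced_ConsD)
  show "s # w = [s] \<otimes>\<^bsub>free_group g\<^esub> w"
    using assms unfolding mult_free_group by (cases w) (auto simp: carrier_free_group cancel_cons_Cons)
  show "w = t # w' \<Longrightarrow> t \<noteq> inv_letter s"
    using assms by (auto simp: carrier_free_group)
qed

section \<open>Ping-pong\<close>

lemma hom_SL_empty_word:
  assumes "\<rho> \<in> Group.hom (free_group g) SL"
  shows "\<rho> [] *v x = x"
proof -
  have nil: "[] \<in> carrier (free_group g)" by (simp add: carrier_free_group)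
  have "\<rho> ([] \<otimes>\<^bsub>free_group g\<^esub> []) = \<rho> [] ** \<rho> []" "Determinants.det (\<rho> []) = 1"
    using assms nil by (auto simp: hom_def SL_def Pi_def)
  then have "inj (\<lambda>x. \<rho> [] *v x)" "\<rho> [] *v (\<rho> [] *v x) = \<rho> [] *v x"
    by (auto intro!: inj_matrix_vector_mult
        simp: mult_free_group Determinants.invertible_det_nz matrix_vector_mul_assoc)
  then show ?thesis by (meson injD)
qed

text \<open>The letter \<open>s\<close> owns the closed half \<open>C s\<close>, and \<open>C' s\<close> is the complement of the corresponding open
  halfspace. The last hypothesis says that points common to both are adherent to the open
  halfspace.\<close>

locale ping_pong =
  fixes g :: nat and \<rho> :: "(nat \<times> bool) list \<Rightarrow> real ^ 'n::{finite,linorder} ^ 'n::{finite,linorder}"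
    and C C' :: "nat \<times> bool \<Rightarrow> (real ^ 'n::{finite,linorder}) set"
  assumes hom: "\<rho> \<in> Group.hom (free_group g) SL"
    and closed: "\<And>s. fst s < g \<Longrightarrow> closed (C s)" "\<And>s. fst s < g \<Longrightarrow> closed (C' s)"
    and cover: "\<And>s v. fst s < g \<Longrightarrow> v \<in> C s \<or> v \<in> C' s"
    and disjoint: "\<And>s t. fst s < g \<Longrightarrow> fst t < g \<Longrightarrow> s \<noteq> t \<Longrightarrow> C s \<inter> C t \<subseteq> {0}"
    and sgn_iff: "\<And>s v. fst s < g \<Longrightarrow> sgn v \<in> C s \<longleftrightarrow> v \<in> C s" "\<And>s v. fst s < g \<Longrightarrow> sgn v \<in> C' s \<longleftrightarrow> v \<in> C' s"
    and move: "\<And>s v. fst s < g \<Longrightarrow> \<rho> [s] *v v \<in> C s \<longleftrightarrow> v \<in> C' (inv_letter s)"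
    and adherent: "\<And>s x U. fst s < g \<Longrightarrow> x \<in> sphere 0 1 \<inter> C s \<inter> C' s \<Longrightarrow> open U \<Longrightarrow> x \<in> U \<Longrightarrow>
      \<exists>y \<in> sphere 0 1 \<inter> U. y \<notin> C' s"
begin

(* Quantifiers over letters are not to be split into those over the index and the exponent. *)
declare split_paired_All [simp del] split_paired_Ex [simp del]

definition P :: "(real ^ 'n::{finite,linorder}) set" where
  "P = {x \<in> sphere 0 1. \<forall>s. fst s < g \<longrightarrow> x \<in> C' s}"

definition D :: "(real ^ 'n::{finite,linorder}) set" where
  "D = (\<Union>\<gamma> \<in> carrier (free_group g). sphere_act (\<rho> \<gamma>) ` P)"

abbreviation act :: "(nat \<times> bool) list \<Rightarrow> real ^ 'n::{finite,linorder} \<Rightarrow> real ^ 'n::{finite,linorder}" where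
  "act w \<equiv> sphere_act (\<rho> w)"

lemma fst_inv_letter [simp]: "fst (inv_letter s) = fst s"
  by (simp add: inv_letter_def)

lemma letter_carrier: "[s] \<in> carrier (free_group g) \<longleftrightarrow> fst s < g"
  by (cases s) (auto simp: carrier_free_group)

lemma nil_carrier: "[] \<in> carrier (free_group g)"
  by (simp add: carrier_free_group)

lemma \<rho>_mult: "u \<in> carrier (free_group g) \<Longrightarrow> v \<in> carrier (free_group g) \<Longrightarrow>
    \<rho> (u \<otimes>\<^bsub>free_group g\<^esub> v) = \<rho> u ** \<rho> v"
  using hom by (simp add: hom_def SL_def)

lemma det_\<rho>: "u \<in> carrier (free_group g) \<Longrightarrow> Determinants.det (\<rho> u) = 1"
  using hom by (auto simp: hom_def SL_def Pi_def)

lemma inj_\<rho>: "u \<in> carrier (free_group g) \<Longrightarrow> inj (\<lambda>x. \<rho> u *v x)"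
  using det_\<rho> by (intro inj_matrix_vector_mult) (simp add: Determinants.invertible_det_nz)

lemma \<rho>_nonzero: "u \<in> carrier (free_group g) \<Longrightarrow> x \<noteq> 0 \<Longrightarrow> \<rho> u *v x \<noteq> 0"
  using inj_\<rho>[of u] by (metis injD matrix_vector_mult_0_right)

lemma \<rho>_nil: "\<rho> [] *v x = x"
  by (rule hom_SL_empty_word[OF hom])

lemma act_sphere: "u \<in> carrier (free_group g) \<Longrightarrow> x \<in> sphere 0 1 \<Longrightarrow> act u x \<in> sphere 0 1"
  using \<rho>_nonzero[of u x] by (cases "x = 0") (auto simp: sphere_act_def norm_sgn)

lemma act_mult:
  assumes "u \<in> carrier (free_group g)" "v \<in> carrier (free_group g)" "x \<in> sphere 0 1"
  shows "act (u \<otimes>\<^bsub>free_group g\<^esub> v) x = act u (act v x)"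
proof -
  have "x \<noteq> 0" using assms(3) by auto
  then have nz: "\<rho> v *v x \<noteq> 0" by (rule \<rho>_nonzero[OF assms(2)])
  have "\<rho> u *v sgn (\<rho> v *v x) = inverse (norm (\<rho> v *v x)) *\<^sub>R (\<rho> u *v (\<rho> v *v x))"
    by (simp add: sgn_div_norm matrix_vector_mult_scaleR)
  then show ?thesis
    using nz by (simp add: sphere_act_def \<rho>_mult[OF assms(1,2)] matrix_vector_mul_assoc sgn_scaleR)
qed

lemma act_nil: "x \<in> sphere 0 1 \<Longrightarrow> act [] x = x"
  by (simp add: sphere_act_def \<rho>_nil sgn_div_norm)

lemma inverse_letters: "fst s < g \<Longrightarrow> \<rho> [inv_letter s] *v (\<rho> [s] *v x) = x"
  using \<rho>_mult[of "[inv_letter s]" "[s]"] \<rho>_nil[of x]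
  by (simp add: letter_carrier mult_free_group matrix_vector_mul_assoc cancel_cons_Cons)

lemma move': "fst s < g \<Longrightarrow> \<rho> [s] *v v \<in> C' s \<longleftrightarrow> v \<in> C (inv_letter s)"
  using move[of "inv_letter s" "\<rho> [s] *v v"] inverse_letters[of s v] by simp

lemma act_C_iff: "fst s < g \<Longrightarrow> act [s] v \<in> C s \<longleftrightarrow> v \<in> C' (inv_letter s)"
  and act_C'_iff: "fst s < g \<Longrightarrow> act [s] v \<in> C' s \<longleftrightarrow> v \<in> C (inv_letter s)"
  by (simp_all add: sphere_act_def sgn_iff move move')

lemma P_sphere: "P \<subseteq> sphere 0 1"
  by (auto simp: P_def)

lemma C_avoids: "fst s < g \<Longrightarrow> fst t < g \<Longrightarrow> s \<noteq> t \<Longrightarrow> v \<in> C s \<Longrightarrow> v \<noteq> 0 \<Longrightarrow> v \<notin> C t \<and> v \<in> C' t"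
  using disjoint[of s t] cover[of t v] by blast

text \<open>The image under the remaining word lies in the half of its first letter, which is not the
  inverse of \<open>s\<close>. So it avoids the open halfspace of the inverse of \<open>s\<close>, and \<open>s\<close> moves it into \<open>C s\<close>.\<close>

lemma word_maps_into:
  assumes "s # w \<in> carrier (free_group g)" "x \<in> P"
  shows "act (s # w) x \<in> C s"
  using assms(1)
proof (induction w arbitrary: s)
  case Nil
  then have "fst s < g" by (simp add: letter_carrier)
  then show ?case using assms(2) by (simp add: act_C_iff P_def)
next
  case (Cons t w)
  note c = Cons_free_group[OF Cons.prems]
  have st: "fst s < g" "fst t < g" using c(1) Cons_free_group(1)[OF c(2)] letter_carrier by auto
  have xs: "x \<in> sphere 0 1" using assms(2) P_sphere by blast
  let ?v = "act (t # w) x"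
  have v: "?v \<in> C t" "?v \<noteq> 0" using Cons.IH[OF c(2)] act_sphere[OF c(2) xs] by auto
  have "?v \<in> C' (inv_letter s)" using C_avoids[of t "inv_letter s"] c(4)[OF refl] st v by auto
  then have "act [s] ?v \<in> C s" using st by (simp add: act_C_iff)
  then show ?case using act_mult[OF c(1,2) xs] c(3) by simp
qed

text \<open>After two letters the image lies in the open halfspace of \<open>s\<close>, as it avoids even the closed half
  of the inverse of \<open>s\<close> before the last step.\<close>

lemma long_word_leaves:
  assumes w: "s # t # w \<in> carrier (free_group g)" and x: "x \<in> P"
  shows "act (s # t # w) x \<notin> P"
proof -
  note c = Cons_free_group[OF w]
  have st: "fst s < g" "fst t < g" using c(1) Cons_free_group(1)[OF c(2)] letter_carrier by auto
  have xs: "x \<in> sphere 0 1" using x P_sphere by blast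
  let ?v = "act (t # w) x"
  have v: "?v \<in> C t" "?v \<noteq> 0" using word_maps_into[OF c(2) x] act_sphere[OF c(2) xs] by auto
  have "?v \<notin> C (inv_letter s)" using C_avoids[of t "inv_letter s"] c(4)[OF refl] st v by auto
  then have "act [s] ?v \<notin> C' s" using st by (simp add: act_C'_iff)
  moreover have "act (s # t # w) x = act [s] ?v" using act_mult[OF c(1,2) xs] unfolding c(3)[symmetric] .
  ultimately show ?thesis using st unfolding P_def by auto
qed

lemma finite_letters: "finite {s :: nat \<times> bool. fst s < g}"
proof -
  have "{s :: nat \<times> bool. fst s < g} = {..<g} \<times> UNIV" by auto
  then show ?thesis by simp
qed

lemma compact_P: "compact P"
proof -
  have "P = sphere 0 1 \<inter> (\<Inter>s\<in>{s. fst s < g}. C' s)" by (auto simp: P_def)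
  moreover have "closed (\<Inter>s\<in>{s. fst s < g}. C' s)" using closed(2) by (intro closed_INT) auto
  ultimately show ?thesis using compact_Int_closed[OF compact_sphere] by metis
qed

text \<open>The words that can return a point of \<open>P\<close> to \<open>P\<close>.\<close>

definition short :: "(nat \<times> bool) list set" where
  "short = insert [] ((\<lambda>s. [s]) ` {s. fst s < g})"

lemma finite_short: "finite short"
  using finite_letters by (simp add: short_def)

lemma short_carrier: "short \<subseteq> carrier (free_group g)"
  by (auto simp: short_def letter_carrier nil_carrier)

lemma returning_word_short: "w \<in> carrier (free_group g) \<Longrightarrow> x \<in> P \<Longrightarrow> act w x \<in> P \<Longrightarrow> w \<in> short"
proof -
  assume w: "w \<in> carrier (free_group g)" "x \<in> P" "act w x \<in> P"
  show ?thesis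
  proof (cases w)
    case (Cons s w')
    then show ?thesis
      using w long_word_leaves[of s _ _ x] Cons_free_group(1)[of s w'] by (cases w') (auto simp: short_def letter_carrier)
  qed (simp add: short_def)
qed

text \<open>At a point of the wall of \<open>s\<close> the complement of \<open>P\<close> is locally the open halfspace of \<open>s\<close>, and this
  is locally contained in the translate of \<open>P\<close> by \<open>s\<close>: the halves of the other letters are moved by
  \<open>s\<close> to closed sets away from the wall.\<close>

lemma neighbourhood:
  assumes x: "x \<in> P"
  shows "\<exists>U. open U \<and> x \<in> U \<and> U \<inter> sphere 0 1 \<subseteq> (\<Union>\<delta>\<in>short. act \<delta> ` P)"
proof -
  have xs: "x \<in> sphere 0 1" "x \<noteq> 0" using x P_sphere by auto
  have PP: "P \<subseteq> (\<Union>\<delta>\<in>short. act \<delta> ` P)"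
  proof
    fix y assume y: "y \<in> P"
    then have "act [] y = y" using act_nil P_sphere by blast
    then have "y \<in> act [] ` P" using y by force
    then show "y \<in> (\<Union>\<delta>\<in>short. act \<delta> ` P)" by (auto simp: short_def)
  qed
  show ?thesis
  proof (cases "\<exists>s. fst s < g \<and> x \<in> C s")
    case False
    let ?U = "- (\<Union>s\<in>{s. fst s < g}. C s)"
    have "open ?U" using closed(1) finite_letters by (intro open_Compl closed_UN) auto
    moreover have "?U \<inter> sphere 0 1 \<subseteq> P" using cover by (auto simp: P_def)
    ultimately show ?thesis using False PP by (intro exI[of _ ?U]) auto
  next
    case True
    then obtain s where s: "fst s < g" "x \<in> C s" by blast
    have xC': "x \<in> C' s" using x s by (simp add: P_def)
    let ?i = "inv_letter s"
    let ?pre = "\<lambda>t. (\<lambda>y. \<rho> [?i] *v y) -` C t"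
    let ?U = "- ((\<Union>t\<in>{t. fst t < g} - {s}. C t) \<union> (\<Union>t\<in>{t. fst t < g} - {?i}. ?pre t))"
    have clp: "closed (?pre t)" if "fst t < g" for t
      by (rule continuous_closed_vimage[OF closed(1)[OF that]])
        (simp add: linear_continuous_at linear_conv_bounded_linear[symmetric])
    have "open ?U" using closed(1) finite_letters clp by (intro open_Compl closed_Un closed_UN) auto
    moreover have "x \<in> ?U"
    proof -
      have "x \<notin> C t" if "fst t < g" "t \<noteq> s" for t using C_avoids[of s t x] that s xs by auto
      moreover have "\<rho> [?i] *v x \<notin> C t" if "fst t < g" "t \<noteq> ?i" for t
      proof -
        have "\<rho> [?i] *v x \<in> C ?i" using move[of ?i x] s xC' by simp
        moreover have "\<rho> [?i] *v x \<noteq> 0" using \<rho>_nonzero[of "[?i]"] letter_carrier s(1) xs by simp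
        ultimately show ?thesis using C_avoids[of ?i t] that s by auto
      qed
      ultimately show ?thesis by blast
    qed
    moreover have "?U \<inter> sphere 0 1 \<subseteq> (\<Union>\<delta>\<in>short. act \<delta> ` P)"
    proof
      fix y assume y: "y \<in> ?U \<inter> sphere 0 1"
      show "y \<in> (\<Union>\<delta>\<in>short. act \<delta> ` P)"
      proof (cases "y \<in> C' s")
        case True
        have "y \<in> C' t" if "fst t < g" for t
          using that y True cover[OF that, of y] by (cases "t = s") auto
        then have "y \<in> P" using y by (simp add: P_def)
        then show ?thesis using PP by blast
      next
        case False
        then have yC: "y \<in> C s" using cover[OF s(1)] by blast
        have si: "fst ?i < g" using s(1) by simp
        let ?z = "act [?i] y"
        have "?z \<in> C' t" if t: "fst t < g" for t
        proof (cases "t = ?i")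
          case True
          then show ?thesis using act_C'_iff[OF si, of y] yC by simp
        next
          case False
          then have "\<rho> [?i] *v y \<notin> C t" using y t by blast
          then show ?thesis using cover[OF t] sgn_iff[OF t] by (auto simp: sphere_act_def)
        qed
        moreover have "?z \<in> sphere 0 1" using act_sphere y letter_carrier si by blast
        ultimately have zP: "?z \<in> P" by (simp add: P_def)
        have c: "[s] \<in> carrier (free_group g)" "[?i] \<in> carrier (free_group g)" using letter_carrier s si by auto
        have "act [s] ?z = act ([s] \<otimes>\<^bsub>free_group g\<^esub> [?i]) y" using act_mult[OF c] y by simp
        also have "[s] \<otimes>\<^bsub>free_group g\<^esub> [?i] = []" by (simp add: mult_free_group cancel_cons_Cons)
        also have "act [] y = y" using act_nil y by blast
        finally have "y \<in> act [s] ` P" using zP by force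
        then show ?thesis using s(1) by (auto simp: short_def)
      qed
    qed
    ultimately show ?thesis by blast
  qed
qed

lemma P_subset_D: "P \<subseteq> D"
proof
  fix x assume "x \<in> P"
  moreover then have "act [] x = x" using act_nil P_sphere by blast
  ultimately show "x \<in> D" unfolding D_def using nil_carrier by (metis UN_I image_eqI)
qed

lemma translate_subset_D: "w \<in> carrier (free_group g) \<Longrightarrow> act w ` P \<subseteq> D"
  by (auto simp: D_def)

lemma D_sphere: "D \<subseteq> sphere 0 1"
  using act_sphere P_sphere by (force simp: D_def)

lemma cocompact_action: "cocompact (free_group g) \<rho> D"
  unfolding cocompact_def using compact_P P_subset_D D_def by blast

text \<open>The neighbourhoods of points of \<open>P\<close> are moved by the group.\<close>

lemma point_neighbourhood:
  assumes x: "x \<in> D"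
  shows "\<exists>V S. open V \<and> x \<in> V \<and> finite S \<and> S \<subseteq> carrier (free_group g) \<and>
    V \<inter> sphere 0 1 \<subseteq> (\<Union>\<alpha>\<in>S. act \<alpha> ` P)"
proof -
  interpret group "free_group g" by (rule group_free_group)
  obtain \<gamma> y where \<gamma>: "\<gamma> \<in> carrier (free_group g)" and y: "y \<in> P" "x = act \<gamma> y"
    using x by (auto simp: D_def)
  obtain U where U: "open U" "y \<in> U" "U \<inter> sphere 0 1 \<subseteq> (\<Union>\<delta>\<in>short. act \<delta> ` P)"
    using neighbourhood[OF y(1)] by blast
  have ys: "y \<in> sphere 0 1" using y P_sphere by blast
  have i: "inv\<^bsub>free_group g\<^esub> \<gamma> \<in> carrier (free_group g)" using \<gamma> by simp
  let ?h = "\<lambda>z. \<rho> (inv\<^bsub>free_group g\<^esub> \<gamma>) *v z"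
  have undo: "act \<gamma> (act (inv\<^bsub>free_group g\<^esub> \<gamma>) z) = z" "act (inv\<^bsub>free_group g\<^esub> \<gamma>) (act \<gamma> z) = z" if "z \<in> sphere 0 1" for z
    using act_mult[OF \<gamma> i that] act_mult[OF i \<gamma> that] act_nil[OF that] \<gamma> by (simp_all add: one_free_group)
  define V where "V = (\<lambda>z. act (inv\<^bsub>free_group g\<^esub> \<gamma>) z) -` U \<inter> - {0}"
  have "continuous_on (- {0}) (\<lambda>z. sgn (?h z))"
    by (rule continuous_on_sgn)
      (use \<rho>_nonzero[OF i] in \<open>auto intro!: linear_continuous_on simp: linear_conv_bounded_linear[symmetric]\<close>)
  then have "open (- {0} \<inter> (\<lambda>z. sgn (?h z)) -` U)"
    by (rule continuous_open_preimage) (use U in auto)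
  then have "open V" by (simp add: V_def sphere_act_def Int_commute)
  moreover have "x \<in> V" using U(2) y(2) undo(2)[OF ys] act_sphere[OF \<gamma> ys] by (auto simp: V_def)
  moreover have "V \<inter> sphere 0 1 \<subseteq> (\<Union>\<alpha>\<in>(\<lambda>\<delta>. \<gamma> \<otimes>\<^bsub>free_group g\<^esub> \<delta>) ` short. act \<alpha> ` P)"
  proof
    fix z assume z: "z \<in> V \<inter> sphere 0 1"
    then have "act (inv\<^bsub>free_group g\<^esub> \<gamma>) z \<in> U \<inter> sphere 0 1" using act_sphere[OF i] by (auto simp: V_def)
    then obtain \<delta> p where p: "\<delta> \<in> short" "p \<in> P" "act (inv\<^bsub>free_group g\<^esub> \<gamma>) z = act \<delta> p" using U(3) by blast
    have "z = act \<gamma> (act \<delta> p)" using undo(1)[of z] z p(3) by simp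
    also have "\<dots> = act (\<gamma> \<otimes>\<^bsub>free_group g\<^esub> \<delta>) p"
    proof (rule act_mult[OF \<gamma>, symmetric])
      show "\<delta> \<in> carrier (free_group g)" "p \<in> sphere 0 1" using p short_carrier P_sphere by blast+
    qed
    finally show "z \<in> (\<Union>\<alpha>\<in>(\<lambda>\<delta>. \<gamma> \<otimes>\<^bsub>free_group g\<^esub> \<delta>) ` short. act \<alpha> ` P)" using p by blast
  qed
  moreover have "finite ((\<lambda>\<delta>. \<gamma> \<otimes>\<^bsub>free_group g\<^esub> \<delta>) ` short)" using finite_short by simp
  moreover have "(\<lambda>\<delta>. \<gamma> \<otimes>\<^bsub>free_group g\<^esub> \<delta>) ` short \<subseteq> carrier (free_group g)"
    using \<gamma> short_carrier by auto
  ultimately show ?thesis by blast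
qed

text \<open>A compact set is covered by finitely many translates of \<open>P\<close>. If \<open>\<gamma>\<close> moves a point of the translate by
  \<open>\<alpha>\<close> to the translate by \<open>\<beta>\<close>, then \<open>\<beta>\<inverse> \<gamma> \<alpha>\<close> returns a point of \<open>P\<close> to \<open>P\<close>.\<close>

lemma properly_discontinuous_action: "properly_discontinuous (free_group g) \<rho> D"
  unfolding properly_discontinuous_def
proof (intro allI impI)
  interpret group "free_group g" by (rule group_free_group)
  fix K assume K: "compact K \<and> K \<subseteq> D"
  have "\<forall>x\<in>K. \<exists>V S. open V \<and> x \<in> V \<and> finite S \<and> S \<subseteq> carrier (free_group g) \<and>
    V \<inter> sphere 0 1 \<subseteq> (\<Union>\<alpha>\<in>S. act \<alpha> ` P)" using point_neighbourhood K by blast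
  then obtain V S where VS: "\<And>x. x \<in> K \<Longrightarrow> open (V x) \<and> x \<in> V x \<and> finite (S x) \<and> S x \<subseteq> carrier (free_group g) \<and>
    V x \<inter> sphere 0 1 \<subseteq> (\<Union>\<alpha>\<in>S x. act \<alpha> ` P)" by metis
  obtain F where F: "F \<subseteq> K" "finite F" "K \<subseteq> (\<Union>x\<in>F. V x)"
    using compactE_image[of K K V] K VS by blast
  define T where "T = (\<Union>x\<in>F. S x)"
  have finT: "finite T" and TG: "T \<subseteq> carrier (free_group g)" using F VS by (auto simp: T_def)
  have KT: "K \<subseteq> (\<Union>\<alpha>\<in>T. act \<alpha> ` P)"
  proof
    fix x assume x: "x \<in> K"
    then obtain y where "y \<in> F" "x \<in> V y" using F(3) by blast
    moreover have "x \<in> sphere 0 1" using x K D_sphere by blast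
    ultimately show "x \<in> (\<Union>\<alpha>\<in>T. act \<alpha> ` P)" using VS[of y] F(1) unfolding T_def by blast
  qed
  let ?h = "\<lambda>(\<beta>, \<delta>, \<alpha>). \<beta> \<otimes>\<^bsub>free_group g\<^esub> \<delta> \<otimes>\<^bsub>free_group g\<^esub> inv\<^bsub>free_group g\<^esub> \<alpha>"
  have "{\<gamma> \<in> carrier (free_group g). act \<gamma> ` K \<inter> K \<noteq> {}} \<subseteq> ?h ` (T \<times> short \<times> T)"
  proof
    fix \<gamma> assume "\<gamma> \<in> {\<gamma> \<in> carrier (free_group g). act \<gamma> ` K \<inter> K \<noteq> {}}"
    then obtain x where \<gamma>: "\<gamma> \<in> carrier (free_group g)" and x: "x \<in> K" "act \<gamma> x \<in> K" by blast
    obtain \<alpha> p where \<alpha>: "\<alpha> \<in> T" "p \<in> P" "x = act \<alpha> p" using KT x(1) by blast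
    obtain \<beta> q where \<beta>: "\<beta> \<in> T" "q \<in> P" "act \<gamma> x = act \<beta> q" using KT x(2) by blast
    have c: "\<alpha> \<in> carrier (free_group g)" "\<beta> \<in> carrier (free_group g)" using \<alpha> \<beta> TG by auto
    have s: "p \<in> sphere 0 1" "q \<in> sphere 0 1" using \<alpha> \<beta> P_sphere by auto
    let ?\<delta> = "inv\<^bsub>free_group g\<^esub> \<beta> \<otimes>\<^bsub>free_group g\<^esub> (\<gamma> \<otimes>\<^bsub>free_group g\<^esub> \<alpha>)"
    have "act ?\<delta> p = act (inv\<^bsub>free_group g\<^esub> \<beta>) (act \<gamma> (act \<alpha> p))"
      using act_mult[of "inv\<^bsub>free_group g\<^esub> \<beta>" "\<gamma> \<otimes>\<^bsub>free_group g\<^esub> \<alpha>" p] act_mult[of \<gamma> \<alpha> p] c \<gamma> s by simp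
    also have "\<dots> = act (inv\<^bsub>free_group g\<^esub> \<beta>) (act \<beta> q)" using \<alpha>(3) \<beta>(3) by simp
    also have "\<dots> = q"
      using act_mult[of "inv\<^bsub>free_group g\<^esub> \<beta>" \<beta> q] c s act_nil by (simp add: one_free_group)
    finally have "?\<delta> \<in> short" using returning_word_short[of ?\<delta> p] \<alpha>(2) \<beta>(2) c \<gamma> by simp
    moreover have "\<gamma> = ?h (\<beta>, ?\<delta>, \<alpha>)" using c \<gamma> by (simp add: m_assoc inv_solve_right flip: m_assoc)
    ultimately show "\<gamma> \<in> ?h ` (T \<times> short \<times> T)" using \<alpha>(1) \<beta>(1) by blast
  qed
  then show "finite {\<gamma> \<in> carrier (free_group g). act \<gamma> ` K \<inter> K \<noteq> {}}"
    using finT finite_short by (meson finite_SigmaI finite_imageI finite_subset)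
qed

text \<open>A point of a wall is not interior, because the open halfspace adheres to it and, near \<open>P\<close>, consists
  of points of \<open>D\<close>.\<close>

lemma interior_P: "top_of_set D interior_of P = {x \<in> P. \<forall>s. fst s < g \<longrightarrow> x \<notin> C s}"
proof
  let ?U = "- (\<Union>s\<in>{s. fst s < g}. C s)"
  let ?Q = "{x \<in> P. \<forall>s. fst s < g \<longrightarrow> x \<notin> C s}"
  have "open ?U" using closed(1) finite_letters by (intro open_Compl closed_UN) auto
  moreover have Q: "?Q = D \<inter> ?U"
  proof (intro equalityI subsetI)
    fix x assume x: "x \<in> D \<inter> ?U"
    then have out: "x \<notin> C s" if "fst s < g" for s using that by blast
    then have "x \<in> C' s" if "fst s < g" for s using cover[OF that] that by blast
    then show "x \<in> ?Q" using x out D_sphere unfolding P_def by blast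
  qed (use P_subset_D in blast)
  ultimately have "openin (top_of_set D) ?Q" unfolding Q by (intro openin_open_Int)
  then show "?Q \<subseteq> top_of_set D interior_of P" by (intro interior_of_maximal) auto
  show "top_of_set D interior_of P \<subseteq> ?Q"
  proof
    fix x assume xi: "x \<in> top_of_set D interior_of P"
    then have x: "x \<in> P" using interior_of_subset[of "top_of_set D" P] by (rule subsetD[rotated])
    obtain U where U: "open U" "x \<in> U" "U \<inter> sphere 0 1 \<subseteq> (\<Union>\<delta>\<in>short. act \<delta> ` P)"
      using neighbourhood[OF x] by blast
    have "openin (top_of_set D) (top_of_set D interior_of P)" by simp
    then obtain V where V: "open V" "top_of_set D interior_of P = D \<inter> V" unfolding openin_open by blast
    have "x \<notin> C s" if s: "fst s < g" for s
    proof
      assume "x \<in> C s"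
      then have "x \<in> sphere 0 1 \<inter> C s \<inter> C' s" using x s by (simp add: P_def)
      moreover have "open (U \<inter> V)" by (rule open_Int[OF U(1) V(1)])
      moreover have "x \<in> U \<inter> V" using U(2) V(2) xi by blast
      ultimately obtain y where y: "y \<in> sphere 0 1" "y \<in> U \<inter> V" "y \<notin> C' s"
        using adherent[OF s] by blast
      have "y \<in> D" using y U(3) translate_subset_D short_carrier by blast
      then have "y \<in> P" using V(2) y(2) interior_of_subset[of "top_of_set D" P] by blast
      then show False using y(3) s by (simp add: P_def)
    qed
    then show "x \<in> ?Q" using x by blast
  qed
qed

lemma closedin_P: "closedin (top_of_set D) P"
  using compact_imp_closed[OF compact_P] P_subset_D by (simp add: closed_subset)

lemma fundamental_domain_P: "fundamental_domain (free_group g) \<rho> D P"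
  unfolding fundamental_domain_def
proof (intro conjI ballI impI closedin_P D_def)
  fix \<gamma> assume \<gamma>: "\<gamma> \<in> carrier (free_group g)" "\<gamma> \<noteq> \<one>\<^bsub>free_group g\<^esub>"
  then obtain s w where w: "\<gamma> = s # w" by (cases \<gamma>) (auto simp: one_free_group)
  have s: "fst s < g" using Cons_free_group(1)[of s w] \<gamma> w letter_carrier by blast
  have "act \<gamma> ` P \<subseteq> C s" using word_maps_into \<gamma> w by blast
  moreover have "top_of_set D interior_of (act \<gamma> ` P) \<subseteq> act \<gamma> ` P" by (rule interior_of_subset)
  ultimately show "top_of_set D interior_of P \<inter> top_of_set D interior_of (act \<gamma> ` P) = {}"
    unfolding interior_P using s by blast
qed

lemma frontier_P: "top_of_set D frontier_of P = (\<Union>s\<in>{s. fst s < g}. sphere 0 1 \<inter> C s \<inter> C' s)"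
proof -
  have "top_of_set D frontier_of P = P - {x \<in> P. \<forall>s. fst s < g \<longrightarrow> x \<notin> C s}"
    unfolding frontier_of_def interior_P using closure_of_closedin[OF closedin_P] by simp
  also have "\<dots> = (\<Union>s\<in>{s. fst s < g}. sphere 0 1 \<inter> C s \<inter> C' s)"
  proof (intro equalityI subsetI)
    fix x assume "x \<in> (\<Union>s\<in>{s. fst s < g}. sphere 0 1 \<inter> C s \<inter> C' s)"
    then obtain s where s: "fst s < g" "x \<in> sphere 0 1" "x \<in> C s" "x \<in> C' s" by blast
    have "x \<noteq> 0" using s(2) by auto
    then have "x \<in> C' t" if "fst t < g" for t
      using C_avoids[of s t x] s that by (cases "s = t") auto
    then show "x \<in> P - {x \<in> P. \<forall>s. fst s < g \<longrightarrow> x \<notin> C s}" using s by (auto simp: P_def)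
  next
    fix x assume "x \<in> P - {x \<in> P. \<forall>s. fst s < g \<longrightarrow> x \<notin> C s}"
    then obtain s where "fst s < g" "x \<in> C s" "x \<in> P" by blast
    then show "x \<in> (\<Union>s\<in>{s. fst s < g}. sphere 0 1 \<inter> C s \<inter> C' s)" unfolding P_def by blast
  qed
  finally show ?thesis .
qed

end

section \<open>The fundamental domain\<close>

theorem theorem1p5:
  fixes k g :: nat
    and A :: "nat \<Rightarrow> real ^ 2 ^ 2"
    and a b :: "nat \<Rightarrow> bool \<Rightarrow> (real ^ 2) set"
    and \<xi> :: "(real ^ 2) set \<Rightarrow> ('n::{finite,linorder}) oriented_flag"
    and \<rho> :: "(nat \<times> bool) list \<Rightarrow> real ^ 'n::{finite,linorder} ^ 'n::{finite,linorder}"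
    and P D :: "(real ^ 'n::{finite,linorder}) set"
  assumes "CARD('n) = 4 * k + 3"
    and "g \<ge> 1"
    and "purely_hyperbolic_schottky g A a b \<xi> \<rho>"
    and "P = sphere 0 1 - (\<Union>j<g. \<Union>s. halfspace k (\<xi> (a j s)) (\<xi> (b j s)))"
    and "D = (\<Union>\<gamma> \<in> carrier (free_group g). sphere_act (\<rho> \<gamma>) ` P)"
  shows "properly_discontinuous (free_group g) \<rho> D \<and>
         cocompact (free_group g) \<rho> D \<and>
         (\<exists>K \<H>. fundamental_domain (free_group g) \<rho> D K \<and>
            finite \<H> \<and> (\<forall>H \<in> \<H>. polyhedral_hypersurface H) \<and>
            top_of_set D frontier_of K = \<Union>\<H>)"
proof -
  note n = assms(1) and schottky = assms(3) and P = assms(4) and D = assms(5)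
  have odd: "odd CARD('n)" using n by simp
  note props = schottky[unfolded purely_hyperbolic_schottky_def]
  have S: "schottky_intervals g A a b" using props by (rule conjunct1)
  have hom: "\<rho> \<in> Group.hom (free_group g) SL" using props by blast
  have endp: "a j s \<in> endpoints g a b" "b j s \<in> endpoints g a b" if "j < g" for j s
    using that by (auto simp: endpoints_def)
  have "\<forall>x \<in> endpoints g a b. \<xi> x \<in> oriented_flags" using props by blast
  then have flags: "\<xi> (a j s) \<in> oriented_flags \<and> \<xi> (b j s) \<in> oriented_flags" if "j < g" for j s
    using endp[OF that] by blast
  have hc: "\<forall>x \<in> endpoints g a b. \<forall>y \<in> endpoints g a b. \<forall>z \<in> endpoints g a b.
      positively_ordered x y z \<longrightarrow> hyperconvex (\<xi> x) (\<xi> y) (\<xi> z)" using props by blast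
  have "\<forall>j < g. flag_act (\<rho> [(j, True)]) (\<xi> (b j False)) = \<xi> (a j True) \<and>
              flag_act (\<rho> [(j, True)]) (\<xi> (a j False)) = \<xi> (b j True)" using props by blast
  then have eqv: "flag_act (\<rho> [(j, True)]) (\<xi> (b j False)) = \<xi> (a j True)"
    "flag_act (\<rho> [(j, True)]) (\<xi> (a j False)) = \<xi> (b j True)" if "j < g" for j using that by blast+
  have hyp: "hyperconvex (\<xi> (a i s)) (\<xi> (a j t)) (\<xi> (b j t))" if "i < g" "j < g" "(i, s) \<noteq> (j, t)" for i j s t
    using hc[rule_format, OF endp(1)[OF that(1)] endp(1)[OF that(2)] endp(2)[OF that(2)] schottky_intervals_ordered[OF S that]] .
  have "\<exists>e. adapted_basis (\<xi> (a j True)) (\<xi> (b j True)) e" if j: "j < g" for j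
  proof (rule exists_adapted_basis)
    show "\<xi> (a j True) \<in> oriented_flags" "\<xi> (b j True) \<in> oriented_flags" using flags[OF j] by auto
    fix i x y
    assume i: "1 \<le> i" "i < CARD('n)" and x: "x \<in> snd (\<xi> (a j True) i)" and y: "y \<in> snd (\<xi> (b j True) (CARD('n) - i))"
    \<comment> \<open>The zero-dimensional step of a third flag turns hyperconvexity into transversality.\<close>
    have h: "hyperconvex (\<xi> (a j False)) (\<xi> (a j True)) (\<xi> (b j True))" using hyp j by blast
    have "bracket ([] @ x @ y) > 0"
      by (rule hyperconvex_bracket[OF h, of 0 i "CARD('n) - i"]) (use flags[OF j] flag_0 i x y in auto)
    then show "bracket (x @ y) > 0" by simp
  qed (rule odd)
  then obtain Ep where Ep: "\<And>j. j < g \<Longrightarrow> adapted_basis (\<xi> (a j True)) (\<xi> (b j True)) (Ep j)" by metis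
  \<comment> \<open>The basis for \<open>(j, False)\<close> is obtained from that for \<open>(j, True)\<close> by the inverse of the generator and
    \<open>alt_rev\<close>, so that \<open>\<rho> [s]\<close> moves \<open>alt_rev\<close> of the basis for the inverse letter exactly to the basis for \<open>s\<close>.\<close>
  define h where "h s = (\<lambda>x. \<rho> [s] *v x)" for s
  have carr: "[(j, s)] \<in> carrier (free_group g)" if "j < g" for j s using that by (simp add: carrier_free_group)
  have \<rho>_nil: "\<rho> [] = Finite_Cartesian_Product.mat 1"
    using hom_SL_empty_word[OF hom] by (simp add: matrix_eq)
  have inv_mat: "\<rho> [(j, \<not> s)] ** \<rho> [(j, s)] = Finite_Cartesian_Product.mat 1" if "j < g" for j s
  proof -
    have "\<rho> ([(j, \<not> s)] \<otimes>\<^bsub>free_group g\<^esub> [(j, s)]) = \<rho> [(j, \<not> s)] ** \<rho> [(j, s)]"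
      using hom carr[OF that] by (simp add: hom_def SL_def)
    then show ?thesis using \<rho>_nil by (simp add: mult_free_group cancel_cons_Cons inv_letter_def)
  qed
  have hh: "h (j, \<not> s) (h (j, s) v) = v" if "j < g" for j s v
    using inv_mat[OF that, of s] by (simp add: h_def matrix_vector_mul_assoc)
  have det1: "Determinants.det (\<rho> [(j, s)]) = 1" if "j < g" for j s
    using hom carr[OF that] by (auto simp: hom_def SL_def Pi_def)
  have lin: "linear (h s)" for s by (simp add: h_def)
  define E where "E s = (if snd s then Ep (fst s) else alt_rev (map (h (fst s, False)) (Ep (fst s))))" for s
  have adE: "adapted_basis (\<xi> (a j s)) (\<xi> (b j s)) (E (j, s))" if j: "j < g" for j s
  proof (cases s)
    case False
    have "adapted_basis (flag_act (\<rho> [(j, False)]) (\<xi> (a j True))) (flag_act (\<rho> [(j, False)]) (\<xi> (b j True)))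
        (map (h (j, False)) (Ep j))"
      unfolding h_def by (rule adapted_basis_flag_act[OF Ep[OF j] det1[OF j]])
    moreover have "flag_act (\<rho> [(j, False)]) (\<xi> (a j True)) = \<xi> (b j False)"
      "flag_act (\<rho> [(j, False)]) (\<xi> (b j True)) = \<xi> (a j False)"
      using flag_act_inverse[OF inv_mat[OF j, of True], of "\<xi> (b j False)"]
        flag_act_inverse[OF inv_mat[OF j, of True], of "\<xi> (a j False)"] flags[OF j] unfolding eqv[OF j] by simp_all
    ultimately have "adapted_basis (\<xi> (b j False)) (\<xi> (a j False)) (map (h (j, False)) (Ep j))" by simp
    then show ?thesis using adapted_basis_alt_rev[OF _ _ _ odd] flags[OF j] False by (simp add: E_def)
  qed (use Ep j in \<open>simp add: E_def\<close>)
  have ob: "E s \<in> ordered_bases UNIV" if "fst s < g" for s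
    using adapted_basisD(3)[OF adE[OF that, of "snd s"]] by simp
  have ob': "alt_rev (E s) \<in> ordered_bases UNIV" if "fst s < g" for s by (rule alt_rev_ordered_bases[OF ob[OF that]])
  have lenE: "length (E s) = CARD('n)" if "fst s < g" for s using ob[OF that] ordered_bases_UNIV_iff by blast
  have EE: "E s = map (h s) (alt_rev (E (inv_letter s)))" if s: "fst s < g" for s
  proof (cases "snd s")
    case True
    have "alt_rev (E (inv_letter s)) = map (h (fst s, False)) (Ep (fst s))"
      using True lenE[of "inv_letter s"] s odd adapted_basisD(1)[OF Ep[OF s]]
      by (simp add: E_def inv_letter_def alt_rev_alt_rev)
    moreover have "s = (fst s, True)" using True by (metis prod.collapse)
    ultimately show ?thesis using True hh[OF s, of False] by (simp add: E_def o_def map_idI)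
  next
    case False
    then have "s = (fst s, False)" by (metis prod.collapse)
    then show ?thesis using False alt_rev_map[OF lin, of s "Ep (fst s)"] by (simp add: E_def inv_letter_def)
  qed
  define C where "C s = closed_half k (E s)" for s
  define C' where "C' s = closed_half k (alt_rev (E s))" for s
  interpret pp: ping_pong g \<rho> C C'
  proof
    show "\<rho> \<in> Group.hom (free_group g) SL" by (rule hom)
    fix s :: "nat \<times> bool" assume s: "fst s < g"
    show "closed (C s)" "closed (C' s)" unfolding C_def C'_def using closed_closed_half ob ob' s by blast+
    show "v \<in> C s \<or> v \<in> C' s" for v unfolding C_def C'_def by (rule closed_half_cover[OF n ob[OF s]])
    show "sgn v \<in> C s \<longleftrightarrow> v \<in> C s" "sgn v \<in> C' s \<longleftrightarrow> v \<in> C' s" for v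
      unfolding C_def C'_def using sgn_closed_half_iff ob ob' s by blast+
    show "C s \<inter> C t \<subseteq> {0}" if t: "fst t < g" "s \<noteq> t" for t
      unfolding C_def
    proof (rule closed_halves_disjoint[OF n])
      show "adapted_basis (\<xi> (a (fst s) (snd s))) (\<xi> (b (fst s) (snd s))) (E s)"
        "adapted_basis (\<xi> (a (fst t) (snd t))) (\<xi> (b (fst t) (snd t))) (E t)"
        using adE[OF s, of "snd s"] adE[OF t(1), of "snd t"] by simp_all
      show "hyperconvex (\<xi> (a (fst s) (snd s))) (\<xi> (a (fst t) (snd t))) (\<xi> (b (fst t) (snd t)))"
        "hyperconvex (\<xi> (a (fst t) (snd t))) (\<xi> (a (fst s) (snd s))) (\<xi> (b (fst s) (snd s)))"
        using hyp[of "fst s" "fst t" "snd s" "snd t"] hyp[of "fst t" "fst s" "snd t" "snd s"] s t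
        by (auto simp: prod_eq_iff)
    qed (use flags s t in auto)
    show "\<rho> [s] *v v \<in> C s \<longleftrightarrow> v \<in> C' (inv_letter s)" for v
    proof -
      have i: "fst (inv_letter s) < g" using s by (simp add: inv_letter_def)
      have m: "map (\<lambda>x. \<rho> [s] *v x) (alt_rev (E (inv_letter s))) = E s" using EE[OF s] by (simp add: h_def)
      show ?thesis
        unfolding C_def C'_def m[symmetric]
        by (rule closed_half_matrix[OF ob'[OF i]]) (use m ob[OF s] in simp)
    qed
    show "\<exists>y \<in> sphere 0 1 \<inter> U. y \<notin> C' s"
      if "x \<in> sphere 0 1 \<inter> C s \<inter> C' s" "open U" "x \<in> U" for x U
      using wall_in_closure[OF n ob[OF s], of x U] that by (simp add: wall_def C_def C'_def)
  qed
  have Peq: "P = pp.P"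
  proof -
    have "halfspace k (\<xi> (a j s)) (\<xi> (b j s)) = sphere 0 1 - C' (j, s)" if "j < g" for j s
      unfolding C'_def using halfspace_eq[OF n _ _ adE[OF that]] flags[OF that] by blast
    then have "P = sphere 0 1 - (\<Union>j<g. \<Union>s. sphere 0 1 - C' (j, s))" unfolding P by simp
    then show ?thesis unfolding pp.P_def by auto
  qed
  have Deq: "D = pp.D" unfolding D pp.D_def Peq ..
  let ?H = "(\<lambda>s. wall k (E s)) ` {s. fst s < g}"
  have "finite ?H" using pp.finite_letters by simp
  moreover have "\<forall>H\<in>?H. polyhedral_hypersurface H" using polyhedral_hypersurface_wall[OF n ob] by auto
  moreover have "top_of_set D frontier_of P = \<Union>?H"
    unfolding Deq Peq pp.frontier_P by (simp add: wall_def C_def C'_def)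
  ultimately show ?thesis
    using pp.properly_discontinuous_action pp.cocompact_action pp.fundamental_domain_P
    unfolding Deq Peq by blast
qed

end
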